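(* Let $\Omega\subset\mathbb{R}^3$ be a domain with smooth (infinitely differentiable) compact boundary, and let $h:\partial\Omega\to(0,\infty)$ be a smooth function such that for each $\mathbf{y}\in\partial\Omega$ the segment $\{\mathbf{y}+t\hat{\mathbf{n}}(\mathbf{y}):t\in[0,h(\mathbf{y})]\}$ meets $\partial\Omega$ only at $\mathbf{y}$. Put $\mathbf{y}'=\mathbf{y}+h(\mathbf{y})\hat{\mathbf{n}}(\mathbf{y})$. For $\mathbf{x}$ not on the half-line emanating from $\mathbf{y}$ in the direction $\hat{\mathbf{n}}(\mathbf{y})$, $$\Sigma^{B,3}_{jk}(\mathbf{x},\mathbf{y};h(\mathbf{y}))=2\hat{\mathbf{n}}_i(\mathbf{x})\Big[T^{S,3}_{ijk}(\mathbf{x},\mathbf{y})-T^{S,3}_{ijk}(\mathbf{x},\mathbf{y}')+h(\mathbf{y})\,\hat{\mathbf{n}}(\mathbf{y})\cdot\nabla_{\mathbf{y}'}T^{S,3}_{ijk}(\mathbf{x},\mathbf{y}')\Big]+(1-\alpha)\hat K_{jk}(\mathbf{x},\mathbf{y}),$$ where $\hat K_{jk}$ is a kernel corresponding to a compact operator. In particular, the integral equation $$\rho_j(\mathbf{x})+\int_{\partial\Omega}\Sigma^{B,3}_{jk}(\mathbf{x},\mathbf{y};h(\mathbf{y}))\,\rho_k(\mathbf{y})\,dS(\mathbf{y})=f_j(\mathbf{x})\qquad(\mathrm{E}_\alpha)$$ is a compact perturbation of the integral equation arising in the Stokes traction boundary value problem when the velocity is represented using the Stokes single-layer potential, and in the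 limit $\alpha\to1^-$ (i.e. $\lambda\to\infty$ with $\mu$ fixed) the integral operator converges to that of the equation $$\begin{aligned}\rho_i(\mathbf{x})&-\frac{3}{2\pi}\int_{\partial\Omega}\hat{\mathbf{n}}_j(\mathbf{x})\frac{(x_i-y_i)(x_j-y_j)(x_k-y_k)}{|\mathbf{x}-\mathbf{y}|^5}\,\rho_k(\mathbf{y})\,dS(\mathbf{y})\\&=f_i(\mathbf{x})-\frac{3}{2\pi}\int_{\partial\Omega}\hat{\mathbf{n}}_j(\mathbf{x})\frac{(x_i-y'_i)(x_j-y'_j)(x_k-y'_k)}{|\mathbf{x}-\mathbf{y}'|^5}\,\rho_k(\mathbf{y})\,dS(\mathbf{y})\\&\quad+\frac{3}{2\pi}\int_{\partial\Omega}h(\mathbf{y})\,\hat{\mathbf{n}}_j(\mathbf{x})\,\hat{\mathbf{n}}_\ell(\mathbf{y})\,\partial_{y'_\ell}\!\left[\frac{(x_i-y'_i)(x_j-y'_j)(x_k-y'_k)}{|\mathbf{x}-\mathbf{y}'|^5}\right]\rho_k(\mathbf{y})\,dS(\mathbf{y}).\qquad(\mathrm{E}_1)\end{aligned}$$ In particular, if $(\mathrm{E}_1)$ is invertible, then $(\mathrm{E}_\alpha)$ is invertible for all $\alpha$ sufficiently close to $1$.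
   Context: Einstein summation is used. $\Omega$ may be bounded or unbounded; $\hat{\mathbf{n}}$ is the unit normal on $\partial\Omega$ pointing out of $\Omega$. The Lamé parameters are $\lambda,\mu$, and $\alpha=\frac{\lambda+\mu}{\lambda+2\mu}\in(1/4,1)$. The integral equations are posed for an unknown density $\rho\in L^2(\partial\Omega;\mathbb{R}^3)$ with given $f\in L^2(\partial\Omega;\mathbb{R}^3)$, and operators act on $L^2(\partial\Omega;\mathbb{R}^3)$. Stress of a vector field $u$: $\sigma_{ij}[u]=\lambda\delta_{ij}\frac{\partial u_k}{\partial x_k}+\mu\left(\frac{\partial u_j}{\partial x_i}+\frac{\partial u_i}{\partial x_j}\right)$. For a matrix-valued $G(\mathbf{x})$, $\sigma$ acts columnwise in $\mathbf{x}$, and $\sigma[G]_{ijk}$ is the $(i,j)$ stress component of the $k$-th column. Let $\mathbf{r}=\mathbf{x}-\mathbf{y}$, $r=|\mathbf{r}|$, $\hat{\mathbf{v}}$ a unit vector, $Q_{\hat{\mathbf{v}}}=\mathrm{I}_3-\hat{\mathbf{v}}\hat{\mathbf{v}}^T$, $R=r-\mathbf{r}\cdot\hat{\mathbf{v}}$. Define $$G^{B,3}(\mathbf{x},\mathbf{y};\hat{\mathbf{v}})=\frac{1}{4\pi\mu}\left[\frac{\mathrm{I}_3}{r}+\frac{\mathbf{r}\mathbf{r}^T}{r^3}\right]+\frac{1}{4\pi\mu}\frac{1-\alpha}{\alpha}\left[\frac1R\mathrm{I}_3+\frac{\mathbf{r}\hat{\mathbf{v}}^T-\hat{\mathbf{v}}\mathbf{r}^T-(\mathbf{r}\cdot\hat{\mathbf{v}})\hat{\mathbf{v}}\hat{\mathbf{v}}^T}{rR}-\frac{Q_{\hat{\mathbf{v}}}\mathbf{r}\mathbf{r}^TQ_{\hat{\mathbf{v}}}}{rR^2}\right],$$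 $$K^{B,3}(\mathbf{x},\mathbf{y};\hat{\mathbf{v}},h)=\int_0^ht\,\hat{\mathbf{v}}\cdot\nabla_{\mathbf{y}}\big(\hat{\mathbf{v}}\cdot\nabla_{\mathbf{y}}G^{B,3}(\mathbf{x},\mathbf{y}+t\hat{\mathbf{v}};\hat{\mathbf{v}})\big)\,dt\qquad(h>0),$$ for $\mathbf{x}$ off the segment $\{\mathbf{y}+t\hat{\mathbf{v}}:t\in[0,h]\}$ (derivatives act on the source variable with $\hat{\mathbf{v}}$ fixed; removable singularities of the integrand are filled in by continuity). For $\mathbf{x}\neq\mathbf{y}$ in $\partial\Omega$, $\Sigma^{B,3}_{jk}(\mathbf{x},\mathbf{y};h)=\hat{\mathbf{n}}_i(\mathbf{x})\,\sigma[K^{B,3}(\cdot,\mathbf{y};\hat{\mathbf{n}}(\mathbf{y}),h)]_{ijk}(\mathbf{x})$. $T^{S,3}_{ijk}(\mathbf{x},\mathbf{y})=-\frac{3r_ir_jr_k}{4\pi r^5}$ is the traction kernel of the three-dimensional Stokes single-layer potential. The Stokes traction integral equation referred to is, up to normalization, the one whose left-hand side is the left-hand side of $(\mathrm{E}_1)$, with the given traction data on the right. In expressions with $\nabla_{\mathbf{y}'}$ or $\partial_{y'_\ell}$, the derivative is taken with respect to the source point $\mathbf{y}'$, treated as an independent variable, with $\hat{\mathbf{n}}(\mathbf{y})$ and $h(\mathbf{y})$ fixed. *)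

theory Defs
  imports "HOL-Analysis.Analysis"
begin

section \<open>Differential operators\<close>

definition pdiff :: "3 \<Rightarrow> (real^3 \<Rightarrow> 'b::real_normed_vector) \<Rightarrow> real^3 \<Rightarrow> 'b" where
  "pdiff l f x = frechet_derivative f (at x) (axis l 1)"

definition ddiff :: "real^3 \<Rightarrow> (real^3 \<Rightarrow> 'b::real_normed_vector) \<Rightarrow> real^3 \<Rightarrow> 'b" where
  "ddiff v f x = (\<Sum>l\<in>UNIV. v $ l *\<^sub>R pdiff l f x)"

definition grad :: "(real^3 \<Rightarrow> real) \<Rightarrow> real^3 \<Rightarrow> real^3" where
  "grad f x = (\<chi> l. pdiff l f x)"

section \<open>Smooth functions and smooth domains\<close>

text \<open>The set \<open>U\<close> is meant to be open.\<close>

primrec Ck_on :: "nat \<Rightarrow> (real^3) set \<Rightarrow> (real^3 \<Rightarrow> real) \<Rightarrow> bool" where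
  "Ck_on 0 U f \<longleftrightarrow> continuous_on U f"
| "Ck_on (Suc n) U f \<longleftrightarrow> f differentiable_on U \<and> (\<forall>l. Ck_on n U (pdiff l f))"

definition Cinf_on :: "(real^3) set \<Rightarrow> (real^3 \<Rightarrow> real) \<Rightarrow> bool" where
  "Cinf_on U f \<longleftrightarrow> (\<forall>n. Ck_on n U f)"

text \<open>Smoothness of a function on a submanifold: locally the restriction of a smooth
  function of the ambient space.\<close>

definition smooth_along :: "(real^3) set \<Rightarrow> (real^3 \<Rightarrow> real) \<Rightarrow> bool" where
  "smooth_along S h \<longleftrightarrow>
     (\<forall>p\<in>S. \<exists>U g. open U \<and> p \<in> U \<and> Cinf_on U g \<and> (\<forall>x\<in>S \<inter> U. h x = g x))"

definition defining_function ::
    "(real^3) set \<Rightarrow> real^3 \<Rightarrow> (real^3) set \<Rightarrow> (real^3 \<Rightarrow> real) \<Rightarrow> bool" where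
  "defining_function \<Omega> p U \<phi> \<longleftrightarrow>
     open U \<and> p \<in> U \<and> Cinf_on U \<phi> \<and> (\<forall>x\<in>U. grad \<phi> x \<noteq> 0) \<and>
     \<Omega> \<inter> U = {x\<in>U. \<phi> x < 0} \<and> frontier \<Omega> \<inter> U = {x\<in>U. \<phi> x = 0}"

definition smooth_domain :: "(real^3) set \<Rightarrow> bool" where
  "smooth_domain \<Omega> \<longleftrightarrow> open \<Omega> \<and> connected \<Omega> \<and> \<Omega> \<noteq> {} \<and>
     (\<forall>p\<in>frontier \<Omega>. \<exists>U \<phi>. defining_function \<Omega> p U \<phi>)"

text \<open>The normal does not depend on the chosen defining function, and points out of \<open>\<Omega>\<close>
  because the defining function is negative inside.\<close>

definition outward_normal :: "(real^3) set \<Rightarrow> real^3 \<Rightarrow> real^3" where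
  "outward_normal \<Omega> p =
     (THE \<nu>. \<exists>U \<phi>. defining_function \<Omega> p U \<phi> \<and> \<nu> = grad \<phi> p /\<^sub>R norm (grad \<phi> p))"

definition half_line :: "real^3 \<Rightarrow> real^3 \<Rightarrow> (real^3) set" where
  "half_line y v = {y + s *\<^sub>R v | s. 0 \<le> s}"

section \<open>Surface measure\<close>

text \<open>Two-dimensional Hausdorff measure, with the factor \<open>\<pi>/4\<close> that makes it agree with
  surface area on smooth surfaces. As a metric outer measure it is countably additive on the
  Borel sets, so \<open>measure_of\<close> below keeps its values.\<close>

definition hausdorff2_pre :: "real \<Rightarrow> (real^3) set \<Rightarrow> ennreal" where
  "hausdorff2_pre \<delta> A =
     (INF C\<in>{C :: nat \<Rightarrow> (real^3) set. A \<subseteq> (\<Union>i. C i) \<and> (\<forall>i. bounded (C i) \<and> diameter (C i) \<le> \<delta>)}.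
        \<Sum>i. ennreal (pi / 4 * (diameter (C i))\<^sup>2))"

definition hausdorff2 :: "(real^3) set \<Rightarrow> ennreal" where
  "hausdorff2 A = (SUP \<delta>\<in>{0<..}. hausdorff2_pre \<delta> A)"

definition hausdorff2_measure :: "(real^3) measure" where
  "hausdorff2_measure = measure_of UNIV (sets borel) hausdorff2"

definition surface_measure :: "(real^3) set \<Rightarrow> (real^3) measure" where
  "surface_measure \<Omega> = restrict_space hausdorff2_measure (frontier \<Omega>)"

section \<open>Operators on square-integrable vector fields\<close>

text \<open>Elements of \<open>L\<^sup>2(M; \<real>\<^sup>3)\<close> are represented by functions; equality of elements is
  equality almost everywhere.\<close>

definition L2 :: "(real^3) measure \<Rightarrow> (real^3 \<Rightarrow> real^3) set" where
  "L2 M = {f \<in> borel_measurable M. integrable M (\<lambda>x. (norm (f x))\<^sup>2)}"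

definition L2_norm :: "(real^3) measure \<Rightarrow> (real^3 \<Rightarrow> real^3) \<Rightarrow> real" where
  "L2_norm M f = sqrt (\<integral>x. (norm (f x))\<^sup>2 \<partial>M)"

type_synonym field_op = "(real^3 \<Rightarrow> real^3) \<Rightarrow> (real^3 \<Rightarrow> real^3)"

definition L2_linear :: "(real^3) measure \<Rightarrow> field_op \<Rightarrow> bool" where
  "L2_linear M A \<longleftrightarrow>
     (\<forall>f\<in>L2 M. A f \<in> L2 M) \<and>
     (\<forall>f\<in>L2 M. \<forall>g\<in>L2 M. AE x in M. A (\<lambda>z. f z + g z) x = A f x + A g x) \<and>
     (\<forall>f\<in>L2 M. \<forall>c. AE x in M. A (\<lambda>z. c *\<^sub>R f z) x = c *\<^sub>R A f x)"

definition L2_bounded :: "(real^3) measure \<Rightarrow> field_op \<Rightarrow> bool" where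
  "L2_bounded M A \<longleftrightarrow> L2_linear M A \<and> (\<exists>C. \<forall>f\<in>L2 M. L2_norm M (A f) \<le> C * L2_norm M f)"

definition L2_compact :: "(real^3) measure \<Rightarrow> field_op \<Rightarrow> bool" where
  "L2_compact M A \<longleftrightarrow> L2_linear M A \<and>
     (\<forall>f :: nat \<Rightarrow> real^3 \<Rightarrow> real^3. \<forall>C. (\<forall>n. f n \<in> L2 M \<and> L2_norm M (f n) \<le> C) \<longrightarrow>
        (\<exists>s g. strict_mono s \<and> g \<in> L2 M \<and>
           (\<lambda>n. L2_norm M (\<lambda>x. A (f (s n)) x - g x)) \<longlonglongrightarrow> 0))"

definition L2_invertible :: "(real^3) measure \<Rightarrow> field_op \<Rightarrow> bool" where
  "L2_invertible M A \<longleftrightarrow> L2_bounded M A \<and>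
     (\<exists>B. L2_bounded M B \<and>
        (\<forall>f\<in>L2 M. (AE x in M. A (B f) x = f x) \<and> (AE x in M. B (A f) x = f x)))"

definition L2_opnorm :: "(real^3) measure \<Rightarrow> field_op \<Rightarrow> ennreal" where
  "L2_opnorm M A = (SUP f\<in>{f \<in> L2 M. L2_norm M f \<le> 1}. ennreal (L2_norm M (A f)))"

definition kernel_op :: "(real^3) measure \<Rightarrow> (real^3 \<Rightarrow> real^3 \<Rightarrow> real^3^3) \<Rightarrow> field_op" where
  "kernel_op M k \<rho> x = (\<integral>y. k x y *v \<rho> y \<partial>M)"

text \<open>Since a divergent Bochner integral is \<open>0\<close> by convention, convergence of the integrals
  has to be demanded separately.\<close>

definition L2_kernel :: "(real^3) measure \<Rightarrow> (real^3 \<Rightarrow> real^3 \<Rightarrow> real^3^3) \<Rightarrow> bool" where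
  "L2_kernel M k \<longleftrightarrow>
     (\<forall>\<rho>\<in>L2 M. AE x in M. integrable M (\<lambda>y. k x y *v \<rho> y)) \<and> L2_bounded M (kernel_op M k)"

definition L2_compact_kernel :: "(real^3) measure \<Rightarrow> (real^3 \<Rightarrow> real^3 \<Rightarrow> real^3^3) \<Rightarrow> bool" where
  "L2_compact_kernel M k \<longleftrightarrow> L2_kernel M k \<and> L2_compact M (kernel_op M k)"

section \<open>Elastic kernels\<close>

definition lame_alpha :: "real \<Rightarrow> real \<Rightarrow> real" where
  "lame_alpha lam mu = (lam + mu) / (lam + 2 * mu)"

text \<open>This forces \<open>mu \<noteq> 0\<close>; for \<open>mu > 0\<close> it says \<open>3 lam + 2 mu > 0\<close>.\<close>

definition elastic :: "real \<Rightarrow> real \<Rightarrow> bool" where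
  "elastic lam mu \<longleftrightarrow> 1 / 4 < lame_alpha lam mu \<and> lame_alpha lam mu < 1"

definition stress :: "real \<Rightarrow> real \<Rightarrow> (real^3 \<Rightarrow> real^3) \<Rightarrow> 3 \<Rightarrow> 3 \<Rightarrow> real^3 \<Rightarrow> real" where
  "stress lam mu u i j x =
     lam * (if i = j then 1 else 0) * (\<Sum>k\<in>UNIV. pdiff k (\<lambda>z. u z $ k) x) +
     mu * (pdiff i (\<lambda>z. u z $ j) x + pdiff j (\<lambda>z. u z $ i) x)"

definition outer :: "real^3 \<Rightarrow> real^3 \<Rightarrow> real^3^3" where
  "outer a b = (\<chi> i j. a $ i * b $ j)"

definition G_B :: "real \<Rightarrow> real \<Rightarrow> real^3 \<Rightarrow> real^3 \<Rightarrow> real^3 \<Rightarrow> real^3^3" where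
  "G_B lam mu v x y =
    (let al = lame_alpha lam mu; r = x - y; R = norm r - r \<bullet> v; Q = mat 1 - outer v v in
      (1 / (4 * pi * mu)) *\<^sub>R ((1 / norm r) *\<^sub>R mat 1 + (1 / norm r ^ 3) *\<^sub>R outer r r) +
      (1 / (4 * pi * mu) * ((1 - al) / al)) *\<^sub>R
        ((1 / R) *\<^sub>R mat 1
         + (1 / (norm r * R)) *\<^sub>R (outer r v - outer v r - (r \<bullet> v) *\<^sub>R outer v v)
         - (1 / (norm r * R\<^sup>2)) *\<^sub>R (Q ** outer r r ** Q)))"

text \<open>The matrix \<open>G_B lam mu v x z\<close> is singular exactly when \<open>x\<close> lies on the half-line from
  \<open>z\<close> in direction \<open>v\<close>; away from \<open>z\<close> the singularity of the second derivative below is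
  removable in \<open>x\<close>.\<close>

definition K_integrand ::
    "real \<Rightarrow> real \<Rightarrow> real^3 \<Rightarrow> real^3 \<Rightarrow> real^3 \<Rightarrow> real \<Rightarrow> real^3^3" where
  "K_integrand lam mu v x y t =
    (let z = y + t *\<^sub>R v;
         D = (\<lambda>x'. t *\<^sub>R ddiff v (ddiff v (G_B lam mu v x')) z)
     in if x \<in> half_line z v then Lim (at x within - half_line z v) D else D x)"

definition K_B :: "real \<Rightarrow> real \<Rightarrow> real^3 \<Rightarrow> real \<Rightarrow> real^3 \<Rightarrow> real^3 \<Rightarrow> real^3^3" where
  "K_B lam mu v h x y = integral {0..h} (K_integrand lam mu v x y)"

definition Sigma_B ::
    "(real^3) set \<Rightarrow> real \<Rightarrow> real \<Rightarrow> (real^3 \<Rightarrow> real) \<Rightarrow> real^3 \<Rightarrow> real^3 \<Rightarrow> real^3^3" where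
  "Sigma_B \<Omega> lam mu h x y = (\<chi> j k. \<Sum>i\<in>UNIV. outward_normal \<Omega> x $ i *
     stress lam mu (\<lambda>x'. column k (K_B lam mu (outward_normal \<Omega> y) (h y) x' y)) i j x)"

definition T_S :: "3 \<Rightarrow> 3 \<Rightarrow> 3 \<Rightarrow> real^3 \<Rightarrow> real^3 \<Rightarrow> real" where
  "T_S i j k x y =
     (let r = x - y in - (3 * r $ i * r $ j * r $ k) / (4 * pi * norm r ^ 5))"

definition displaced :: "(real^3) set \<Rightarrow> (real^3 \<Rightarrow> real) \<Rightarrow> real^3 \<Rightarrow> real^3" where
  "displaced \<Omega> h y = y + h y *\<^sub>R outward_normal \<Omega> y"

section \<open>Integral equations\<close>

text \<open>The equation for elastic parameters is \<open>E_alpha \<Omega> lam mu h \<rho> = f\<close>.\<close>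

definition E_alpha :: "(real^3) set \<Rightarrow> real \<Rightarrow> real \<Rightarrow> (real^3 \<Rightarrow> real) \<Rightarrow> field_op" where
  "E_alpha \<Omega> lam mu h \<rho> x =
     \<rho> x + kernel_op (surface_measure \<Omega>) (Sigma_B \<Omega> lam mu h) \<rho> x"

definition cubic :: "3 \<Rightarrow> 3 \<Rightarrow> 3 \<Rightarrow> real^3 \<Rightarrow> real^3 \<Rightarrow> real" where
  "cubic i j k x y = (x - y) $ i * (x - y) $ j * (x - y) $ k / norm (x - y) ^ 5"

definition stokes_kernel :: "(real^3) set \<Rightarrow> real^3 \<Rightarrow> real^3 \<Rightarrow> real^3^3" where
  "stokes_kernel \<Omega> x y = (\<chi> i k. \<Sum>j\<in>UNIV. outward_normal \<Omega> x $ j * cubic i j k x y)"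

definition displaced_kernel ::
    "(real^3) set \<Rightarrow> (real^3 \<Rightarrow> real) \<Rightarrow> real^3 \<Rightarrow> real^3 \<Rightarrow> real^3^3" where
  "displaced_kernel \<Omega> h x y =
     (\<chi> i k. \<Sum>j\<in>UNIV. outward_normal \<Omega> x $ j * cubic i j k x (displaced \<Omega> h y))"

definition displaced_dipole_kernel ::
    "(real^3) set \<Rightarrow> (real^3 \<Rightarrow> real) \<Rightarrow> real^3 \<Rightarrow> real^3 \<Rightarrow> real^3^3" where
  "displaced_dipole_kernel \<Omega> h x y =
     (\<chi> i k. \<Sum>j\<in>UNIV. \<Sum>l\<in>UNIV. h y * outward_normal \<Omega> x $ j * outward_normal \<Omega> y $ l *
        pdiff l (cubic i j k x) (displaced \<Omega> h y))"

text \<open>The Stokes traction equation is \<open>stokes_op \<Omega> \<rho> = f\<close>, and the limiting equation is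
  \<open>stokes_op \<Omega> \<rho> = f + E1_rhs \<Omega> h \<rho>\<close>, that is, \<open>E_one \<Omega> h \<rho> = f\<close>.\<close>

definition stokes_op :: "(real^3) set \<Rightarrow> field_op" where
  "stokes_op \<Omega> \<rho> x =
     \<rho> x - (3 / (2 * pi)) *\<^sub>R kernel_op (surface_measure \<Omega>) (stokes_kernel \<Omega>) \<rho> x"

definition E1_rhs :: "(real^3) set \<Rightarrow> (real^3 \<Rightarrow> real) \<Rightarrow> field_op" where
  "E1_rhs \<Omega> h \<rho> x =
     - (3 / (2 * pi)) *\<^sub>R kernel_op (surface_measure \<Omega>) (displaced_kernel \<Omega> h) \<rho> x
     + (3 / (2 * pi)) *\<^sub>R kernel_op (surface_measure \<Omega>) (displaced_dipole_kernel \<Omega> h) \<rho> x"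

definition E_one :: "(real^3) set \<Rightarrow> (real^3 \<Rightarrow> real) \<Rightarrow> field_op" where
  "E_one \<Omega> h \<rho> x = stokes_op \<Omega> \<rho> x - E1_rhs \<Omega> h \<rho> x"

end

theory Submission
  imports Defs "HOL-Library.Diagonal_Subsequence" "HOL-Complex_Analysis.Great_Picard"
begin

text \<open>
  The second derivative of the Green's function along \<open>v\<close> is smooth away from the pole, and its part
  with coefficient \<open>(1 - \<alpha>) / \<alpha>\<close> consists of third derivatives of \<open>1 / r\<close>. Its stress is
  \<open>2 (v \<bullet> \<nabla>)\<^sup>2 T\<close> plus \<open>(1 - \<alpha>) / (4 \<pi> \<alpha>)\<close> times a kernel \<open>V\<close> of size \<open>1 / r\<^sup>4\<close>. Integrating the first
  term by parts against \<open>t\<close> gives the Stokes terms. The contraction of \<open>V\<close> with \<open>v = n(y)\<close> vanishes, so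
  contracting it with \<open>n(x)\<close> is the same as contracting it with \<open>n(x) - n(y)\<close>, which gains a factor
  \<open>|x - y|\<close>; after integration against \<open>t\<close> the remainder is \<open>O(1 / |x - y|)\<close>.

  The boundary is locally a Lipschitz graph, so its surface measure grows at most quadratically, and
  a kernel that is continuous off the diagonal and \<open>O(1 / |x - y|)\<close> is, by Schur's test, a norm limit of
  operators with continuous kernels, which are compact by Arzela-Ascoli. Finally, the operators of
  \<open>(E\<^sub>\<alpha>)\<close> and \<open>(E\<^sub>1)\<close> differ by \<open>(1 - \<alpha>) / \<alpha>\<close> times a fixed bounded operator.
\<close>

text \<open>The remainder operator is one fixed operator because the Lame parameters drop out of its
  kernel. The part of the Green's function without c = (1 - \<alpha>) / \<alpha> is a Stokeslet,
  hence divergence-free; the divergence of the rest is a multiple of c, and \<lambda> c / \<mu> = 1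
  - c makes all multiples of the identity in the stress cancel.

  The Green's function is singular on a whole half-line, which may meet the boundary again beyond
  the segment, while the operators integrate over every y. The kernel identity is therefore proved
  for all distinct boundary points, which requires that the limit taken on the half-line equals the
  explicit formula.

  The Stokes kernel looks like 1 / r^2; it is weakly singular because n(x) is orthogonal to x - y up
  to O(r^2), the same flatness that keeps the segment from y away from nearby x.

  Elements of L^2 are represented by functions and divergent integrals equal 0, so operator
  identities hold almost everywhere, values on the diagonal are arbitrary, and points are discarded
  as null sets.\<close>

section \<open>Directional derivatives and calculus of matrix-valued maps\<close>

lemma pdiff_eq:
  assumes "(f has_derivative f') (at x)"
  shows "pdiff l f x = f' (axis l 1)"
  using frechet_derivative_at[OF assms] by (simp add: pdiff_def)

lemma ddiff_eq:
  assumes f: "(f has_derivative f') (at x)"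
  shows "ddiff v f x = f' v"
proof -
  have lin: "linear f'"
    using f has_derivative_linear by blast
  have "ddiff v f x = (\<Sum>l\<in>UNIV. v $ l *\<^sub>R f' (axis l 1))"
    by (simp add: ddiff_def pdiff_eq[OF f])
  also have "\<dots> = f' (\<Sum>l\<in>UNIV. v $ l *s axis l 1)"
    by (simp add: linear_sum[OF lin] linear_cmul[OF lin] scalar_mult_eq_scaleR)
  finally show ?thesis by (simp only: basis_expansion)
qed

text \<open>For iterated derivatives: the inner derivative of the Green's function is known
  explicitly only on the open set off the half-line.\<close>

lemma ddiff_cong_open:
  assumes "open S" "x \<in> S" "\<And>z. z \<in> S \<Longrightarrow> f z = g z" "g differentiable (at x)"
  shows "ddiff v f x = ddiff v g x"
proof -
  obtain g' where g: "(g has_derivative g') (at x)"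
    using assms(4) differentiable_def by blast
  have "(f has_derivative g') (at x)"
    by (rule has_derivative_transform_within_open[OF g assms(1,2)]) (simp add: assms(3))
  then show ?thesis using g by (simp add: ddiff_eq)
qed

text \<open>\<open>ddiff\<close> is assembled from partial derivatives, but the Green's function
  simplifies only along lines in direction \<open>v\<close>. Differentiability, checked separately,
  allows the derivative to be computed as that of a function of one real variable.\<close>

lemma ddiff_line:
  assumes F: "F differentiable (at w)"
    and D: "((\<lambda>\<tau>. F (w + \<tau> *\<^sub>R v)) has_vector_derivative D) (at 0)"
  shows "ddiff v F w = D"
proof -
  obtain F' where F': "(F has_derivative F') (at w)"
    using F differentiable_def by blast
  have "((\<lambda>\<tau>. w + \<tau> *\<^sub>R v) has_derivative (\<lambda>\<tau>. \<tau> *\<^sub>R v)) (at 0)"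
    by (auto intro!: derivative_eq_intros)
  from diff_chain_at[OF this, of F F'] F'
  have "((\<lambda>\<tau>. F (w + \<tau> *\<^sub>R v)) has_derivative (\<lambda>\<tau>. F' (\<tau> *\<^sub>R v))) (at 0)"
    by (simp add: o_def)
  then have "(\<lambda>\<tau>. F' (\<tau> *\<^sub>R v)) = (\<lambda>\<tau>. \<tau> *\<^sub>R D)"
    using D unfolding has_vector_derivative_def by (rule has_derivative_unique)
  from fun_cong[OF this, of 1] have "F' v = D" by simp
  then show ?thesis using ddiff_eq[OF F'] by simp
qed

lemma ddiff_reflect:
  assumes F: "F differentiable (at (x - z))"
  shows "ddiff v (\<lambda>z. F (x - z)) z = - ddiff v F (x - z)"
    and "(\<lambda>z. F (x - z)) differentiable (at z)"
proof -
  obtain F' where F': "(F has_derivative F') (at (x - z))"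
    using F differentiable_def by blast
  have "((\<lambda>z. x - z) has_derivative (\<lambda>h. - h)) (at z)"
    by (auto intro!: derivative_eq_intros)
  from diff_chain_at[OF this, of F F'] F'
  have *: "((\<lambda>z. F (x - z)) has_derivative (\<lambda>h. F' (- h))) (at z)"
    by (simp add: o_def)
  have "linear F'" using F' has_derivative_linear by blast
  with ddiff_eq[OF *] ddiff_eq[OF F'] show "ddiff v (\<lambda>z. F (x - z)) z = - ddiff v F (x - z)"
    by (simp add: linear_neg)
  from * show "(\<lambda>z. F (x - z)) differentiable (at z)"
    by (auto simp: differentiable_def)
qed

lemma Basis_matrix: "i \<in> (Basis :: (real^3^3) set) \<Longrightarrow> \<exists>j k. i = axis j (axis k 1)"
  by (auto simp: Basis_vec_def)

lemma has_derivative_matrix: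
  fixes F :: "'a::real_normed_vector \<Rightarrow> real^3^3"
  assumes "\<And>j k. ((\<lambda>w. F w $ j $ k) has_derivative (\<lambda>h. D h $ j $ k)) (at w)"
  shows "(F has_derivative D) (at w)"
  unfolding has_derivative_componentwise_within[of F D w UNIV]
  using assms by (auto dest!: Basis_matrix simp: inner_axis)

lemma differentiable_matrix:
  fixes F :: "'a::real_normed_vector \<Rightarrow> real^3^3"
  assumes "\<And>j k. (\<lambda>w. F w $ j $ k) differentiable (at w)"
  shows "F differentiable (at w)"
proof -
  obtain D where "\<And>j k. ((\<lambda>w. F w $ j $ k) has_derivative D j k) (at w)"
    using assms unfolding differentiable_def by metis
  then have "(F has_derivative (\<lambda>h. \<chi> j k. D j k h)) (at w)"
    by (intro has_derivative_matrix) simp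
  then show ?thesis by (auto simp: differentiable_def)
qed

lemma has_vector_derivative_matrix:
  fixes F :: "real \<Rightarrow> real^3^3"
  assumes "\<And>j k. ((\<lambda>w. F w $ j $ k) has_real_derivative (D $ j $ k)) (at w)"
  shows "(F has_vector_derivative D) (at w)"
  unfolding has_vector_derivative_def
  by (rule has_derivative_matrix)
    (use assms in \<open>auto simp: has_field_derivative_def mult_commute_abs\<close>)

section \<open>The source derivatives of the Green's function\<close>

text \<open>The \<open>(j, k)\<close> entry of \<open>4 \<pi> \<mu> G\<close> in terms of \<open>c = (1 - \<alpha>) / \<alpha>\<close>, \<open>d = \<delta>\<^sub>j\<^sub>k\<close>,
  the length \<open>r\<close> of \<open>w = x - y\<close>, \<open>s = w \<bullet> v\<close>, \<open>a = w\<^sub>j\<close> and \<open>b = w\<^sub>k\<close>; then its first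
  and second derivative in \<open>w\<close> along \<open>v\<close>. In the second one all powers of \<open>R = r - s\<close>
  have cancelled, so that it extends smoothly across the half-line.\<close>

definition green_entry :: "real \<Rightarrow> real \<Rightarrow> real \<Rightarrow> real \<Rightarrow> real \<Rightarrow> real \<Rightarrow> real \<Rightarrow> real \<Rightarrow> real" where
  "green_entry c d vj vk r s a b =
     d / r + a * b / r ^ 3
     + c * (d / (r - s) + (a * vk - vj * b - s * vj * vk) / (r * (r - s))
            - (a - s * vj) * (b - s * vk) / (r * (r - s)\<^sup>2))"

definition green_entry1 :: "real \<Rightarrow> real \<Rightarrow> real \<Rightarrow> real \<Rightarrow> real \<Rightarrow> real \<Rightarrow> real \<Rightarrow> real \<Rightarrow> real" where
  "green_entry1 c d vj vk r s a b =
     - s * d / r ^ 3 + (vj * b + a * vk) / r ^ 3 - 3 * s * a * b / r ^ 5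
     + c * (d / (r * (r - s)) + (a * vk - vj * b - s * vj * vk) / r ^ 3 - vj * vk / (r * (r - s))
            - (a - s * vj) * (b - s * vk) * (2 * r - s) / (r ^ 3 * (r - s)\<^sup>2))"

definition green_entry2 :: "real \<Rightarrow> real \<Rightarrow> real \<Rightarrow> real \<Rightarrow> real \<Rightarrow> real \<Rightarrow> real \<Rightarrow> real \<Rightarrow> real" where
  "green_entry2 c d vj vk r s a b =
     d * (3 * s\<^sup>2 / r ^ 5 - 1 / r ^ 3) + 2 * vj * vk / r ^ 3 - 6 * s * (vj * b + a * vk) / r ^ 5
     + a * b * (15 * s\<^sup>2 / r ^ 7 - 3 / r ^ 5)
     + c * ((d - 2 * vj * vk) / r ^ 3 + (6 * s * vj * b - 3 * a * b) / r ^ 5)"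

text \<open>Along \<open>v\<close> the length r grows at rate s / r and s at rate 1, so R = r - s
  satisfies R' = - R / r, and the components of w orthogonal to \<open>v\<close> are constant. The
  logarithmic derivative of R thus has no pole at R = 0, and the singular terms close up: 1 / (r R)
  has derivative 1 / r^3 and (2 r - s) / (r^3 R^2) has derivative 3 / r^5.\<close>

lemma green_entry_deriv:
  assumes N: "(N has_real_derivative s / r) (at 0)" "N 0 = r"
    and S: "(S has_real_derivative 1) (at 0)" "S 0 = s"
    and A: "(A has_real_derivative vj) (at 0)" "A 0 = a"
    and B: "(B has_real_derivative vk) (at 0)" "B 0 = b"
    and r: "r \<noteq> 0" "r - s \<noteq> 0"
  shows "((\<lambda>\<tau>. green_entry c d vj vk (N \<tau>) (S \<tau>) (A \<tau>) (B \<tau>)) has_real_derivative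
            green_entry1 c d vj vk r s a b) (at 0)"
    and "((\<lambda>\<tau>. green_entry1 c d vj vk (N \<tau>) (S \<tau>) (A \<tau>) (B \<tau>)) has_real_derivative
            green_entry2 c d vj vk r s a b) (at 0)"
proof -
  define R where "R \<tau> = N \<tau> - S \<tau>" for \<tau>
  define p where "p = r - s"
  define P where "P \<tau> = A \<tau> - S \<tau> * vj" for \<tau>
  define Q where "Q \<tau> = B \<tau> - S \<tau> * vk" for \<tau>
  have p: "p \<noteq> 0" "s = r - p" using r by (auto simp: p_def)
  note [derivative_intros] = N(1) S(1) A(1) B(1)
  have R': "(R has_real_derivative - p / r) (at 0)" "R 0 = p"
    unfolding R_def by (auto intro!: derivative_eq_intros simp: r field_simps p_def N S)
  have P': "(P has_real_derivative 0) (at 0)" "P 0 = a - s * vj"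
    unfolding P_def by (auto intro!: derivative_eq_intros simp: A S)
  have Q': "(Q has_real_derivative 0) (at 0)" "Q 0 = b - s * vk"
    unfolding Q_def by (auto intro!: derivative_eq_intros simp: B S)
  note [derivative_intros] = R'(1) P'(1) Q'(1)
  have NR: "((\<lambda>\<tau>. 1 / (N \<tau> * R \<tau>)) has_real_derivative 1 / r ^ 3) (at 0)"
    by (auto intro!: derivative_eq_intros simp: N S R' r p)
       (simp add: field_simps r p power3_eq_cube)
  have R1: "((\<lambda>\<tau>. 1 / R \<tau>) has_real_derivative 1 / (r * p)) (at 0)"
    by (auto intro!: derivative_eq_intros simp: R' r p)
  have N3: "((\<lambda>\<tau>. 1 / N \<tau> ^ 3) has_real_derivative - 3 * s / r ^ 5) (at 0)"
    by (auto intro!: derivative_eq_intros simp: N r) (simp add: field_simps r eval_nat_numeral)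
  have N1: "((\<lambda>\<tau>. 1 / N \<tau>) has_real_derivative - s / r ^ 3) (at 0)"
    by (auto intro!: derivative_eq_intros simp: N r) (simp add: field_simps r eval_nat_numeral)
  have N5: "((\<lambda>\<tau>. 1 / N \<tau> ^ 5) has_real_derivative - 5 * s / r ^ 7) (at 0)"
    by (auto intro!: derivative_eq_intros simp: N r) (simp add: field_simps r eval_nat_numeral)
  have NR2: "((\<lambda>\<tau>. 1 / (N \<tau> * (R \<tau>)\<^sup>2)) has_real_derivative (2 * r - s) / (r ^ 3 * p\<^sup>2)) (at 0)"
    by (auto intro!: derivative_eq_intros simp: N S R' r p)
       (simp add: field_simps r p eval_nat_numeral)
  have NR3: "((\<lambda>\<tau>. (2 * N \<tau> - S \<tau>) / (N \<tau> ^ 3 * (R \<tau>)\<^sup>2)) has_real_derivative 3 / r ^ 5) (at 0)"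
    by (auto intro!: derivative_eq_intros simp: N S R' r p)
       (simp add: field_simps r p eval_nat_numeral)
  note [derivative_intros] = NR R1 N3 N1 N5 NR2 NR3
  \<comment> \<open>The reciprocals become separate factors, so that the rules just proved, with
    their cancelled right-hand sides, apply instead of the quotient rule.\<close>
  have e0: "(\<lambda>\<tau>. green_entry c d vj vk (N \<tau>) (S \<tau>) (A \<tau>) (B \<tau>)) =
     (\<lambda>\<tau>. d * (1 / N \<tau>) + A \<tau> * B \<tau> * (1 / N \<tau> ^ 3) + c * (d * (1 / R \<tau>)
        + (A \<tau> * vk - vj * B \<tau> - S \<tau> * vj * vk) * (1 / (N \<tau> * R \<tau>))
        - P \<tau> * Q \<tau> * (1 / (N \<tau> * (R \<tau>)\<^sup>2))))"
    by (simp add: green_entry_def R_def P_def Q_def)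
  show "((\<lambda>\<tau>. green_entry c d vj vk (N \<tau>) (S \<tau>) (A \<tau>) (B \<tau>)) has_real_derivative
            green_entry1 c d vj vk r s a b) (at 0)"
    unfolding e0
    by (rule derivative_eq_intros refl)+
       (simp add: N S R' P' Q' A B green_entry1_def p_def[symmetric], 
        simp add: algebra_simps)
  have e1: "(\<lambda>\<tau>. green_entry1 c d vj vk (N \<tau>) (S \<tau>) (A \<tau>) (B \<tau>)) =
     (\<lambda>\<tau>. - d * S \<tau> * (1 / N \<tau> ^ 3) + (vj * B \<tau> + A \<tau> * vk) * (1 / N \<tau> ^ 3) - 3 * S \<tau> * A \<tau> * B \<tau> * (1 / N \<tau> ^ 5)
       + c * ((d - vj * vk) * (1 / (N \<tau> * R \<tau>)) + (A \<tau> * vk - vj * B \<tau> - S \<tau> * vj * vk) * (1 / N \<tau> ^ 3)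
        - P \<tau> * Q \<tau> * ((2 * N \<tau> - S \<tau>) / (N \<tau> ^ 3 * (R \<tau>)\<^sup>2))))"
    by (simp add: fun_eq_iff green_entry1_def R_def P_def Q_def divide_inverse algebra_simps)
  show "((\<lambda>\<tau>. green_entry1 c d vj vk (N \<tau>) (S \<tau>) (A \<tau>) (B \<tau>)) has_real_derivative
            green_entry2 c d vj vk r s a b) (at 0)"
    unfolding e1
    by (rule derivative_eq_intros refl)+
       (simp add: N S R' P' Q' A B green_entry2_def p_def[symmetric], 
        simp add: algebra_simps power2_eq_square diff_divide_distrib add_divide_distrib)
qed

definition green_mat ::
    "(real \<Rightarrow> real \<Rightarrow> real \<Rightarrow> real \<Rightarrow> real \<Rightarrow> real \<Rightarrow> real \<Rightarrow> real \<Rightarrow> real)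
      \<Rightarrow> real \<Rightarrow> real \<Rightarrow> real^3 \<Rightarrow> real^3 \<Rightarrow> real^3^3" where
  "green_mat f lam mu v w = (\<chi> j k. 1 / (4 * pi * mu) *
     f ((1 - lame_alpha lam mu) / lame_alpha lam mu) (if j = k then 1 else 0)
       (v $ j) (v $ k) (norm w) (w \<bullet> v) (w $ j) (w $ k))"

lemma projection_outer:
  fixes v r :: "real^3"
  shows "((mat 1 - outer v v) ** outer r r ** (mat 1 - outer v v)) $ j $ k =
    (r $ j - (r \<bullet> v) * v $ j) * (r $ k - (r \<bullet> v) * v $ k)"
proof -
  define Q where "Q = mat 1 - outer v v"
  have Q: "(\<Sum>m\<in>UNIV. Q $ j $ m * r $ m) = r $ j - (r \<bullet> v) * v $ j" for j
    by (simp add: Q_def mat_def outer_def left_diff_distrib mult_if_delta sum_subtractf inner_vec_def)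
       (simp add: sum_distrib_left mult_ac)
  have sym: "Q $ l $ k = Q $ k $ l" for l
    by (auto simp: Q_def mat_def outer_def)
  have "(Q ** outer r r ** Q) $ j $ k = (\<Sum>l\<in>UNIV. (\<Sum>m\<in>UNIV. Q $ j $ m * r $ m) * r $ l * Q $ k $ l)"
    by (simp add: matrix_matrix_mult_def outer_def sum_distrib_right mult.assoc sym)
  also have "\<dots> = (\<Sum>m\<in>UNIV. Q $ j $ m * r $ m) * (\<Sum>l\<in>UNIV. Q $ k $ l * r $ l)"
    by (simp add: sum_distrib_left mult_ac)
  finally show ?thesis unfolding Q by (simp add: Q_def)
qed

lemma outer_nth: "outer a b $ i $ j = a $ i * b $ j"
  by (simp add: outer_def)

lemma G_B_eq: "G_B lam mu v x = (\<lambda>z. green_mat green_entry lam mu v (x - z))"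
proof (intro ext, unfold vec_eq_iff, intro allI)
  fix z :: "real^3" and j k :: 3
  define r where "r = x - z"
  \<comment> \<open>With the reciprocals opaque the identity is polynomial, so it also holds where a
    denominator vanishes.\<close>
  define i1 i3 iR iRR iRR2 where "i1 = 1 / norm r" and "i3 = 1 / norm r ^ 3"
    and "iR = 1 / (norm r - r \<bullet> v)" and "iRR = 1 / (norm r * (norm r - r \<bullet> v))"
    and "iRR2 = 1 / (norm r * (norm r - r \<bullet> v)\<^sup>2)"
  note i = i1_def[symmetric] i3_def[symmetric] iR_def[symmetric] iRR_def[symmetric] iRR2_def[symmetric]
  define C where "C = 1 / (4 * pi * mu)"
  define c where "c = (1 - lame_alpha lam mu) / lame_alpha lam mu"
  define d :: real where "d = (if j = k then 1 else 0)"
  have mat: "(mat 1 :: real^3^3) $ j $ k = d" by (simp add: mat_def d_def)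
  have "G_B lam mu v x z $ j $ k =
      C * (i1 * d + i3 * (r $ j * r $ k))
      + C * c * (iR * d + iRR * (r $ j * v $ k - v $ j * r $ k - (r \<bullet> v) * (v $ j * v $ k))
           - iRR2 * ((r $ j - (r \<bullet> v) * v $ j) * (r $ k - (r \<bullet> v) * v $ k)))"
    unfolding G_B_def Let_def r_def[symmetric] i C_def[symmetric] c_def[symmetric]
    by (simp only: vector_add_component vector_minus_component vector_scaleR_component
        real_scaleR_def projection_outer mat outer_nth)
  also have "\<dots> = C * (d * i1 + r $ j * r $ k * i3 + c * (d * iR
       + (r $ j * v $ k - v $ j * r $ k - (r \<bullet> v) * v $ j * v $ k) * iRR
       - (r $ j - (r \<bullet> v) * v $ j) * (r $ k - (r \<bullet> v) * v $ k) * iRR2))"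
    by (simp add: algebra_simps)
  also have "\<dots> = green_mat green_entry lam mu v (x - z) $ j $ k"
    by (simp add: green_mat_def green_entry_def C_def c_def d_def
        i1_def i3_def iR_def iRR_def iRR2_def r_def)
  finally show "G_B lam mu v x z $ j $ k = green_mat green_entry lam mu v (x - z) $ j $ k" .
qed

text \<open>For a unit vector \<open>v\<close> this is the complement of the half-line from 0 in
  direction \<open>v\<close>, by the equality case of Cauchy-Schwarz. Written as R being nonzero, it
  is open as a preimage and supplies the denominators directly.\<close>

definition off_ray :: "real^3 \<Rightarrow> (real^3) set" where
  "off_ray v = {w. norm w - w \<bullet> v \<noteq> 0}"

lemma open_off_ray: "open (off_ray v)"
proof -
  have "off_ray v = (\<lambda>w. norm w - w \<bullet> v) -` (- {0})" by (auto simp: off_ray_def)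
  then show ?thesis
    by (auto intro!: open_vimage continuous_intros)
qed

lemma off_rayI:
  assumes v: "norm v = 1" and x: "x \<notin> half_line z v"
  shows "x - z \<in> off_ray v"
proof (rule ccontr)
  assume "x - z \<notin> off_ray v"
  then have "norm (x - z) *\<^sub>R v = x - z"
    using norm_cauchy_schwarz_eq[of "x - z" v] v by (simp add: off_ray_def)
  then have "x = z + norm (x - z) *\<^sub>R v" by (simp add: algebra_simps)
  then show False using x by (auto simp: half_line_def)
qed

lemma off_ray_nz: "w \<in> off_ray v \<Longrightarrow> w \<noteq> 0"
  by (auto simp: off_ray_def)

lemma differentiable_nth: "(\<lambda>w::real^3. w $ j) differentiable F"
  by (simp add: bounded_linear_vec_nth bounded_linear_imp_differentiable)

lemma differentiable_inner_const: "(\<lambda>w::real^3. w \<bullet> v) differentiable F"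
  by (simp add: bounded_linear_inner_left bounded_linear_imp_differentiable)

lemma green_entry_differentiable:
  assumes "w \<in> off_ray v"
  shows "(\<lambda>w. green_entry c d vj vk (norm w) (w \<bullet> v) (w $ j) (w $ k)) differentiable (at w)"
    and "(\<lambda>w. green_entry1 c d vj vk (norm w) (w \<bullet> v) (w $ j) (w $ k)) differentiable (at w)"
proof -
  have w: "norm w - w \<bullet> v \<noteq> 0" "w \<noteq> 0" using assms off_ray_nz by (auto simp: off_ray_def)
  note intros = differentiable_add differentiable_diff differentiable_minus
        differentiable_mult differentiable_divide differentiable_power differentiable_const
        differentiable_nth differentiable_inner_const differentiable_norm_at
  show "(\<lambda>w. green_entry c d vj vk (norm w) (w \<bullet> v) (w $ j) (w $ k)) differentiable (at w)"
    unfolding green_entry_def by (intro intros) (use w in auto)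
  show "(\<lambda>w. green_entry1 c d vj vk (norm w) (w \<bullet> v) (w $ j) (w $ k)) differentiable (at w)"
    unfolding green_entry1_def by (intro intros) (use w in auto)
qed

lemma green_mat_differentiable:
  assumes "w \<in> off_ray v"
  shows "green_mat green_entry lam mu v differentiable (at w)"
    and "green_mat green_entry1 lam mu v differentiable (at w)"
  by (rule differentiable_matrix, unfold green_mat_def vec_lambda_beta,
      intro differentiable_mult differentiable_const green_entry_differentiable assms)+

lemma norm_line_deriv:
  fixes w v :: "real^3"
  assumes "w \<noteq> 0"
  shows "((\<lambda>\<tau>. norm (w + \<tau> *\<^sub>R v)) has_real_derivative (w \<bullet> v) / norm w) (at 0)"
proof -
  have "((\<lambda>\<tau>. w + \<tau> *\<^sub>R v) has_derivative (\<lambda>\<tau>. \<tau> *\<^sub>R v)) (at 0)"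
    by (auto intro!: derivative_eq_intros)
  from diff_chain_at[OF this, of norm "\<lambda>h. h \<bullet> sgn w"] has_derivative_norm[OF assms]
  have "((\<lambda>\<tau>. norm (w + \<tau> *\<^sub>R v)) has_derivative (\<lambda>\<tau>. (\<tau> *\<^sub>R v) \<bullet> sgn w)) (at 0)"
    by (simp add: o_def)
  moreover have "(\<lambda>\<tau>. (\<tau> *\<^sub>R v) \<bullet> sgn w) = (*) ((w \<bullet> v) / norm w)"
    by (auto simp: sgn_div_norm inner_commute divide_inverse)
  ultimately show ?thesis by (simp add: has_field_derivative_def)
qed

lemma green_mat_line_deriv:
  assumes v: "norm v = 1" and w: "w \<in> off_ray v"
  shows "((\<lambda>\<tau>. green_mat green_entry lam mu v (w + \<tau> *\<^sub>R v)) has_vector_derivative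
            green_mat green_entry1 lam mu v w) (at 0)" (is ?A)
    and "((\<lambda>\<tau>. green_mat green_entry1 lam mu v (w + \<tau> *\<^sub>R v)) has_vector_derivative
            green_mat green_entry2 lam mu v w) (at 0)" (is ?B)
proof -
  have nz: "norm w \<noteq> 0" "norm w - w \<bullet> v \<noteq> 0"
    using w off_ray_nz by (auto simp: off_ray_def)
  have I: "((\<lambda>\<tau>. (w + \<tau> *\<^sub>R v) \<bullet> v) has_real_derivative 1) (at 0)"
    using v by (auto intro!: derivative_eq_intros simp: inner_add_left dot_square_norm)
  have c: "((\<lambda>\<tau>. (w + \<tau> *\<^sub>R v) $ j) has_real_derivative v $ j) (at 0)" for j
    by (auto intro!: derivative_eq_intros)
  note N = norm_line_deriv[OF off_ray_nz[OF w], of v]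
  note * = green_entry_deriv[OF N _ I _ c _ c _ nz, simplified]
  show ?A
    by (rule has_vector_derivative_matrix) (auto simp: green_mat_def intro!: DERIV_cmult[OF *(1)[simplified]] DERIV_cdivide[OF *(1)[simplified]])
  show ?B
    by (rule has_vector_derivative_matrix) (auto simp: green_mat_def intro!: DERIV_cmult[OF *(2)[simplified]] DERIV_cdivide[OF *(2)[simplified]])
qed

lemma ddiff_ddiff_G_B:
  assumes v: "norm v = 1" and x: "x - z \<in> off_ray v"
  shows "ddiff v (ddiff v (G_B lam mu v x)) z = green_mat green_entry2 lam mu v (x - z)"
proof -
  define S where "S = (\<lambda>z. x - z) -` off_ray v"
  have S: "open S" "z \<in> S"
    unfolding S_def using x by (auto intro!: open_vimage open_off_ray continuous_intros)
  \<comment> \<open>Each derivative in z of a function of x - z costs a sign. \<open>F\<close>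
    carries the first sign, and the second derivative cancels it.\<close>
  define F where "F = (\<lambda>w. - green_mat green_entry1 lam mu v w)"
  have F: "F differentiable (at w)" if "w \<in> off_ray v" for w
    unfolding F_def by (intro differentiable_minus green_mat_differentiable that)
  have 1: "ddiff v (G_B lam mu v x) z = F (x - z)" if "z \<in> S" for z
  proof -
    have w: "x - z \<in> off_ray v" using that by (simp add: S_def)
    show ?thesis
      unfolding G_B_eq F_def ddiff_reflect(1)[OF green_mat_differentiable(1)[OF w]]
      by (simp add: ddiff_line[OF green_mat_differentiable(1)[OF w] green_mat_line_deriv(1)[OF v w]])
  qed
  have "ddiff v (ddiff v (G_B lam mu v x)) z = ddiff v (\<lambda>z. F (x - z)) z"
    by (rule ddiff_cong_open[OF S 1 ddiff_reflect(2)[OF F[OF x]]])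
  also have "\<dots> = - ddiff v F (x - z)"
    by (rule ddiff_reflect(1)[OF F[OF x]])
  also have "ddiff v F (x - z) = - green_mat green_entry2 lam mu v (x - z)"
    by (rule ddiff_line[OF F[OF x]])
      (unfold F_def, intro has_vector_derivative_minus green_mat_line_deriv v x)
  finally show ?thesis by simp
qed

lemma continuous_on_green_mat2: "continuous_on (- {0}) (green_mat green_entry2 lam mu v)"
  unfolding green_mat_def green_entry2_def
  by (intro continuous_intros) auto

text \<open>Makes the value of \<open>Lim\<close> in \<open>K_integrand\<close> well determined: a
  shift orthogonal to \<open>v\<close> leaves the half-line, however small it is.\<close>

lemma half_line_islimpt:
  fixes z v :: "real^3"
  assumes "x \<in> half_line z v"
  shows "at x within - half_line z v \<noteq> bot"
proof -
  obtain u :: "real^3" where u: "u \<noteq> 0" "orthogonal v u"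
    using orthogonal_to_vector_exists[of v] by auto
  obtain s where s: "x = z + s *\<^sub>R v"
    using assms by (auto simp: half_line_def)
  have out: "x + e *\<^sub>R u \<notin> half_line z v" if "e \<noteq> 0" for e
  proof
    assume "x + e *\<^sub>R u \<in> half_line z v"
    then obtain s' where "x + e *\<^sub>R u = z + s' *\<^sub>R v" by (auto simp: half_line_def)
    then have eq: "e *\<^sub>R u = (s' - s) *\<^sub>R v" by (simp add: s algebra_simps)
    have "(e *\<^sub>R u) \<bullet> u = 0"
      unfolding eq using u(2) by (simp add: orthogonal_def)
    then show False using u(1) that by simp
  qed
  have "x islimpt - half_line z v"
    unfolding islimpt_approachable
  proof (intro allI impI)
    fix e :: real assume e: "0 < e"
    define d where "d = e / (2 * norm u)"
    have "d \<noteq> 0" "0 < d" using e u by (auto simp: d_def)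
    moreover have "dist (x + d *\<^sub>R u) x < e"
      using e u by (simp add: dist_norm d_def)
    ultimately show "\<exists>x'\<in>- half_line z v. x' \<noteq> x \<and> dist x' x < e"
      using out[of d] u(1) by (intro bexI[of _ "x + d *\<^sub>R u"]) auto
  qed
  then show ?thesis by (simp add: trivial_limit_within)
qed

text \<open>The explicit second derivative is continuous away from the pole, so the limit prescribed
  on the half-line is its value there. Points on the half-line beyond the segment need no separate
  treatment afterwards.\<close>

lemma K_integrand_eq:
  assumes v: "norm v = 1" and x: "x \<noteq> y + t *\<^sub>R v"
  shows "K_integrand lam mu v x y t = t *\<^sub>R green_mat green_entry2 lam mu v (x - y - t *\<^sub>R v)"
proof -
  define z where "z = y + t *\<^sub>R v"
  define D where "D = (\<lambda>x'. t *\<^sub>R ddiff v (ddiff v (G_B lam mu v x')) z)"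
  define E where "E = (\<lambda>x'. t *\<^sub>R green_mat green_entry2 lam mu v (x' - z))"
  have DE: "D x' = E x'" if "x' \<notin> half_line z v" for x'
    unfolding D_def E_def using ddiff_ddiff_G_B[OF v off_rayI[OF v that]] by simp
  have "K_integrand lam mu v x y t = E x"
  proof (cases "x \<in> half_line z v")
    case True
    have "continuous_on (- {z}) E"
      unfolding E_def
      by (intro continuous_intros continuous_on_compose2[OF continuous_on_green_mat2]) auto
    then have "isCont E x"
      using x by (simp add: continuous_on_eq_continuous_at z_def open_Compl)
    then have "(E \<longlongrightarrow> E x) (at x within - half_line z v)"
      by (auto simp: isCont_def intro: tendsto_within_subset)
    then have "(D \<longlongrightarrow> E x) (at x within - half_line z v)"
      by (rule Lim_transform_eventually) (auto simp: eventually_at_filter DE)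
    then have "Lim (at x within - half_line z v) D = E x"
      by (intro tendsto_Lim half_line_islimpt[OF True])
    with True show ?thesis
      by (simp add: K_integrand_def Let_def z_def D_def)
  next
    case False
    then show ?thesis
      using DE[OF False] by (simp add: K_integrand_def Let_def z_def D_def)
  qed
  then show ?thesis by (simp add: E_def z_def algebra_simps)
qed

section \<open>The stress of the second source derivative\<close>

text \<open>The chain rule for \<open>green_entry2\<close> in a direction \<open>p\<close> with \<open>\<sigma> = p \<bullet> v\<close>, \<open>q = p \<bullet> w\<close>,
  \<open>a' = p\<^sub>j\<close>, \<open>b' = p\<^sub>k\<close>.\<close>

definition green_entry2_deriv ::
    "real \<Rightarrow> real \<Rightarrow> real \<Rightarrow> real \<Rightarrow> real \<Rightarrow> real \<Rightarrow> real \<Rightarrow> real \<Rightarrow> real \<Rightarrow> real \<Rightarrow> real \<Rightarrow> real \<Rightarrow> real" where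
  "green_entry2_deriv c d vj vk r s a b \<sigma> q a' b' =
     d * (3 * q / r ^ 5 + 6 * s * \<sigma> / r ^ 5 - 15 * s\<^sup>2 * q / r ^ 7)
     - 6 * vj * vk * q / r ^ 5
     - 6 * \<sigma> * (vj * b + a * vk) / r ^ 5 - 6 * s * (vj * b' + a' * vk) / r ^ 5
     + 30 * s * q * (vj * b + a * vk) / r ^ 7
     + (a' * b + a * b') * (15 * s\<^sup>2 / r ^ 7 - 3 / r ^ 5)
     + a * b * (30 * s * \<sigma> / r ^ 7 + 15 * q / r ^ 7 - 105 * s\<^sup>2 * q / r ^ 9)
     + c * (- 3 * q * (d - 2 * vj * vk) / r ^ 5
            + (6 * \<sigma> * vj * b + 6 * s * vj * b' - 3 * a' * b - 3 * a * b') / r ^ 5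
            - 5 * q * (6 * s * vj * b - 3 * a * b) / r ^ 7)"

lemma has_derivative_norm_power:
  fixes w :: "real^3"
  assumes "w \<noteq> 0"
  shows "((\<lambda>w. 1 / norm w ^ n) has_derivative (\<lambda>h. - real n * (w \<bullet> h) / norm w ^ (n + 2))) (at w)"
proof (cases n)
  case 0 then show ?thesis by simp
next
  case (Suc m)
  have n: "(norm has_derivative (\<lambda>h. (w \<bullet> h) / norm w)) (at w)"
    using has_derivative_norm[OF assms] by (simp add: sgn_div_norm inner_commute divide_inverse mult.commute)
  have "((\<lambda>x. x ^ n) has_real_derivative real n * norm w ^ m) (at (norm w))"
    using DERIV_pow[of n "norm w"] by (simp add: Suc)
  then have "((\<lambda>x. 1 / x ^ n) has_real_derivative - (real n * norm w ^ m) / (norm w ^ n * norm w ^ n)) (at (norm w))"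
    by (rule DERIV_cong[OF DERIV_divide[OF DERIV_const]]) (use assms in auto)
  from has_derivative_compose[OF n this[unfolded has_field_derivative_def]]
  have "((\<lambda>w. 1 / norm w ^ n) has_derivative
      (\<lambda>h. - (real n * norm w ^ m) / (norm w ^ n * norm w ^ n) * ((w \<bullet> h) / norm w))) (at w)"
    by simp
  then show ?thesis
    by (rule has_derivative_eq_rhs) (use assms in \<open>simp add: fun_eq_iff Suc field_simps\<close>)
qed

lemma has_derivative_nth: "((\<lambda>w::real^3. w $ j) has_derivative (\<lambda>h. h $ j)) F"
  by (rule bounded_linear_imp_has_derivative) (rule bounded_linear_vec_nth)

lemma has_derivative_inner_const: "((\<lambda>w::real^3. w \<bullet> v) has_derivative (\<lambda>h. h \<bullet> v)) F"
  by (rule bounded_linear_imp_has_derivative) (rule bounded_linear_inner_left)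

lemma green_entry2_has_derivative:
  fixes w v :: "real^3"
  assumes w: "w \<noteq> 0"
  shows "((\<lambda>w. green_entry2 c d vj vk (norm w) (w \<bullet> v) (w $ j) (w $ k)) has_derivative
    (\<lambda>h. green_entry2_deriv c d vj vk (norm w) (w \<bullet> v) (w $ j) (w $ k) (h \<bullet> v) (w \<bullet> h) (h $ j) (h $ k)))
    (at w)"
proof -
  define p where "p n = (\<lambda>w::real^3. 1 / norm w ^ n)" for n
  have p: "(p n has_derivative (\<lambda>h. - real n * (w \<bullet> h) / norm w ^ (n + 2))) (at w)" for n
    unfolding p_def by (rule has_derivative_norm_power[OF w])
  note [derivative_intros] = p has_derivative_nth has_derivative_inner_const
  have e: "(\<lambda>w. green_entry2 c d vj vk (norm w) (w \<bullet> v) (w $ j) (w $ k)) =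
    (\<lambda>w. d * (3 * (w \<bullet> v)\<^sup>2 * p 5 w - p 3 w) + 2 * vj * vk * p 3 w
      - 6 * (w \<bullet> v) * (vj * w $ k + w $ j * vk) * p 5 w
      + w $ j * w $ k * (15 * (w \<bullet> v)\<^sup>2 * p 7 w - 3 * p 5 w)
      + c * ((d - 2 * vj * vk) * p 3 w + (6 * (w \<bullet> v) * vj * w $ k - 3 * w $ j * w $ k) * p 5 w))"
    by (simp add: fun_eq_iff green_entry2_def p_def)
  show ?thesis
    unfolding e
    apply (rule has_derivative_eq_rhs)
     apply (rule derivative_intros)+
    apply (simp add: fun_eq_iff green_entry2_deriv_def p_def)
    apply (simp add: divide_inverse algebra_simps power2_eq_square)
    done
qed

text \<open>The third derivative of \<open>1 / norm w\<close> in the directions \<open>a\<close>, \<open>b\<close>, \<open>c\<close>.\<close>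

definition third_deriv :: "real^3 \<Rightarrow> real^3 \<Rightarrow> real^3 \<Rightarrow> real^3 \<Rightarrow> real" where
  "third_deriv a b c w = 3 * ((a \<bullet> b) * (c \<bullet> w) + (a \<bullet> c) * (b \<bullet> w) + (b \<bullet> c) * (a \<bullet> w)) / norm w ^ 5
     - 15 * (a \<bullet> w) * (b \<bullet> w) * (c \<bullet> w) / norm w ^ 7"

text \<open>The kernel V of the overview. The corrections to the third derivative in the directions
  i, j, k are chosen so that contraction with \<open>v\<close> in i, and by symmetry in j, gives
  zero; its factor in the stress is c / (4 pi).\<close>

definition residual :: "real^3 \<Rightarrow> 3 \<Rightarrow> 3 \<Rightarrow> 3 \<Rightarrow> real^3 \<Rightarrow> real" where
  "residual v i j k w = - 2 * ((if i = j then 1 else 0) * third_deriv v v (axis k 1) w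
      + third_deriv (axis i 1) (axis j 1) (axis k 1) w
      - v $ j * third_deriv v (axis i 1) (axis k 1) w
      - v $ i * third_deriv v (axis j 1) (axis k 1) w)"

lemma third_deriv_axis_sum: "(\<Sum>i\<in>UNIV. v $ i * third_deriv (axis i 1) b c w) = third_deriv v b c w"
proof -
  have 1: "(\<Sum>i\<in>UNIV. v $ i * (axis i 1 \<bullet> z)) = v \<bullet> z" for z :: "real^3"
    by (simp add: inner_axis' inner_vec_def[of v])
  have "(\<Sum>i\<in>UNIV. v $ i * third_deriv (axis i 1) b c w) =
     (\<Sum>i\<in>UNIV. 3 / norm w ^ 5 * (c \<bullet> w) * (v $ i * (axis i 1 \<bullet> b))
       + 3 / norm w ^ 5 * (b \<bullet> w) * (v $ i * (axis i 1 \<bullet> c))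
       + (3 / norm w ^ 5 * (b \<bullet> c) - 15 / norm w ^ 7 * (b \<bullet> w) * (c \<bullet> w)) * (v $ i * (axis i 1 \<bullet> w)))"
    by (simp add: third_deriv_def divide_inverse algebra_simps)
  also have "\<dots> = third_deriv v b c w"
    by (simp only: sum.distrib sum_distrib_left[symmetric] 1)
      (simp add: third_deriv_def divide_inverse algebra_simps)
  finally show ?thesis .
qed

lemma third_deriv_commute: "third_deriv a b c w = third_deriv b a c w"
  by (simp add: third_deriv_def inner_commute algebra_simps)

text \<open>This cancellation is what makes the remainder kernel weakly singular.\<close>

lemma residual_normal:
  assumes v: "norm v = 1"
  shows "(\<Sum>i\<in>UNIV. v $ i * residual v i j k w) = 0"
proof -
  have vv: "(\<Sum>i\<in>UNIV. v $ i * v $ i) = 1"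
    using v by (simp add: norm_eq_1 inner_vec_def)
  have "(\<Sum>i\<in>UNIV. v $ i * residual v i j k w) =
     (\<Sum>i\<in>UNIV. - 2 * third_deriv v v (axis k 1) w * (if i = j then v $ i else 0)
       + - 2 * (v $ i * third_deriv (axis i 1) (axis j 1) (axis k 1) w)
       + 2 * v $ j * (v $ i * third_deriv (axis i 1) v (axis k 1) w)
       + 2 * third_deriv v (axis j 1) (axis k 1) w * (v $ i * v $ i))"
    by (intro sum.cong refl)
      (simp add: residual_def third_deriv_commute[of v "axis _ 1"] algebra_simps)
  also have "\<dots> = 0"
    by (simp only: sum.distrib sum_distrib_left[symmetric] third_deriv_axis_sum vv)
      (simp add: third_deriv_commute[of v "axis _ 1"])
  finally show ?thesis .
qed

text \<open>The second derivative of \<open>w\<^sub>i w\<^sub>j w\<^sub>k / norm w ^ 5\<close> along \<open>v\<close>.\<close>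

definition cubic2 :: "real^3 \<Rightarrow> 3 \<Rightarrow> 3 \<Rightarrow> 3 \<Rightarrow> real^3 \<Rightarrow> real" where
  "cubic2 v i j k w =
     2 * (v $ i * v $ j * w $ k + v $ i * w $ j * v $ k + w $ i * v $ j * v $ k) / norm w ^ 5
     - 10 * (w \<bullet> v) * (v $ i * w $ j * w $ k + w $ i * v $ j * w $ k + w $ i * w $ j * v $ k) / norm w ^ 7
     + w $ i * w $ j * w $ k * (35 * (w \<bullet> v)\<^sup>2 / norm w ^ 9 - 5 / norm w ^ 7)"

text \<open>The i-th partial derivative of 4 pi \<mu> times the (j, k) entry of the second source
  derivative: the chain rule in the direction \<open>axis i 1\<close>.\<close>

definition green_grad :: "real \<Rightarrow> real^3 \<Rightarrow> 3 \<Rightarrow> 3 \<Rightarrow> 3 \<Rightarrow> real^3 \<Rightarrow> real" where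
  "green_grad c v i j k w = green_entry2_deriv c (if j = k then 1 else 0) (v $ j) (v $ k)
     (norm w) (w \<bullet> v) (w $ j) (w $ k) (v $ i) (w $ i) (if i = j then 1 else 0) (if i = k then 1 else 0)"

text \<open>The terms without \<open>c\<close> are the second derivative along \<open>v\<close> of
  the Stokeslet I / r + w w^T / r^3, whose columns are divergence-free, so only terms with the
  factor \<open>c\<close> survive.\<close>

lemma green_grad_divergence:
  assumes v: "norm v = 1" and w: "w \<noteq> 0"
  shows "(\<Sum>l\<in>UNIV. green_grad c v l l k w) = 2 * c * third_deriv v v (axis k 1) w"
proof -
  define r s b vk where "r = norm w" and "s = w \<bullet> v" and "b = w $ k" and "vk = v $ k"
  have r: "r \<noteq> 0" using w by (simp add: r_def)
  have vv: "(\<Sum>l\<in>UNIV. v $ l * v $ l) = 1"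
    using v by (simp add: norm_eq_1 inner_vec_def)
  have wv: "(\<Sum>l\<in>UNIV. w $ l * v $ l) = s" by (simp add: inner_vec_def s_def)
  have ww: "(\<Sum>l\<in>UNIV. w $ l * w $ l) = r\<^sup>2"
    by (simp add: r_def power2_norm_eq_inner inner_vec_def)
  \<comment> \<open>The summand is sorted by its dependence on l: a Kronecker term and multiples of
    v_l v_l, w_l v_l, w_l w_l and 1. After summation only 1, s, r^2 and 3 remain.\<close>
  define X where "X l = c * (6 * s * v $ l - 6 * w $ l) / r ^ 5" for l
  define P where "P = - 6 * b / r ^ 5 + c * (6 * b / r ^ 5)"
  define Q where "Q = - 12 * vk / r ^ 5 + 60 * s * b / r ^ 7 + c * (6 * vk / r ^ 5 - 30 * s * b / r ^ 7)"
  define R where "R = 30 * s * vk / r ^ 7 + 15 * b / r ^ 7 - 105 * s\<^sup>2 * b / r ^ 9 + c * (15 * b / r ^ 7)"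
  define Z where "Z = - 6 * s * vk / r ^ 5 + b * (15 * s\<^sup>2 / r ^ 7 - 3 / r ^ 5) - 3 * c * b / r ^ 5"
  have "(\<Sum>l\<in>UNIV. green_grad c v l l k w) =
     (\<Sum>l\<in>UNIV. (if l = k then X l else 0) + P * (v $ l * v $ l) + Q * (w $ l * v $ l) + R * (w $ l * w $ l) + Z)"
    by (intro sum.cong refl)
       (auto simp: green_grad_def green_entry2_deriv_def r_def[symmetric] s_def[symmetric] b_def[symmetric]
          vk_def[symmetric] X_def P_def Q_def R_def Z_def divide_inverse algebra_simps power2_eq_square)
  also have "\<dots> = X k + P + Q * s + R * r\<^sup>2 + 3 * Z"
    by (simp only: sum.distrib sum_distrib_left[symmetric] vv wv ww) simp
  also have "\<dots> = 2 * c * (3 * (b + 2 * s * vk) / r ^ 5 - 15 * s\<^sup>2 * b / r ^ 7)"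
    using r by (simp add: X_def P_def Q_def R_def Z_def b_def[symmetric] vk_def[symmetric])
       (simp add: field_simps eval_nat_numeral)
  also have "\<dots> = 2 * c * third_deriv v v (axis k 1) w"
    using v by (simp add: third_deriv_def r_def[symmetric] inner_axis inner_axis' inner_commute[of v w]
      s_def[symmetric] b_def[symmetric] vk_def[symmetric] norm_eq_1)
      (simp add: power2_eq_square algebra_simps)
  finally show ?thesis .
qed

text \<open>The Stokeslet has symmetrised gradient - 6 w_i w_j w_k / r^5 + 2 \<delta>_ij w_k / r^3.
  Two derivatives along \<open>v\<close> turn the first term into \<open>cubic2\<close>, and the
  second into a third derivative of 1 / r, because w_k / r^3 is minus the k-th derivative of 1 / r.
  The terms with \<open>c\<close> form \<open>residual\<close> and a diagonal part that
  \<open>stress_green\<close> cancels.\<close>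

lemma green_grad_symmetric:
  assumes v: "norm v = 1"
  shows "green_grad c v i j k w + green_grad c v j i k w =
    - 6 * cubic2 v i j k w - 2 * (if i = j then 1 else 0) * third_deriv v v (axis k 1) w
    + c * (residual v i j k w + 2 * (if i = j then 1 else 0) * third_deriv v v (axis k 1) w)"
proof -
  define r s where "r = norm w" and "s = w \<bullet> v"
  define dij djk dik :: real where "dij = (if i = j then 1 else 0)" and "djk = (if j = k then 1 else 0)"
    and "dik = (if i = k then 1 else 0)"
  have d: "(if i = j then 1 else 0) = dij" "(if j = i then 1 else 0) = dij"
    "(if j = k then 1 else 0) = djk" "(if i = k then 1 else 0) = dik"
    by (auto simp: dij_def djk_def dik_def)
  have ax: "axis i 1 \<bullet> (axis j 1 :: real^3) = dij" "axis j 1 \<bullet> (axis k 1 :: real^3) = djk"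
     "axis i 1 \<bullet> (axis k 1 :: real^3) = dik"
    by (auto simp: inner_axis_axis dij_def djk_def dik_def)
  have in1: "axis l 1 \<bullet> w = w $ l" "v \<bullet> axis l 1 = v $ l" "v \<bullet> w = s" "w \<bullet> v = s" for l
    by (auto simp: inner_axis inner_axis' s_def inner_commute)
  have vv: "v \<bullet> v = 1" using v by (simp add: norm_eq_1)
  show ?thesis
    unfolding green_grad_def green_entry2_deriv_def cubic2_def residual_def third_deriv_def d ax in1 vv
      r_def[symmetric]
    by (simp add: divide_inverse algebra_simps power2_eq_square)
qed

section \<open>Integration along the segment\<close>

definition cubic1 :: "real^3 \<Rightarrow> 3 \<Rightarrow> 3 \<Rightarrow> 3 \<Rightarrow> real^3 \<Rightarrow> real" where
  "cubic1 v i j k w =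
     5 * (w \<bullet> v) * (w $ i * w $ j * w $ k) / norm w ^ 7
     - (v $ i * w $ j * w $ k + w $ i * v $ j * w $ k + w $ i * w $ j * v $ k) / norm w ^ 5"

text \<open>The derivative is in the source point, so the sign coming from w = x - y is built into
  \<open>cubic1\<close>. This is why differentiating \<open>cubic1\<close> in w yields minus
  \<open>cubic2\<close>.\<close>

lemma cubic_has_derivative:
  fixes x y :: "real^3"
  assumes "x \<noteq> y"
  shows "(cubic i j k x has_derivative (\<lambda>h. cubic1 h i j k (x - y))) (at y)"
proof -
  define w where "w = x - y"
  have w: "w \<noteq> 0" using assms by (simp add: w_def)
  define p where "p n = (\<lambda>w::real^3. 1 / norm w ^ n)" for n
  have p: "(p n has_derivative (\<lambda>h. - real n * (w \<bullet> h) / norm w ^ (n + 2))) (at w)" for n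
    unfolding p_def by (rule has_derivative_norm_power[OF w])
  note [derivative_intros] = p has_derivative_nth has_derivative_inner_const
  have "((\<lambda>w. w $ i * w $ j * w $ k * p 5 w) has_derivative (\<lambda>h. - cubic1 h i j k w)) (at w)"
    apply (rule has_derivative_eq_rhs)
     apply (rule derivative_intros)+
    apply (simp add: fun_eq_iff cubic1_def p_def)
    apply (simp add: divide_inverse algebra_simps)
    done
  moreover have "((\<lambda>y. x - y) has_derivative (\<lambda>h. - h)) (at y)"
    by (auto intro!: derivative_eq_intros)
  ultimately have "((\<lambda>y. (x - y) $ i * (x - y) $ j * (x - y) $ k * p 5 (x - y)) has_derivative
      (\<lambda>h. - cubic1 (- h) i j k w)) (at y)"
    unfolding w_def by (rule has_derivative_compose[rotated])
  moreover have "(\<lambda>h. - cubic1 (- h) i j k w) = (\<lambda>h. cubic1 h i j k w)"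
    by (simp add: fun_eq_iff cubic1_def divide_inverse algebra_simps)
  moreover have "cubic i j k x = (\<lambda>y. (x - y) $ i * (x - y) $ j * (x - y) $ k * p 5 (x - y))"
    by (simp add: fun_eq_iff cubic_def p_def)
  ultimately show ?thesis by (simp add: w_def)
qed

lemma cubic1_has_derivative:
  fixes w v :: "real^3"
  assumes v: "norm v = 1" and w: "w \<noteq> 0"
  shows "\<exists>D. (cubic1 v i j k has_derivative D) (at w) \<and> D v = - cubic2 v i j k w"
proof -
  have vv: "v \<bullet> v = 1" using v by (simp add: norm_eq_1)
  define p where "p n = (\<lambda>w::real^3. 1 / norm w ^ n)" for n
  have p: "(p n has_derivative (\<lambda>h. - real n * (w \<bullet> h) / norm w ^ (n + 2))) (at w)" for n
    unfolding p_def by (rule has_derivative_norm_power[OF w])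
  note [derivative_intros] = p has_derivative_nth has_derivative_inner_const
  have e: "cubic1 v i j k = (\<lambda>w. 5 * (w \<bullet> v) * (w $ i * w $ j * w $ k) * p 7 w
     - (v $ i * w $ j * w $ k + w $ i * v $ j * w $ k + w $ i * w $ j * v $ k) * p 5 w)"
    by (simp add: fun_eq_iff cubic1_def p_def)
  show ?thesis
    unfolding e
    apply (rule exI conjI)+
     apply (rule derivative_intros)+
    apply (simp add: cubic2_def p_def vv)
    apply (simp add: divide_inverse algebra_simps power2_eq_square)
    done
qed

lemma continuous_on_line_off_zero:
  fixes f :: "real^3 \<Rightarrow> 'b::real_normed_vector"
  assumes f: "continuous_on (- {0}) f" and off: "\<And>t. t \<in> T \<Longrightarrow> x \<noteq> y + t *\<^sub>R v"
  shows "continuous_on T (\<lambda>t. f (x - y - t *\<^sub>R v))"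
proof (rule continuous_on_compose2[OF f])
  have "x - y - t *\<^sub>R v \<noteq> 0" if "t \<in> T" for t
    using off[OF that] by (auto simp: algebra_simps)
  then show "(\<lambda>t. x - y - t *\<^sub>R v) ` T \<subseteq> - {0}" by auto
qed (intro continuous_intros)

lemma continuous_on_cubic2: "continuous_on (- {0}) (cubic2 v i j k)"
  unfolding cubic2_def by (intro continuous_intros) auto

lemma integral_cubic2:
  assumes v: "norm v = 1" and h: "0 \<le> h" and off: "\<And>t. t \<in> {0..h} \<Longrightarrow> x \<noteq> y + t *\<^sub>R v"
  shows "integral {0..h} (\<lambda>t. t * cubic2 v i j k (x - y - t *\<^sub>R v)) =
    cubic i j k x y - cubic i j k x (y + h *\<^sub>R v) + h * cubic1 v i j k (x - (y + h *\<^sub>R v))"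
proof -
  have c: "((\<lambda>t. cubic i j k x (y + t *\<^sub>R v)) has_real_derivative cubic1 v i j k (x - (y + t *\<^sub>R v))) (at t)"
    if "t \<in> {0..h}" for t
  proof -
    have "((\<lambda>t. y + t *\<^sub>R v) has_derivative (\<lambda>h. h *\<^sub>R v)) (at t)"
      by (auto intro!: derivative_eq_intros)
    from has_derivative_compose[OF this cubic_has_derivative[OF off[OF that], of i j k]]
    show ?thesis
      unfolding has_field_derivative_def
      by (rule has_derivative_eq_rhs) (simp add: fun_eq_iff cubic1_def divide_inverse algebra_simps)
  qed
  have c1: "((\<lambda>t. cubic1 v i j k (x - (y + t *\<^sub>R v))) has_real_derivative cubic2 v i j k (x - (y + t *\<^sub>R v))) (at t)"
    if "t \<in> {0..h}" for t
  proof -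
    have w: "x - (y + t *\<^sub>R v) \<noteq> 0" using off[OF that] by simp
    obtain D where D: "(cubic1 v i j k has_derivative D) (at (x - (y + t *\<^sub>R v)))"
        "D v = - cubic2 v i j k (x - (y + t *\<^sub>R v))"
      using cubic1_has_derivative[OF v w] by blast
    have "((\<lambda>t. x - (y + t *\<^sub>R v)) has_derivative (\<lambda>h. - (h *\<^sub>R v))) (at t)"
      by (auto intro!: derivative_eq_intros)
    from has_derivative_compose[OF this D(1)] has_derivative_linear[OF D(1)]
    show ?thesis
      unfolding has_field_derivative_def
      by (auto simp: fun_eq_iff linear_neg linear_cmul D(2) mult.commute elim!: has_derivative_eq_rhs)
  qed
  \<comment> \<open>With f(t) the value of \<open>cubic i j k x\<close> at y + t v, the function t
    f''(t) has the antiderivative t f'(t) - f(t).\<close>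
  have "((\<lambda>t. t * cubic2 v i j k (x - (y + t *\<^sub>R v))) has_integral
      (h * cubic1 v i j k (x - (y + h *\<^sub>R v)) - cubic i j k x (y + h *\<^sub>R v)
       - (0 * cubic1 v i j k (x - (y + 0 *\<^sub>R v)) - cubic i j k x (y + 0 *\<^sub>R v)))) {0..h}"
  proof (rule fundamental_theorem_of_calculus[OF h])
    fix t assume t: "t \<in> {0..h}"
    have "((\<lambda>t. t * cubic1 v i j k (x - (y + t *\<^sub>R v)) - cubic i j k x (y + t *\<^sub>R v)) has_real_derivative
        t * cubic2 v i j k (x - (y + t *\<^sub>R v))) (at t)"
      by (rule derivative_eq_intros c[OF t] c1[OF t] refl)+ simp
    then show "((\<lambda>t. t * cubic1 v i j k (x - (y + t *\<^sub>R v)) - cubic i j k x (y + t *\<^sub>R v)) has_vector_derivative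
        t * cubic2 v i j k (x - (y + t *\<^sub>R v))) (at t within {0..h})"
      by (simp add: has_real_derivative_iff_has_vector_derivative has_vector_derivative_at_within)
  qed
  then show ?thesis by (simp add: integral_unique diff_diff_eq)
qed

text \<open>Differentiation under the integral sign. \<open>F\<close> is known only off the segment,
  but the segment is compact, so the formula holds on a ball around x, which is also the convex
  neighbourhood that the Leibniz rule asks for.\<close>

lemma pdiff_line_integral:
  fixes f :: "real^3 \<Rightarrow> real" and g :: "3 \<Rightarrow> real^3 \<Rightarrow> real"
  assumes f: "\<And>w. w \<noteq> 0 \<Longrightarrow> (f has_derivative (\<lambda>h. \<Sum>i\<in>UNIV. h $ i * g i w)) (at w)"
    and g: "\<And>i. continuous_on (- {0}) (g i)"
    and F: "\<And>x'. (\<And>t. t \<in> {0..h} \<Longrightarrow> x' \<noteq> y + t *\<^sub>R v) \<Longrightarrow>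
              F x' = integral {0..h} (\<lambda>t. t * f (x' - y - t *\<^sub>R v))"
    and off: "\<And>t. t \<in> {0..h} \<Longrightarrow> x \<noteq> y + t *\<^sub>R v"
  shows "pdiff l F x = integral {0..h} (\<lambda>t. t * g l (x - y - t *\<^sub>R v))"
proof -
  define seg where "seg = (\<lambda>t. y + t *\<^sub>R v) ` {0..h}"
  have "closed seg"
    unfolding seg_def by (intro compact_imp_closed compact_continuous_image continuous_intros) auto
  moreover have "x \<in> - seg" unfolding seg_def using off by blast
  ultimately obtain e where e: "0 < e" "ball x e \<subseteq> - seg"
    using open_contains_ball[of "- seg"] by (auto simp: open_Compl)
  define U where "U = ball x e"
  have U: "open U" "convex U" "x \<in> U" using e by (auto simp: U_def)
  have offU: "x' - y - t *\<^sub>R v \<noteq> 0" if "x' \<in> U" "t \<in> {0..h}" for x' t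
  proof
    assume "x' - y - t *\<^sub>R v = 0"
    then have "x' = y + t *\<^sub>R v" by (simp add: algebra_simps)
    then have "x' \<in> seg" unfolding seg_def using that(2) by (rule image_eqI)
    then show False using that(1) e(2) by (auto simp: U_def)
  qed
  have offU': "x' \<noteq> y + t *\<^sub>R v" if "x' \<in> U" "t \<in> {0..h}" for x' t
    using offU[OF that] by (auto simp: algebra_simps)
  define gv where "gv w = (\<chi> i. g i w)" for w
  \<comment> \<open>The Leibniz rule wants the derivative to be continuous as a bounded linear map;
    as inner product with a gradient vector it inherits continuity from the components
    \<open>g\<close>.\<close>
  define fx where "fx x' t = blinfun_inner_left (t *\<^sub>R gv (x' - y - t *\<^sub>R v))" for x' t
  have gv: "continuous_on (- {0}) gv"
    unfolding gv_def by (intro continuous_intros g)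
  have fcont: "continuous_on (- {0}) f"
    using f by (intro continuous_at_imp_continuous_on ballI) (auto dest: has_derivative_continuous)
  have gvU: "continuous_on (U \<times> {0..h}) (\<lambda>p. gv (fst p - y - snd p *\<^sub>R v))"
    by (rule continuous_on_compose2[OF gv]) (auto intro!: continuous_intros dest: offU)
  have "((\<lambda>x'. integral (cbox 0 h) (\<lambda>t. t * f (x' - y - t *\<^sub>R v))) has_derivative
      blinfun_apply (integral (cbox 0 h) (fx x))) (at x within U)"
  proof (rule leibniz_rule[OF _ _ _ U(3,2)])
    fix x' t assume x': "x' \<in> U" and t: "t \<in> cbox 0 h"
    have "((\<lambda>x'. x' - y - t *\<^sub>R v) has_derivative (\<lambda>h. h)) (at x' within U)"
      by (auto intro!: derivative_eq_intros)
    from has_derivative_compose[OF this f[OF offU]] x' t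
    have "((\<lambda>x'. t * f (x' - y - t *\<^sub>R v)) has_derivative
         (\<lambda>h. t * (\<Sum>i\<in>UNIV. h $ i * g i (x' - y - t *\<^sub>R v)))) (at x' within U)"
      by (intro has_derivative_mult_right) auto
    moreover have "(\<lambda>h. t * (\<Sum>i\<in>UNIV. h $ i * g i (x' - y - t *\<^sub>R v))) = blinfun_apply (fx x' t)"
      by (simp add: fun_eq_iff fx_def gv_def inner_vec_def sum_distrib_left mult_ac)
    ultimately show "((\<lambda>x'. t * f (x' - y - t *\<^sub>R v)) has_derivative blinfun_apply (fx x' t)) (at x' within U)"
      by simp
  next
    fix x' assume "x' \<in> U"
    then show "(\<lambda>t. t * f (x' - y - t *\<^sub>R v)) integrable_on cbox 0 h"
      by (intro integrable_continuous continuous_intros continuous_on_line_off_zero[OF fcont]) (auto dest: offU')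
  next
    show "continuous_on (U \<times> cbox 0 h) (\<lambda>(x, t). fx x t)"
      unfolding fx_def case_prod_unfold
      by (intro bounded_linear.continuous_on[OF bounded_linear_blinfun_inner_left] continuous_intros)
        (use gvU in simp)
  qed
  then have "((\<lambda>x'. integral {0..h} (\<lambda>t. t * f (x' - y - t *\<^sub>R v))) has_derivative
      blinfun_apply (integral {0..h} (fx x))) (at x)"
    using at_within_open[OF U(3,1)] by simp
  then have "(F has_derivative blinfun_apply (integral {0..h} (fx x))) (at x)"
    by (rule has_derivative_transform_within_open[OF _ U(1,3)]) (rule F[symmetric], rule offU')
  then have "pdiff l F x = blinfun_apply (integral {0..h} (fx x)) (axis l 1)"
    by (rule pdiff_eq)
  also have "\<dots> = integral {0..h} (\<lambda>t. blinfun_apply (fx x t) (axis l 1))"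
  proof -
    have "fx x integrable_on {0..h}"
      unfolding fx_def
      by (intro integrable_continuous_real bounded_linear.continuous_on[OF bounded_linear_blinfun_inner_left]
          continuous_intros continuous_on_line_off_zero[OF gv] off)
    from integral_linear[OF this, of "\<lambda>B. blinfun_apply B (axis l 1)"]
    show ?thesis by (simp add: o_def blinfun.bounded_linear_left)
  qed
  also have "\<dots> = integral {0..h} (\<lambda>t. t * g l (x - y - t *\<^sub>R v))"
    by (simp add: fx_def gv_def inner_axis')
  finally show ?thesis .
qed

lemma K_B_eq:
  assumes v: "norm v = 1" and off: "\<And>t. t \<in> {0..h} \<Longrightarrow> x \<noteq> y + t *\<^sub>R v"
  shows "K_B lam mu v h x y $ j $ k =
    integral {0..h} (\<lambda>t. t * (green_mat green_entry2 lam mu v (x - y - t *\<^sub>R v) $ j $ k))"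
proof -
  have "K_B lam mu v h x y = integral {0..h} (\<lambda>t. t *\<^sub>R green_mat green_entry2 lam mu v (x - y - t *\<^sub>R v))"
    unfolding K_B_def by (rule integral_cong) (simp add: K_integrand_eq[OF v off])
  moreover have int: "(\<lambda>t. t *\<^sub>R green_mat green_entry2 lam mu v (x - y - t *\<^sub>R v)) integrable_on {0..h}"
    by (intro integrable_continuous_real continuous_intros
         continuous_on_line_off_zero[OF continuous_on_green_mat2] off)
  moreover have bl: "bounded_linear (\<lambda>A::real^3^3. A $ j $ k)"
    by (intro bounded_linear_compose[OF bounded_linear_vec_nth bounded_linear_vec_nth])
  ultimately show ?thesis
    using integral_linear[OF int bl] by (simp add: o_def)
qed

lemma green_entry2_gradient:
  assumes "w \<noteq> 0"
  shows "((\<lambda>w. green_mat green_entry2 lam mu v w $ j $ k) has_derivative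
    (\<lambda>h. \<Sum>i\<in>UNIV. h $ i * (1 / (4 * pi * mu) *
        green_grad ((1 - lame_alpha lam mu) / lame_alpha lam mu) v i j k w))) (at w)"
proof -
  let ?c = "(1 - lame_alpha lam mu) / lame_alpha lam mu"
  let ?d = "if j = k then 1 else 0 :: real"
  let ?D = "\<lambda>h. green_entry2_deriv ?c ?d (v $ j) (v $ k) (norm w) (w \<bullet> v) (w $ j) (w $ k)
       (h \<bullet> v) (w \<bullet> h) (h $ j) (h $ k)"
  have ax: "(axis l 1 :: real^3) $ m = (if l = m then 1 else 0)" for l m :: 3
    by (simp add: axis_def)
  define G where "G = (\<lambda>h. 1 / (4 * pi * mu) * ?D h)"
  have D: "((\<lambda>w. green_mat green_entry2 lam mu v w $ j $ k) has_derivative G) (at w)"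
    unfolding green_mat_def vec_lambda_beta G_def
    by (intro has_derivative_mult_right green_entry2_has_derivative assms)
  have lin: "linear G" using D has_derivative_linear by blast
  have G: "G h = (\<Sum>i\<in>UNIV. h $ i * (1 / (4 * pi * mu) * green_grad ?c v i j k w))" for h
  proof -
    have "G h = G (\<Sum>l\<in>UNIV. h $ l *\<^sub>R axis l 1)"
      using basis_expansion[of h] by (simp add: scalar_mult_eq_scaleR)
    also have "\<dots> = (\<Sum>l\<in>UNIV. h $ l *\<^sub>R G (axis l 1))"
      by (simp only: linear_sum[OF lin] linear_cmul[OF lin])
    also have "\<dots> = (\<Sum>i\<in>UNIV. h $ i * (1 / (4 * pi * mu) * green_grad ?c v i j k w))"
      by (intro sum.cong refl)
        (auto simp: G_def green_grad_def inner_axis inner_axis' ax)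
    finally show ?thesis .
  qed
  show ?thesis by (rule has_derivative_eq_rhs[OF D ext[OF G]])
qed

lemma continuous_on_green_grad: "continuous_on (- {0}) (green_grad c v i j k)"
  unfolding green_grad_def green_entry2_deriv_def
  by (intro continuous_intros) auto

lemma continuous_on_residual: "continuous_on (- {0}) (residual v i j k)"
  unfolding residual_def third_deriv_def
  by (intro continuous_intros) auto

text \<open>If lam + mu or lam + 2 * mu vanished, \<alpha> would be 0, in the second case because x
  / 0 = 0; if mu vanished, \<alpha> would be 1. All three are excluded by the bounds on
  \<alpha>.\<close>

lemma elastic_nz:
  assumes "elastic lam mu"
  shows "mu \<noteq> 0" "lam + mu \<noteq> 0" "lam + 2 * mu \<noteq> 0"
    "(1 - lame_alpha lam mu) / lame_alpha lam mu = mu / (lam + mu)"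
proof -
  have e: "1 / 4 < (lam + mu) / (lam + 2 * mu)" "(lam + mu) / (lam + 2 * mu) < 1"
    using assms by (auto simp: elastic_def lame_alpha_def)
  show 1: "lam + 2 * mu \<noteq> 0" using e by auto
  show 2: "lam + mu \<noteq> 0"
  proof
    assume "lam + mu = 0"
    then have "(lam + mu) / (lam + 2 * mu) = 0" by simp
    with e show False by simp
  qed
  show "mu \<noteq> 0" using e 1 by auto
  have "1 - lame_alpha lam mu = mu / (lam + 2 * mu)"
    using 1 by (simp add: lame_alpha_def field_simps)
  then show "(1 - lame_alpha lam mu) / lame_alpha lam mu = mu / (lam + mu)"
    using 1 2 by (simp add: lame_alpha_def)
qed

text \<open>The relation \<lambda> c / \<mu> = 1 - c makes the diagonal terms 2 (1 - c), - 2 and 2 c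
  times \<Phi> add up to zero. What is left depends on the Lame parameters only through the factor
  \<open>c\<close>.\<close>

lemma stress_green:
  assumes el: "elastic lam mu" and v: "norm v = 1" and w: "w \<noteq> 0"
  defines "c \<equiv> (1 - lame_alpha lam mu) / lame_alpha lam mu"
  shows "lam * (if i = j then 1 else 0) * (\<Sum>l\<in>UNIV. 1 / (4 * pi * mu) * green_grad c v l l k w)
    + mu * (1 / (4 * pi * mu) * green_grad c v i j k w + 1 / (4 * pi * mu) * green_grad c v j i k w)
    = - 3 / (2 * pi) * cubic2 v i j k w + c / (4 * pi) * residual v i j k w"
proof -
  note nz = elastic_nz[OF el]
  define d :: real where "d = (if i = j then 1 else 0)"
  define \<Phi> where "\<Phi> = third_deriv v v (axis k 1) w"
  have c: "c = mu / (lam + mu)" using nz(4) by (simp add: c_def)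
  have "lam * c / mu = lam / (lam + mu)" using nz(1) by (simp add: c)
  also have "\<dots> = 1 - c" using nz(2) by (simp add: c diff_divide_eq_iff)
  finally have key: "lam * c / mu = 1 - c" .
  have "lam * d * (\<Sum>l\<in>UNIV. 1 / (4 * pi * mu) * green_grad c v l l k w)
    + mu * (1 / (4 * pi * mu) * green_grad c v i j k w + 1 / (4 * pi * mu) * green_grad c v j i k w)
    = 1 / (4 * pi) * (lam / mu * d * (\<Sum>l\<in>UNIV. green_grad c v l l k w)
         + (green_grad c v i j k w + green_grad c v j i k w))"
    using nz(1) by (simp add: sum_distrib_left[symmetric] field_simps sum_divide_distrib[symmetric])
  also have "\<dots> = 1 / (4 * pi) * (2 * d * (lam * c / mu) * \<Phi> - 6 * cubic2 v i j k w - 2 * d * \<Phi>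
       + c * (residual v i j k w + 2 * d * \<Phi>))"
    unfolding green_grad_divergence[OF v w] green_grad_symmetric[OF v] d_def[symmetric] \<Phi>_def[symmetric]
    by (simp add: algebra_simps)
  also have "\<dots> = - 3 / (2 * pi) * cubic2 v i j k w + c / (4 * pi) * residual v i j k w"
    unfolding key by (simp add: field_simps)
  finally show ?thesis by (simp add: d_def)
qed

lemma stress_K_B:
  assumes el: "elastic lam mu" and v: "norm v = 1" and h: "0 \<le> h"
    and off: "\<And>t. t \<in> {0..h} \<Longrightarrow> x \<noteq> y + t *\<^sub>R v"
  shows "stress lam mu (\<lambda>x'. column k (K_B lam mu v h x' y)) i j x =
    - 3 / (2 * pi) * (cubic i j k x y - cubic i j k x (y + h *\<^sub>R v)
        + h * cubic1 v i j k (x - (y + h *\<^sub>R v)))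
    + (1 - lame_alpha lam mu) / lame_alpha lam mu / (4 * pi) *
        integral {0..h} (\<lambda>t. t * residual v i j k (x - y - t *\<^sub>R v))"
proof -
  define c where "c = (1 - lame_alpha lam mu) / lame_alpha lam mu"
  define g where "g i j k w = 1 / (4 * pi * mu) * green_grad c v i j k w" for i j k w
  have gcont: "continuous_on (- {0}) (g i j k)" for i j k
    unfolding g_def by (intro continuous_intros continuous_on_green_grad)
  define I where "I f = integral {0..h} (\<lambda>t. t * f (x - y - t *\<^sub>R v))" for f :: "real^3 \<Rightarrow> real"
  have int: "(\<lambda>t. t * f (x - y - t *\<^sub>R v)) integrable_on {0..h}"
    if "continuous_on (- {0}) f" for f :: "real^3 \<Rightarrow> real"
    by (intro integrable_continuous_real continuous_intros continuous_on_line_off_zero[OF that] off)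
  have I_add: "I (\<lambda>w. f w + g w) = I f + I g"
    if "continuous_on (- {0}) f" "continuous_on (- {0}) g" for f g
    unfolding I_def using integral_add[OF int[OF that(1)] int[OF that(2)]] by (simp add: algebra_simps)
  have I_mult: "I (\<lambda>w. a * f w) = a * I f" for a f
    unfolding I_def using integral_mult_right[of "{0..h}" a "\<lambda>t. t * f (x - y - t *\<^sub>R v)"]
    by (simp add: mult_ac)
  have I_sum: "I (\<lambda>w. \<Sum>l\<in>UNIV. f l w) = (\<Sum>l\<in>UNIV. I (f l))"
    if "\<And>l. continuous_on (- {0}) (f l)" for f :: "3 \<Rightarrow> real^3 \<Rightarrow> real"
    unfolding I_def using integral_sum[OF _ int[OF that], of UNIV "\<lambda>l. l"]
    by (simp add: sum_distrib_left)
  have pd: "pdiff l (\<lambda>z. column k (K_B lam mu v h z y) $ m) x = I (g l m k)" for l m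
    unfolding I_def
  proof (rule pdiff_line_integral[OF green_entry2_gradient[of _ lam mu v m k, folded c_def, folded g_def] gcont _ off])
    fix x' assume off': "\<And>t. t \<in> {0..h} \<Longrightarrow> x' \<noteq> y + t *\<^sub>R v"
    show "column k (K_B lam mu v h x' y) $ m =
        integral {0..h} (\<lambda>t. t * green_mat green_entry2 lam mu v (x' - y - t *\<^sub>R v) $ m $ k)"
      using K_B_eq[OF v off', where j = m and k = k] by (simp add: column_def)
  qed
  have "stress lam mu (\<lambda>x'. column k (K_B lam mu v h x' y)) i j x =
     lam * (if i = j then 1 else 0) * (\<Sum>l\<in>UNIV. I (g l l k)) + mu * (I (g i j k) + I (g j i k))"
    by (simp add: stress_def pd)
  also have "\<dots> = I (\<lambda>w. lam * (if i = j then 1 else 0) * (\<Sum>l\<in>UNIV. g l l k w) + mu * (g i j k w + g j i k w))"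
    by (simp add: I_add I_mult I_sum gcont continuous_intros del: mult_if_delta)
  also have "\<dots> = I (\<lambda>w. - 3 / (2 * pi) * cubic2 v i j k w + c / (4 * pi) * residual v i j k w)"
    unfolding I_def
  proof (rule integral_cong)
    fix t assume "t \<in> {0..h}"
    then have w: "x - y - t *\<^sub>R v \<noteq> 0" using off by (auto simp: algebra_simps)
    show "t * (lam * (if i = j then 1 else 0) * (\<Sum>l\<in>UNIV. g l l k (x - y - t *\<^sub>R v))
            + mu * (g i j k (x - y - t *\<^sub>R v) + g j i k (x - y - t *\<^sub>R v))) =
        t * (- 3 / (2 * pi) * cubic2 v i j k (x - y - t *\<^sub>R v) + c / (4 * pi) * residual v i j k (x - y - t *\<^sub>R v))"
      unfolding g_def c_def by (rule arg_cong[OF stress_green[OF el v w]])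
  qed
  also have "\<dots> = - 3 / (2 * pi) * I (cubic2 v i j k) + c / (4 * pi) * I (residual v i j k)"
    by (subst I_add) (intro continuous_intros continuous_on_cubic2 continuous_on_residual, intro continuous_intros continuous_on_cubic2 continuous_on_residual, simp only: I_mult)
  also have "I (cubic2 v i j k) =
      cubic i j k x y - cubic i j k x (y + h *\<^sub>R v) + h * cubic1 v i j k (x - (y + h *\<^sub>R v))"
    unfolding I_def by (rule integral_cubic2[OF v h off])
  finally show ?thesis by (simp only: I_def c_def)
qed

section \<open>The space of square-integrable fields\<close>

lemma L2_nn_integral:
  assumes "f \<in> L2 M"
  shows "(\<integral>\<^sup>+x. ennreal ((norm (f x))\<^sup>2) \<partial>M) = ennreal ((L2_norm M f)\<^sup>2)"
proof -
  have "(\<integral>\<^sup>+x. ennreal ((norm (f x))\<^sup>2) \<partial>M) = ennreal (\<integral>x. (norm (f x))\<^sup>2 \<partial>M)"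
    using assms by (intro nn_integral_eq_integral) (auto simp: L2_def)
  then show ?thesis by (simp add: L2_norm_def)
qed

lemma L2I_nn_integral:
  assumes [measurable]: "f \<in> borel_measurable M"
    and le: "(\<integral>\<^sup>+x. ennreal ((norm (f x))\<^sup>2) \<partial>M) \<le> ennreal (C\<^sup>2)"
  shows "f \<in> L2 M" and "0 \<le> C \<Longrightarrow> L2_norm M f \<le> C"
proof -
  show f: "f \<in> L2 M"
    using le by (auto simp: L2_def integrable_iff_bounded intro: le_less_trans)
  assume C: "0 \<le> C"
  have "ennreal ((L2_norm M f)\<^sup>2) \<le> ennreal (C\<^sup>2)"
    using le L2_nn_integral[OF f] by simp
  then show "L2_norm M f \<le> C"
    using C power2_le_imp_le by (auto simp: ennreal_le_iff)
qed

lemma L2_norm_nonneg: "0 \<le> L2_norm M f"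
  by (simp add: L2_norm_def)

lemma L2_measurable: "f \<in> L2 M \<Longrightarrow> f \<in> borel_measurable M"
  by (simp add: L2_def)

lemma L2_zero: "(\<lambda>x. 0) \<in> L2 M" "L2_norm M (\<lambda>x. 0) = 0"
  by (auto simp: L2_def L2_norm_def)

lemma L2_scale:
  assumes "f \<in> L2 M"
  shows "(\<lambda>x. c *\<^sub>R f x) \<in> L2 M" "L2_norm M (\<lambda>x. c *\<^sub>R f x) = \<bar>c\<bar> * L2_norm M f"
  using assms by (auto simp: L2_def L2_norm_def power_mult_distrib real_sqrt_mult)

lemma L2_inner_bound:
  assumes "f \<in> L2 M" "g \<in> L2 M"
  shows "integrable M (\<lambda>x. norm (f x) * norm (g x))"
    and "(\<integral>x. norm (f x) * norm (g x) \<partial>M) \<le> L2_norm M f * L2_norm M g"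
proof -
  have [measurable]: "f \<in> borel_measurable M" "g \<in> borel_measurable M"
    using assms by (auto simp: L2_def)
  have "(\<integral>\<^sup>+x. ennreal (norm (f x)) * ennreal (norm (g x)) \<partial>M)\<^sup>2
      \<le> (\<integral>\<^sup>+x. (ennreal (norm (f x)))\<^sup>2 \<partial>M) * (\<integral>\<^sup>+x. (ennreal (norm (g x)))\<^sup>2 \<partial>M)"
    by (rule Cauchy_Schwarz_nn_integral) auto
  also have "\<dots> = ennreal ((L2_norm M f)\<^sup>2 * (L2_norm M g)\<^sup>2)"
    by (simp add: ennreal_power L2_nn_integral assms ennreal_mult)
  finally have le: "(\<integral>\<^sup>+x. ennreal (norm (f x) * norm (g x)) \<partial>M)\<^sup>2
      \<le> ennreal ((L2_norm M f)\<^sup>2 * (L2_norm M g)\<^sup>2)"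
    by (simp add: ennreal_mult)
  then have "(\<integral>\<^sup>+x. ennreal (norm (f x) * norm (g x)) \<partial>M)\<^sup>2 < \<infinity>"
    by (rule le_less_trans) simp
  then have fin: "(\<integral>\<^sup>+x. ennreal (norm (f x) * norm (g x)) \<partial>M) < \<infinity>"
    by (auto simp: power2_eq_square ennreal_mult_less_top top_unique less_top)
  show int: "integrable M (\<lambda>x. norm (f x) * norm (g x))"
    using fin by (auto simp: integrable_iff_bounded)
  have "(\<integral>\<^sup>+x. ennreal (norm (f x) * norm (g x)) \<partial>M) = ennreal (\<integral>x. norm (f x) * norm (g x) \<partial>M)"
    by (rule nn_integral_eq_integral[OF int]) auto
  with le have "(\<integral>x. norm (f x) * norm (g x) \<partial>M)\<^sup>2 \<le> (L2_norm M f * L2_norm M g)\<^sup>2"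
    by (simp add: ennreal_power power_mult_distrib ennreal_le_iff)
  then show "(\<integral>x. norm (f x) * norm (g x) \<partial>M) \<le> L2_norm M f * L2_norm M g"
    by (rule power2_le_imp_le) (simp add: L2_norm_nonneg)
qed

lemma L2_add:
  assumes f: "f \<in> L2 M" and g: "g \<in> L2 M"
  shows "(\<lambda>x. f x + g x) \<in> L2 M" "L2_norm M (\<lambda>x. f x + g x) \<le> L2_norm M f + L2_norm M g"
proof -
  have [measurable]: "f \<in> borel_measurable M" "g \<in> borel_measurable M"
    using assms by (auto simp: L2_def)
  note int = L2_inner_bound(1)[OF f g]
  have i2: "integrable M (\<lambda>x. (norm (f x))\<^sup>2 + 2 * (norm (f x) * norm (g x)) + (norm (g x))\<^sup>2)"
    using f g int by (auto simp: L2_def)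
  have pw: "(norm (f x + g x))\<^sup>2 \<le> (norm (f x))\<^sup>2 + 2 * (norm (f x) * norm (g x)) + (norm (g x))\<^sup>2" for x
  proof -
    have "(norm (f x + g x))\<^sup>2 \<le> (norm (f x) + norm (g x))\<^sup>2"
      by (intro power_mono norm_triangle_ineq) auto
    then show ?thesis by (simp add: power2_sum algebra_simps)
  qed
  have i3: "integrable M (\<lambda>x. (norm (f x + g x))\<^sup>2)"
    by (rule Bochner_Integration.integrable_bound[OF i2]) (use pw in \<open>auto intro!: AE_I2 order_trans[OF pw]\<close>)
  then show "(\<lambda>x. f x + g x) \<in> L2 M" by (simp add: L2_def)
  have sq: "(L2_norm M h)\<^sup>2 = (\<integral>x. (norm (h x))\<^sup>2 \<partial>M)" for h
    by (simp add: L2_norm_def)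
  have "(L2_norm M (\<lambda>x. f x + g x))\<^sup>2 \<le> (\<integral>x. (norm (f x))\<^sup>2 + 2 * (norm (f x) * norm (g x)) + (norm (g x))\<^sup>2 \<partial>M)"
    unfolding sq by (rule integral_mono[OF i3 i2 pw])
  also have "\<dots> = (L2_norm M f)\<^sup>2 + 2 * (\<integral>x. norm (f x) * norm (g x) \<partial>M) + (L2_norm M g)\<^sup>2"
    using f g int by (simp add: sq L2_def)
  also have "\<dots> \<le> (L2_norm M f + L2_norm M g)\<^sup>2"
    using L2_inner_bound(2)[OF f g] by (simp add: power2_sum algebra_simps)
  finally show "L2_norm M (\<lambda>x. f x + g x) \<le> L2_norm M f + L2_norm M g"
    by (rule power2_le_imp_le) (simp add: L2_norm_nonneg)
qed

lemma L2_diff: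
  assumes f: "f \<in> L2 M" and g: "g \<in> L2 M"
  shows "(\<lambda>x. f x - g x) \<in> L2 M" "L2_norm M (\<lambda>x. f x - g x) \<le> L2_norm M f + L2_norm M g"
  using L2_add[OF f L2_scale(1)[OF g, of "-1"]] L2_scale(2)[OF g, of "-1"] by auto

lemma L2_norm_diff_commute: "L2_norm M (\<lambda>x. f x - g x) = L2_norm M (\<lambda>x. g x - f x)"
  by (simp add: L2_norm_def norm_minus_commute)

lemma L2_triangle:
  assumes "f \<in> L2 M" "g \<in> L2 M" "h \<in> L2 M"
  shows "L2_norm M (\<lambda>x. f x - h x) \<le> L2_norm M (\<lambda>x. f x - g x) + L2_norm M (\<lambda>x. g x - h x)"
  using L2_add(2)[OF L2_diff(1)[OF assms(1,2)] L2_diff(1)[OF assms(2,3)]] by simp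

lemma L2_norm_cong_AE:
  assumes "f \<in> L2 M" "g \<in> L2 M" "AE x in M. f x = g x"
  shows "L2_norm M f = L2_norm M g"
proof -
  have [measurable]: "f \<in> borel_measurable M" "g \<in> borel_measurable M"
    using assms by (auto simp: L2_def)
  have "(\<integral>x. (norm (f x))\<^sup>2 \<partial>M) = (\<integral>x. (norm (g x))\<^sup>2 \<partial>M)"
    by (rule integral_cong_AE) (use assms(3) in auto)
  then show ?thesis by (simp add: L2_norm_def)
qed

lemma L2_norm_zeroD:
  assumes f: "f \<in> L2 M" and "L2_norm M f = 0"
  shows "AE x in M. f x = 0"
proof -
  have "(\<integral>x. (norm (f x))\<^sup>2 \<partial>M) = 0"
    using assms(2) by (simp add: L2_norm_def)
  then have "AE x in M. (norm (f x))\<^sup>2 = 0"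
    using integral_nonneg_eq_0_iff_AE[of M "\<lambda>x. (norm (f x))\<^sup>2"] f by (simp add: L2_def)
  then show ?thesis by simp
qed

lemma L2_eq_AE:
  assumes "f \<in> L2 M" "g \<in> L2 M" "L2_norm M (\<lambda>x. f x - g x) = 0"
  shows "AE x in M. f x = g x"
  using L2_norm_zeroD[OF L2_diff(1)[OF assms(1,2)] assms(3)] by simp

lemma L2_norm_diff_AE:
  assumes "f \<in> L2 M" "g \<in> L2 M" "AE x in M. f x = g x"
  shows "L2_norm M (\<lambda>x. f x - g x) = 0"
  using L2_norm_cong_AE[OF L2_diff(1)[OF assms(1,2)] L2_zero(1)] assms(3) by (auto simp: L2_zero)

text \<open>Each term is at most the whole sum C, so d_k <= sqrt C / 2^k. The weight 4^k is what
  turns square-integrable increments into absolutely summable ones.\<close>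

lemma summable_of_weighted_squares:
  fixes d :: "nat \<Rightarrow> real"
  assumes nonneg: "\<And>k. 0 \<le> d k" and fin: "(\<Sum>k. ennreal (4 ^ k * (d k)\<^sup>2)) < \<infinity>"
  shows "summable d"
proof -
  obtain C where C: "0 \<le> C" "(\<Sum>k. ennreal (4 ^ k * (d k)\<^sup>2)) = ennreal C"
    using fin unfolding infinity_ennreal_def less_top_ennreal by blast
  have le: "d k \<le> sqrt C * (1 / 2) ^ k" for k
  proof -
    have "ennreal (4 ^ k * (d k)\<^sup>2) \<le> (\<Sum>n<Suc k. ennreal (4 ^ n * (d n)\<^sup>2))"
      by (simp only: sum.lessThan_Suc) (rule add_increasing, auto)
    also have "\<dots> \<le> (\<Sum>n. ennreal (4 ^ n * (d n)\<^sup>2))"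
      by (rule sum_le_suminf) auto
    also have "\<dots> = ennreal C" by (rule C(2))
    finally have "ennreal (4 ^ k * (d k)\<^sup>2) \<le> ennreal C" .
    then have "4 ^ k * (d k)\<^sup>2 \<le> C" using C(1) by (simp only: ennreal_le_iff)
    moreover have "(4::real) ^ k = (2 ^ k)\<^sup>2"
      by (simp add: power2_eq_square flip: power_mult_distrib)
    ultimately have "(2 ^ k * d k)\<^sup>2 \<le> C" by (simp add: power_mult_distrib)
    then have "2 ^ k * d k \<le> sqrt C" by (rule real_le_rsqrt)
    then show ?thesis by (simp add: field_simps power_divide)
  qed
  show "summable d"
  proof (rule summable_comparison_test'[where N = 0])
    show "summable (\<lambda>k. sqrt C * (1 / 2 :: real) ^ k)"
      by (intro summable_mult summable_geometric) auto
  qed (use le nonneg in auto)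
qed

text \<open>Riesz-Fischer: a subsequence with fast decaying increments converges almost everywhere,
  and Fatou's lemma passes the Cauchy estimate of the full sequence to that limit.\<close>

theorem L2_complete:
  assumes f: "\<And>n. f n \<in> L2 M"
    and Cauchy: "\<And>e. 0 < e \<Longrightarrow> \<exists>N. \<forall>m\<ge>N. \<forall>n\<ge>N. L2_norm M (\<lambda>x. f m x - f n x) < e"
  shows "\<exists>g\<in>L2 M. (\<lambda>n. L2_norm M (\<lambda>x. f n x - g x)) \<longlonglongrightarrow> 0"
proof -
  have [measurable]: "f n \<in> borel_measurable M" for n
    using f by (simp add: L2_def)
  have "\<forall>k. \<exists>N. \<forall>m\<ge>N. \<forall>n\<ge>N. L2_norm M (\<lambda>x. f m x - f n x) < (1/4) ^ k"
    using Cauchy by simp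
  \<comment> \<open>Increments below 4^-k have squares below 16^-k, which leaves the summable 4^-k
    after multiplication by the weight 4^k.\<close>
  then obtain N where N: "\<And>k m n. m \<ge> N k \<Longrightarrow> n \<ge> N k \<Longrightarrow> L2_norm M (\<lambda>x. f m x - f n x) < (1/4) ^ k"
    by metis
  \<comment> \<open>The partial sum dominates \<open>N k\<close>, and the added k makes the indices
    strictly increasing.\<close>
  define s where "s k = (\<Sum>i\<le>k. N i) + k" for k
  have sN: "N k \<le> s k" for k
    unfolding s_def by (rule trans_le_add1) (rule member_le_sum, auto)
  have s_Suc: "s k < s (Suc k)" for k by (simp add: s_def)
  have s_ge: "k \<le> s k" for k by (simp add: s_def)
  define d where "d k x = norm (f (s (Suc k)) x - f (s k) x)" for k x
  have dk: "(\<integral>\<^sup>+x. ennreal (4 ^ k * (d k x)\<^sup>2) \<partial>M) \<le> ennreal ((1/4) ^ k)" for k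
  proof -
    have "L2_norm M (\<lambda>x. f (s (Suc k)) x - f (s k) x) < (1/4) ^ k"
      using sN[of k] s_Suc[of k] by (intro N) auto
    then have "(L2_norm M (\<lambda>x. f (s (Suc k)) x - f (s k) x))\<^sup>2 \<le> ((1/4) ^ k)\<^sup>2"
      by (intro power_mono) (auto simp: L2_norm_nonneg)
    then have "ennreal (4 ^ k) * ennreal ((L2_norm M (\<lambda>x. f (s (Suc k)) x - f (s k) x))\<^sup>2)
        \<le> ennreal (4 ^ k) * ennreal (((1/4) ^ k)\<^sup>2)"
      by (intro mult_left_mono) (auto simp: ennreal_le_iff)
    also have "\<dots> = ennreal ((1/4) ^ k)"
      by (simp add: power2_eq_square power_divide flip: ennreal_mult)
    finally show ?thesis
      by (simp add: L2_nn_integral[OF L2_diff(1)[OF f f], symmetric] d_def ennreal_mult' nn_integral_cmult)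
  qed
  have "(\<integral>\<^sup>+x. (\<Sum>k. ennreal (4 ^ k * (d k x)\<^sup>2)) \<partial>M) = (\<Sum>k. \<integral>\<^sup>+x. ennreal (4 ^ k * (d k x)\<^sup>2) \<partial>M)"
    by (rule nn_integral_suminf) (auto simp: d_def)
  also have "\<dots> \<le> (\<Sum>k. ennreal ((1/4) ^ k))"
    by (intro suminf_le dk) auto
  also have "\<dots> = ennreal (\<Sum>k. (1/4) ^ k)"
    by (intro suminf_ennreal2 summable_geometric) auto
  also have "\<dots> < \<infinity>" by simp
  finally have "AE x in M. (\<Sum>k. ennreal (4 ^ k * (d k x)\<^sup>2)) \<noteq> \<infinity>"
    by (intro nn_integral_noteq_infinite) (auto simp: d_def)
  then have conv: "AE x in M. convergent (\<lambda>k. f (s k) x)"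
  proof eventually_elim
    case (elim x)
    have "summable (\<lambda>k. d k x)"
      by (rule summable_of_weighted_squares) (use elim in \<open>auto simp: d_def less_top\<close>)
    then have "summable (\<lambda>k. f (s (Suc k)) x - f (s k) x)"
      unfolding d_def by (rule summable_norm_cancel)
    from convergent_add[OF summable_LIMSEQ[OF this, THEN convergentI] convergent_const[of "f (s 0) x"]]
    show ?case by (simp add: sum_lessThan_telescope[of "\<lambda>i. f (s i) x"])
  qed
  define g where "g x = lim (\<lambda>k. f (s k) x)" for x
  have [measurable]: "g \<in> borel_measurable M"
    unfolding g_def by (rule borel_measurable_lim_metric) auto
  have lim: "AE x in M. (\<lambda>k. f (s k) x) \<longlonglongrightarrow> g x"
    using conv by eventually_elim (simp add: g_def convergent_LIMSEQ_iff)
  have bound: "(\<integral>\<^sup>+x. ennreal ((norm (f n x - g x))\<^sup>2) \<partial>M) \<le> ennreal (e\<^sup>2)"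
    if e: "0 < e" and n: "\<And>m. m \<ge> K \<Longrightarrow> L2_norm M (\<lambda>x. f n x - f m x) < e" for e n K
  proof -
    have "(\<integral>\<^sup>+x. ennreal ((norm (f n x - g x))\<^sup>2) \<partial>M)
        = (\<integral>\<^sup>+x. liminf (\<lambda>k. ennreal ((norm (f n x - f (s k) x))\<^sup>2)) \<partial>M)"
    proof (rule nn_integral_cong_AE, use lim in eventually_elim)
      case (elim x)
      have "(\<lambda>k. ennreal ((norm (f n x - f (s k) x))\<^sup>2)) \<longlonglongrightarrow> ennreal ((norm (f n x - g x))\<^sup>2)"
        by (intro tendsto_intros elim)
      then show ?case
        by (intro lim_imp_Liminf[symmetric]) auto
    qed
    also have "\<dots> \<le> liminf (\<lambda>k. \<integral>\<^sup>+x. ennreal ((norm (f n x - f (s k) x))\<^sup>2) \<partial>M)"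
      by (rule nn_integral_liminf) auto
    also have "\<dots> \<le> liminf (\<lambda>k::nat. ennreal (e\<^sup>2))"
    proof (rule Liminf_mono)
      show "\<forall>\<^sub>F k in sequentially. (\<integral>\<^sup>+x. ennreal ((norm (f n x - f (s k) x))\<^sup>2) \<partial>M) \<le> ennreal (e\<^sup>2)"
        unfolding eventually_sequentially
      proof (intro exI[of _ K] allI impI)
        fix k assume "K \<le> k"
        then have "L2_norm M (\<lambda>x. f n x - f (s k) x) < e"
          using s_ge[of k] by (intro n) auto
        then show "(\<integral>\<^sup>+x. ennreal ((norm (f n x - f (s k) x))\<^sup>2) \<partial>M) \<le> ennreal (e\<^sup>2)"
          by (simp add: L2_nn_integral[OF L2_diff(1)[OF f f]] ennreal_le_iff power_mono L2_norm_nonneg)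
      qed
    qed
    also have "\<dots> = ennreal (e\<^sup>2)" by (simp add: Liminf_const)
    finally show ?thesis .
  qed
  obtain K where K: "\<forall>m\<ge>K. \<forall>n\<ge>K. L2_norm M (\<lambda>x. f m x - f n x) < 1"
    using Cauchy[of 1] by auto
  have "(\<lambda>x. f K x - g x) \<in> L2 M"
    by (rule L2I_nn_integral(1)[OF _ bound[of 1 K K]]) (use K in auto)
  from L2_diff(1)[OF f[of K] this] have g: "g \<in> L2 M" by simp
  have "(\<lambda>n. L2_norm M (\<lambda>x. f n x - g x)) \<longlonglongrightarrow> 0"
  proof (rule LIMSEQ_I)
    fix r :: real assume r: "0 < r"
    then obtain K where K: "\<forall>m\<ge>K. \<forall>n\<ge>K. L2_norm M (\<lambda>x. f m x - f n x) < r / 2"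
      using Cauchy[of "r / 2"] by auto
    have "L2_norm M (\<lambda>x. f n x - g x) \<le> r / 2" if "n \<ge> K" for n
      by (rule L2I_nn_integral(2)[OF _ bound[of "r / 2" K n]]) (use K r that in auto)
    then show "\<exists>no. \<forall>n\<ge>no. norm (L2_norm M (\<lambda>x. f n x - g x) - 0) < r"
      using r by (intro exI[of _ K]) (fastforce simp: L2_norm_nonneg)
  qed
  with g show ?thesis by blast
qed

section \<open>Operators on square-integrable fields\<close>

lemma L2_linear_L2: "L2_linear M A \<Longrightarrow> f \<in> L2 M \<Longrightarrow> A f \<in> L2 M"
  by (simp add: L2_linear_def)

lemma L2_linear_addD:
  "L2_linear M A \<Longrightarrow> f \<in> L2 M \<Longrightarrow> g \<in> L2 M \<Longrightarrow> AE x in M. A (\<lambda>z. f z + g z) x = A f x + A g x"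
  by (simp add: L2_linear_def)

lemma L2_linear_scaleD:
  "L2_linear M A \<Longrightarrow> f \<in> L2 M \<Longrightarrow> AE x in M. A (\<lambda>z. c *\<^sub>R f z) x = c *\<^sub>R A f x"
  by (simp add: L2_linear_def)

lemma L2_linear_diff:
  assumes A: "L2_linear M A" and f: "f \<in> L2 M" and g: "g \<in> L2 M"
  shows "AE x in M. A (\<lambda>z. f z - g z) x = A f x - A g x"
proof -
  have "AE x in M. A (\<lambda>z. f z + (-1) *\<^sub>R g z) x = A f x + A (\<lambda>z. (-1) *\<^sub>R g z) x"
    by (intro L2_linear_addD A f L2_scale g)
  moreover have "AE x in M. A (\<lambda>z. (-1) *\<^sub>R g z) x = (-1) *\<^sub>R A g x"
    by (intro L2_linear_scaleD A g)
  ultimately show ?thesis by eventually_elim simp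
qed

lemma L2_linear_norm_diff:
  assumes A: "L2_linear M A" and f: "f \<in> L2 M" and g: "g \<in> L2 M"
  shows "L2_norm M (\<lambda>x. A f x - A g x) = L2_norm M (A (\<lambda>x. f x - g x))"
  using L2_linear_diff[OF assms]
  by (intro L2_norm_cong_AE L2_diff L2_linear_L2[OF A] f g) auto

lemma L2_bounded_linear: "L2_bounded M A \<Longrightarrow> L2_linear M A"
  by (simp add: L2_bounded_def)

lemma L2_boundedE:
  assumes "L2_bounded M A"
  obtains C where "0 < C" "\<And>f. f \<in> L2 M \<Longrightarrow> L2_norm M (A f) \<le> C * L2_norm M f"
proof -
  obtain C where C: "\<And>f. f \<in> L2 M \<Longrightarrow> L2_norm M (A f) \<le> C * L2_norm M f"
    using assms unfolding L2_bounded_def by blast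
  have "L2_norm M (A f) \<le> (\<bar>C\<bar> + 1) * L2_norm M f" if "f \<in> L2 M" for f
    by (rule order_trans[OF C[OF that]]) (intro mult_right_mono, auto simp: L2_norm_nonneg)
  then show ?thesis by (intro that[of "\<bar>C\<bar> + 1"]) auto
qed

lemma L2_linear_add:
  assumes A: "L2_linear M A" and B: "L2_linear M B"
  shows "L2_linear M (\<lambda>f x. A f x + B f x)"
  unfolding L2_linear_def
proof (intro conjI ballI allI)
  fix f g assume f: "f \<in> L2 M" and g: "g \<in> L2 M"
  have "AE x in M. A (\<lambda>z. f z + g z) x = A f x + A g x" "AE x in M. B (\<lambda>z. f z + g z) x = B f x + B g x"
    using A B f g unfolding L2_linear_def by blast+
  then show "AE x in M. A (\<lambda>z. f z + g z) x + B (\<lambda>z. f z + g z) x = A f x + B f x + (A g x + B g x)"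
    by eventually_elim simp
next
  fix f c assume f: "f \<in> L2 M"
  have "AE x in M. A (\<lambda>z. c *\<^sub>R f z) x = c *\<^sub>R A f x" "AE x in M. B (\<lambda>z. c *\<^sub>R f z) x = c *\<^sub>R B f x"
    using A B f unfolding L2_linear_def by blast+
  then show "AE x in M. A (\<lambda>z. c *\<^sub>R f z) x + B (\<lambda>z. c *\<^sub>R f z) x = c *\<^sub>R (A f x + B f x)"
    by eventually_elim (simp add: scaleR_add_right)
qed (intro L2_add L2_linear_L2[OF A] L2_linear_L2[OF B])

lemma L2_linear_scale:
  assumes A: "L2_linear M A"
  shows "L2_linear M (\<lambda>f x. a *\<^sub>R A f x)"
  unfolding L2_linear_def
proof (intro conjI ballI allI)
  fix f g assume f: "f \<in> L2 M" and g: "g \<in> L2 M"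
  have "AE x in M. A (\<lambda>z. f z + g z) x = A f x + A g x"
    using A f g unfolding L2_linear_def by blast
  then show "AE x in M. a *\<^sub>R A (\<lambda>z. f z + g z) x = a *\<^sub>R A f x + a *\<^sub>R A g x"
    by eventually_elim (simp add: scaleR_add_right)
next
  fix f c assume f: "f \<in> L2 M"
  have "AE x in M. A (\<lambda>z. c *\<^sub>R f z) x = c *\<^sub>R A f x"
    using A f unfolding L2_linear_def by blast
  then show "AE x in M. a *\<^sub>R A (\<lambda>z. c *\<^sub>R f z) x = c *\<^sub>R (a *\<^sub>R A f x)"
    by eventually_elim simp
qed (intro L2_scale L2_linear_L2[OF A])

lemma L2_bounded_id: "L2_bounded M (\<lambda>f. f)"
  by (auto simp: L2_bounded_def L2_linear_def intro!: exI[of _ 1])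

lemma L2_bounded_add:
  assumes A: "L2_bounded M A" and B: "L2_bounded M B"
  shows "L2_bounded M (\<lambda>f x. A f x + B f x)"
proof -
  obtain C D where C: "\<And>f. f \<in> L2 M \<Longrightarrow> L2_norm M (A f) \<le> C * L2_norm M f"
    and D: "\<And>f. f \<in> L2 M \<Longrightarrow> L2_norm M (B f) \<le> D * L2_norm M f"
    using A B unfolding L2_bounded_def by blast
  note lin = L2_bounded_linear[OF A] L2_bounded_linear[OF B]
  have "L2_norm M (\<lambda>x. A f x + B f x) \<le> (C + D) * L2_norm M f" if f: "f \<in> L2 M" for f
    using L2_add(2)[OF L2_linear_L2[OF lin(1) f] L2_linear_L2[OF lin(2) f]] C[OF f] D[OF f]
    by (simp add: distrib_right)
  then show ?thesis
    using L2_linear_add[OF lin] unfolding L2_bounded_def by blast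
qed

lemma L2_bounded_scale:
  assumes A: "L2_bounded M A"
  shows "L2_bounded M (\<lambda>f x. a *\<^sub>R A f x)"
proof -
  obtain C where C: "\<And>f. f \<in> L2 M \<Longrightarrow> L2_norm M (A f) \<le> C * L2_norm M f"
    using A unfolding L2_bounded_def by blast
  note lin = L2_bounded_linear[OF A]
  have "L2_norm M (\<lambda>x. a *\<^sub>R A f x) \<le> (\<bar>a\<bar> * C) * L2_norm M f" if f: "f \<in> L2 M" for f
    using L2_scale(2)[OF L2_linear_L2[OF lin f], of a] mult_left_mono[OF C[OF f], of "\<bar>a\<bar>"]
    by (simp add: mult.assoc)
  then show ?thesis
    using L2_linear_scale[OF lin] unfolding L2_bounded_def by blast
qed

lemma L2_bounded_diff:
  assumes A: "L2_bounded M A" and B: "L2_bounded M B"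
  shows "L2_bounded M (\<lambda>f x. A f x - B f x)"
  using L2_bounded_add[OF A L2_bounded_scale[OF B, of "-1"]] by simp

lemma L2_compact_scale:
  assumes A: "L2_compact M A"
  shows "L2_compact M (\<lambda>f x. a *\<^sub>R A f x)"
  unfolding L2_compact_def
proof (intro conjI allI impI)
  have lin: "L2_linear M A" using A by (simp add: L2_compact_def)
  then show "L2_linear M (\<lambda>f x. a *\<^sub>R A f x)" by (rule L2_linear_scale)
  fix f :: "nat \<Rightarrow> real^3 \<Rightarrow> real^3" and C assume f: "\<forall>n. f n \<in> L2 M \<and> L2_norm M (f n) \<le> C"
  then obtain s g where s: "strict_mono s" and g: "g \<in> L2 M"
    and lim: "(\<lambda>n. L2_norm M (\<lambda>x. A (f (s n)) x - g x)) \<longlonglongrightarrow> 0"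
    using A unfolding L2_compact_def by blast
  have "L2_norm M (\<lambda>x. a *\<^sub>R A (f (s n)) x - a *\<^sub>R g x) = \<bar>a\<bar> * L2_norm M (\<lambda>x. A (f (s n)) x - g x)" for n
    using L2_scale(2)[OF L2_diff(1)[OF L2_linear_L2[OF lin] g]] f by (simp add: scaleR_diff_right)
  then have "(\<lambda>n. L2_norm M (\<lambda>x. a *\<^sub>R A (f (s n)) x - a *\<^sub>R g x)) \<longlonglongrightarrow> 0"
    using tendsto_mult_right_zero[OF lim] by simp
  then show "\<exists>s g. strict_mono s \<and> g \<in> L2 M \<and> (\<lambda>n. L2_norm M (\<lambda>x. a *\<^sub>R A (f (s n)) x - g x)) \<longlonglongrightarrow> 0"
    using s L2_scale(1)[OF g] by blast
qed

lemma L2_compact_add: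
  assumes A: "L2_compact M A" and B: "L2_compact M B"
  shows "L2_compact M (\<lambda>f x. A f x + B f x)"
  unfolding L2_compact_def
proof (intro conjI allI impI)
  have lin: "L2_linear M A" "L2_linear M B" using A B by (simp_all add: L2_compact_def)
  then show "L2_linear M (\<lambda>f x. A f x + B f x)" by (rule L2_linear_add)
  fix f :: "nat \<Rightarrow> real^3 \<Rightarrow> real^3" and C assume f: "\<forall>n. f n \<in> L2 M \<and> L2_norm M (f n) \<le> C"
  then obtain s g where s: "strict_mono s" and g: "g \<in> L2 M"
    and lim: "(\<lambda>n. L2_norm M (\<lambda>x. A (f (s n)) x - g x)) \<longlonglongrightarrow> 0"
    using A unfolding L2_compact_def by blast
  obtain r k where r: "strict_mono r" and k: "k \<in> L2 M"
    and lim2: "(\<lambda>n. L2_norm M (\<lambda>x. B (f (s (r n))) x - k x)) \<longlonglongrightarrow> 0"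
    using B f unfolding L2_compact_def by (elim conjE) (drule spec[of _ "\<lambda>n. f (s n)"], blast)
  have lim1: "(\<lambda>n. L2_norm M (\<lambda>x. A (f (s (r n))) x - g x)) \<longlonglongrightarrow> 0"
    using LIMSEQ_subseq_LIMSEQ[OF lim r] by (simp add: o_def)
  have "(\<lambda>n. L2_norm M (\<lambda>x. A (f (s (r n))) x + B (f (s (r n))) x - (g x + k x))) \<longlonglongrightarrow> 0"
  proof (rule tendsto_sandwich[OF _ _ tendsto_const])
    show "(\<lambda>n. L2_norm M (\<lambda>x. A (f (s (r n))) x - g x) + L2_norm M (\<lambda>x. B (f (s (r n))) x - k x)) \<longlonglongrightarrow> 0"
      using tendsto_add[OF lim1 lim2] by simp
    have "L2_norm M (\<lambda>x. A (f (s (r n))) x + B (f (s (r n))) x - (g x + k x))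
       \<le> L2_norm M (\<lambda>x. A (f (s (r n))) x - g x) + L2_norm M (\<lambda>x. B (f (s (r n))) x - k x)" for n
      using L2_add(2)[OF L2_diff(1)[OF L2_linear_L2[OF lin(1)] g] L2_diff(1)[OF L2_linear_L2[OF lin(2)] k]] f
      by (simp add: algebra_simps)
    then show "\<forall>\<^sub>F n in sequentially. L2_norm M (\<lambda>x. A (f (s (r n))) x + B (f (s (r n))) x - (g x + k x))
       \<le> L2_norm M (\<lambda>x. A (f (s (r n))) x - g x) + L2_norm M (\<lambda>x. B (f (s (r n))) x - k x)"
      by simp
  qed (simp add: L2_norm_nonneg)
  moreover have "strict_mono (s \<circ> r)" using s r by (rule strict_mono_o)
  ultimately show "\<exists>s g. strict_mono s \<and> g \<in> L2 M \<and> (\<lambda>n. L2_norm M (\<lambda>x. A (f (s n)) x + B (f (s n)) x - g x)) \<longlonglongrightarrow> 0"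
    using L2_add(1)[OF g k] by (intro exI[of _ "s \<circ> r"] exI[of _ "\<lambda>x. g x + k x"]) simp
qed

text \<open>A diagonal argument. The property \<open>P k\<close> asks for images pairwise within 1 /
  (k + 1), not for convergence: it passes to subsequences, and one good approximation of
  \<open>A\<close> secures it. The diagonal sequence is then Cauchy and has a limit by
  \<open>L2_complete\<close>.\<close>

lemma L2_compact_limit:
  assumes A: "L2_linear M A"
    and approx: "\<And>e. 0 < e \<Longrightarrow> \<exists>B. L2_compact M B \<and>
        (\<forall>f\<in>L2 M. L2_norm M (\<lambda>x. A f x - B f x) \<le> e * L2_norm M f)"
  shows "L2_compact M A"
  unfolding L2_compact_def
proof (intro conjI allI impI)
  show "L2_linear M A" by (rule A)
  fix f :: "nat \<Rightarrow> real^3 \<Rightarrow> real^3" and C assume f: "\<forall>n. f n \<in> L2 M \<and> L2_norm M (f n) \<le> C"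
  have C: "0 \<le> C" using f order_trans[OF L2_norm_nonneg, of M "f 0" C] by blast
  define P where "P k s \<longleftrightarrow> (\<forall>i j. L2_norm M (\<lambda>x. A (f (s i)) x - A (f (s j)) x) \<le> 1 / real (Suc k))"
    for k and s :: "nat \<Rightarrow> nat"
  interpret subseqs P
  proof
    fix k and s :: "nat \<Rightarrow> nat" assume "strict_mono s"
    \<comment> \<open>A quarter of the target, since the path from \<open>A a\<close> through
      \<open>B a\<close>, \<open>g\<close> and \<open>B b\<close> to \<open>A b\<close> has four
      pieces.\<close>
    define e where "e = 1 / (4 * real (Suc k))"
    have e: "0 < e" by (simp add: e_def)
    \<comment> \<open>Dividing by \<open>C + 1\<close> instead of \<open>C\<close> covers the case C
      = 0.\<close>
    obtain B where B: "L2_compact M B"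
      and AB: "\<And>f. f \<in> L2 M \<Longrightarrow> L2_norm M (\<lambda>x. A f x - B f x) \<le> e / (C + 1) * L2_norm M f"
      using approx[of "e / (C + 1)"] e C by auto
    have AB': "L2_norm M (\<lambda>x. A (f n) x - B (f n) x) \<le> e" for n
    proof -
      have "L2_norm M (\<lambda>x. A (f n) x - B (f n) x) \<le> e / (C + 1) * L2_norm M (f n)" using f by (intro AB) simp
      also have "\<dots> \<le> e / (C + 1) * (C + 1)"
        using f C e by (intro mult_left_mono) (auto intro: order_trans[of _ C])
      finally show ?thesis using C by simp
    qed
    obtain r g where r: "strict_mono r" and g: "g \<in> L2 M"
      and lim: "(\<lambda>n. L2_norm M (\<lambda>x. B (f (s (r n))) x - g x)) \<longlonglongrightarrow> 0"
      using B f unfolding L2_compact_def by (elim conjE) (drule spec[of _ "\<lambda>n. f (s n)"], blast)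
    obtain N where "\<forall>n\<ge>N. L2_norm M (\<lambda>x. B (f (s (r n))) x - g x) < e"
      using LIMSEQ_D[OF lim e] by (auto simp: L2_norm_nonneg)
    then have N: "\<And>n. n \<ge> N \<Longrightarrow> L2_norm M (\<lambda>x. B (f (s (r n))) x - g x) \<le> e"
      using less_imp_le by blast
    have Bl: "L2_linear M B" using B by (simp add: L2_compact_def)
    have "L2_norm M (\<lambda>x. A (f (s (r (i + N)))) x - A (f (s (r (j + N)))) x) \<le> 1 / real (Suc k)" for i j
    proof -
      define a b where "a = f (s (r (i + N)))" and "b = f (s (r (j + N)))"
      have ab: "a \<in> L2 M" "b \<in> L2 M" using f by (auto simp: a_def b_def)
      note L = L2_linear_L2[OF A ab(1)] L2_linear_L2[OF A ab(2)] L2_linear_L2[OF Bl ab(1)] L2_linear_L2[OF Bl ab(2)]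
      have "L2_norm M (\<lambda>x. A a x - A b x) \<le> L2_norm M (\<lambda>x. A a x - B a x) + L2_norm M (\<lambda>x. B a x - A b x)"
        by (intro L2_triangle L)
      also have "L2_norm M (\<lambda>x. B a x - A b x) \<le> L2_norm M (\<lambda>x. B a x - g x) + L2_norm M (\<lambda>x. g x - A b x)"
        by (intro L2_triangle L g)
      also have "L2_norm M (\<lambda>x. g x - A b x) \<le> L2_norm M (\<lambda>x. g x - B b x) + L2_norm M (\<lambda>x. B b x - A b x)"
        by (intro L2_triangle L g)
      also have "L2_norm M (\<lambda>x. g x - B b x) \<le> e"
        using N[of "j + N"] by (simp add: b_def L2_norm_diff_commute[of M g])
      also have "L2_norm M (\<lambda>x. B b x - A b x) \<le> e"
        using AB' by (simp add: b_def L2_norm_diff_commute[of M "B _"])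
      also have "L2_norm M (\<lambda>x. B a x - g x) \<le> e" using N[of "i + N"] by (simp add: a_def)
      also have "L2_norm M (\<lambda>x. A a x - B a x) \<le> e" using AB' by (simp add: a_def)
      finally have "L2_norm M (\<lambda>x. A a x - A b x) \<le> e + (e + (e + e))" by simp
      also have "\<dots> = 1 / real (Suc k)" by (simp add: e_def field_simps)
      finally show ?thesis by (simp add: a_def b_def)
    qed
    \<comment> \<open>The shift by \<open>N\<close> is necessary because \<open>P\<close> speaks of
      all indices, not only of large ones.\<close>
    then have "P k (s \<circ> (\<lambda>i. r (i + N)))" by (simp add: P_def)
    moreover have "strict_mono (\<lambda>i. r (i + N))" using r by (auto simp: strict_mono_def)
    ultimately show "\<exists>r'. strict_mono r' \<and> P k (s \<circ> r')" by blast
  qed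
  have diag: "P k (diagseq \<circ> ((+) (Suc k)))" for k
    by (rule diagseq_holds) (simp add: P_def)
  have "\<exists>g\<in>L2 M. (\<lambda>n. L2_norm M (\<lambda>x. A (f (diagseq n)) x - g x)) \<longlonglongrightarrow> 0"
  proof (rule L2_complete)
    show "A (f (diagseq n)) \<in> L2 M" for n using f by (intro L2_linear_L2[OF A]) simp
    fix e :: real assume "0 < e"
    then obtain k where k: "1 / real (Suc k) < e" using nat_approx_posE by blast
    have "L2_norm M (\<lambda>x. A (f (diagseq m)) x - A (f (diagseq n)) x) < e" if "m \<ge> Suc k" "n \<ge> Suc k" for m n
    proof -
      have "L2_norm M (\<lambda>x. A (f ((diagseq \<circ> (+) (Suc k)) (m - Suc k))) x
          - A (f ((diagseq \<circ> (+) (Suc k)) (n - Suc k))) x) \<le> 1 / real (Suc k)"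
        using diag[of k] unfolding P_def by blast
      then show ?thesis using that k by simp
    qed
    then show "\<exists>N. \<forall>m\<ge>N. \<forall>n\<ge>N. L2_norm M (\<lambda>x. A (f (diagseq m)) x - A (f (diagseq n)) x) < e" by blast
  qed
  then show "\<exists>s g. strict_mono s \<and> g \<in> L2 M \<and> (\<lambda>n. L2_norm M (\<lambda>x. A (f (s n)) x - g x)) \<longlonglongrightarrow> 0"
    using subseq_diagseq by blast
qed

text \<open>With P = A' - A, the equation A' u = f reads u = B (f - P u). If C bounds B and
  \<epsilon> = 1 / (2 C), the right-hand side contracts with factor 1/2, so iteration solves it. All
  equations hold only almost everywhere, so the inverse is a choice of solution, and its linearity
  follows from uniqueness almost everywhere.\<close>

theorem L2_invertible_perturbation:
  assumes inv: "L2_invertible M A"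
  shows "\<exists>\<epsilon>>0. \<forall>A'. L2_bounded M A' \<and>
      (\<forall>f\<in>L2 M. L2_norm M (\<lambda>x. A' f x - A f x) \<le> \<epsilon> * L2_norm M f) \<longrightarrow> L2_invertible M A'"
proof -
  obtain B where A: "L2_bounded M A" and B: "L2_bounded M B"
    and AB: "\<And>f. f \<in> L2 M \<Longrightarrow> AE x in M. A (B f) x = f x"
    and BA: "\<And>f. f \<in> L2 M \<Longrightarrow> AE x in M. B (A f) x = f x"
    using inv unfolding L2_invertible_def by blast
  obtain C where C: "0 < C" "\<And>f. f \<in> L2 M \<Longrightarrow> L2_norm M (B f) \<le> C * L2_norm M f"
    using L2_boundedE[OF B] by blast
  note Al = L2_bounded_linear[OF A] and Bl = L2_bounded_linear[OF B]
  note AL = L2_linear_L2[OF Al] and BL = L2_linear_L2[OF Bl]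
  define \<epsilon> where "\<epsilon> = 1 / (2 * C)"
  have "0 < \<epsilon>" using C by (simp add: \<epsilon>_def)
  moreover have "L2_invertible M A'" if A': "L2_bounded M A'"
    and close: "\<And>f. f \<in> L2 M \<Longrightarrow> L2_norm M (\<lambda>x. A' f x - A f x) \<le> \<epsilon> * L2_norm M f" for A'
  proof -
    note A'l = L2_bounded_linear[OF A'] note A'L = L2_linear_L2[OF A'l]
    define P where "P = (\<lambda>f x. A' f x - A f x)"
    have "L2_bounded M P"
      unfolding P_def by (rule L2_bounded_diff[OF A' A])
    note Pl = L2_bounded_linear[OF this] note PL = L2_linear_L2[OF Pl]
    have BP: "C * L2_norm M (P f) \<le> L2_norm M f / 2" if "f \<in> L2 M" for f
      using mult_left_mono[OF close[OF that], of C] C(1) by (simp add: P_def \<epsilon>_def)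
    \<comment> \<open>Absorbing B P u, of norm at most half that of u, gives this lower bound, which
      yields both injectivity and the bound 2 C for the inverse.\<close>
    have coercive: "L2_norm M u \<le> 2 * C * L2_norm M (A' u)" if u: "u \<in> L2 M" for u
    proof -
      have "L2_norm M u = L2_norm M (B (A u))"
        using BA[OF u] by (intro L2_norm_cong_AE u BL AL) auto
      also have "\<dots> \<le> C * L2_norm M (A u)" by (intro C AL u)
      also have "A u = (\<lambda>x. A' u x - P u x)" by (simp add: P_def)
      also have "L2_norm M \<dots> \<le> L2_norm M (A' u) + L2_norm M (P u)"
        by (intro L2_diff A'L PL u)
      finally have "L2_norm M u \<le> C * L2_norm M (A' u) + C * L2_norm M (P u)"
        using C(1) by (simp add: distrib_left)
      then show ?thesis using BP[OF u] by simp
    qed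
    have inj: "AE x in M. u x = w x"
      if u: "u \<in> L2 M" and w: "w \<in> L2 M" and eq: "AE x in M. A' u x = A' w x" for u w
    proof (rule L2_eq_AE[OF u w])
      have "L2_norm M (\<lambda>x. u x - w x) \<le> 2 * C * L2_norm M (A' (\<lambda>x. u x - w x))"
        by (intro coercive L2_diff u w)
      also have "L2_norm M (A' (\<lambda>x. u x - w x)) = L2_norm M (\<lambda>x. A' u x - A' w x)"
        by (rule L2_linear_norm_diff[OF A'l u w, symmetric])
      also have "\<dots> = 0" by (intro L2_norm_diff_AE A'L u w eq)
      finally show "L2_norm M (\<lambda>x. u x - w x) = 0" using L2_norm_nonneg[of M "\<lambda>x. u x - w x"] by simp
    qed
    have surj: "\<exists>u\<in>L2 M. AE x in M. A' u x = f x" if f: "f \<in> L2 M" for f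
    proof -
      define u where "u = rec_nat (\<lambda>x. 0) (\<lambda>n w. B (\<lambda>x. f x - P w x))"
      have u0: "u 0 = (\<lambda>x. 0)" and uS: "u (Suc n) = B (\<lambda>x. f x - P (u n) x)" for n
        by (simp_all add: u_def)
      have uL: "u n \<in> L2 M" for n
        by (induction n) (auto simp: u0 uS L2_zero intro!: BL L2_diff f PL)
      have step: "L2_norm M (\<lambda>x. u (Suc (Suc n)) x - u (Suc n) x) \<le> L2_norm M (\<lambda>x. u (Suc n) x - u n x) / 2" for n
      proof -
        have "L2_norm M (\<lambda>x. u (Suc (Suc n)) x - u (Suc n) x) =
            L2_norm M (B (\<lambda>x. (f x - P (u (Suc n)) x) - (f x - P (u n) x)))"
          unfolding uS[of "Suc n"] uS[of n]
          by (intro L2_linear_norm_diff[OF Bl] L2_diff f PL BL uL)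
        also have "\<dots> \<le> C * L2_norm M (\<lambda>x. (f x - P (u (Suc n)) x) - (f x - P (u n) x))"
          by (intro C L2_diff f PL uL)
        also have "L2_norm M (\<lambda>x. (f x - P (u (Suc n)) x) - (f x - P (u n) x)) = L2_norm M (\<lambda>x. P (u n) x - P (u (Suc n)) x)"
          by simp
        also have "\<dots> = L2_norm M (P (\<lambda>x. u n x - u (Suc n) x))"
          by (intro L2_linear_norm_diff[OF Pl] uL)
        also have "C * \<dots> \<le> L2_norm M (\<lambda>x. u n x - u (Suc n) x) / 2"
          by (intro BP L2_diff uL)
        finally show ?thesis by (simp add: L2_norm_diff_commute[of M "u n"])
      qed
      define D where "D = L2_norm M (\<lambda>x. u 1 x - u 0 x)"
      have D: "L2_norm M (\<lambda>x. u (Suc n) x - u n x) \<le> D * (1/2) ^ n" for n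
      proof (induction n)
        case (Suc n) then show ?case using step[of n] by simp
      qed (simp add: D_def)
      \<comment> \<open>The factor 1 - (1/2)^k, from the finite geometric sum, is what lets the
        induction on k go through.\<close>
      have far: "L2_norm M (\<lambda>x. u (n + k) x - u n x) \<le> 2 * D * (1/2) ^ n * (1 - (1/2) ^ k)" for n k
      proof (induction k)
        case 0 then show ?case by (simp add: L2_zero)
      next
        case (Suc k)
        have "L2_norm M (\<lambda>x. u (n + Suc k) x - u n x) \<le> L2_norm M (\<lambda>x. u (Suc (n + k)) x - u (n + k) x)
            + L2_norm M (\<lambda>x. u (n + k) x - u n x)"
          unfolding add_Suc_right by (intro L2_triangle uL)
        also have "\<dots> \<le> D * (1/2) ^ (n + k) + 2 * D * (1/2) ^ n * (1 - (1/2) ^ k)"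
          by (intro add_mono D Suc)
        finally show ?case by (simp add: power_add algebra_simps)
      qed
      have D0: "0 \<le> D" by (simp add: D_def L2_norm_nonneg)
      have far': "L2_norm M (\<lambda>x. u m x - u n x) \<le> 2 * D * (1/2) ^ n" if "n \<le> m" for m n
      proof -
        obtain k where "m = n + k" using \<open>n \<le> m\<close> le_Suc_ex by blast
        moreover have "2 * D * (1/2) ^ n * (1 - (1/2) ^ k) \<le> 2 * D * (1/2) ^ n * 1"
          using D0 by (intro mult_left_mono) auto
        ultimately show ?thesis using far[of n k] by simp
      qed
      have "\<exists>w\<in>L2 M. (\<lambda>n. L2_norm M (\<lambda>x. u n x - w x)) \<longlonglongrightarrow> 0"
      proof (rule L2_complete[OF uL])
        fix e :: real assume e: "0 < e"
        have "(\<lambda>n. 2 * D * (1/2) ^ n) \<longlonglongrightarrow> 0"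
          by (intro tendsto_mult_right_zero LIMSEQ_power_zero) simp
        from LIMSEQ_D[OF this e] obtain N where N: "\<And>n. n \<ge> N \<Longrightarrow> 2 * D * (1/2) ^ n < e"
          by (auto simp: abs_mult D0)
        have "L2_norm M (\<lambda>x. u m x - u n x) < e" if "m \<ge> N" "n \<ge> N" for m n
        proof (cases "n \<le> m")
          case True then show ?thesis using far'[OF True] N[of n] that by simp
        next
          case False
          then have "n \<ge> m" by simp
          then show ?thesis using far'[OF \<open>n \<ge> m\<close>] N[of m] that by (simp add: L2_norm_diff_commute[of M "u m"])
        qed
        then show "\<exists>N. \<forall>m\<ge>N. \<forall>n\<ge>N. L2_norm M (\<lambda>x. u m x - u n x) < e" by blast
      qed
      then obtain w where w: "w \<in> L2 M" and lim: "(\<lambda>n. L2_norm M (\<lambda>x. u n x - w x)) \<longlonglongrightarrow> 0" by blast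
      obtain CA where CA: "\<And>f. f \<in> L2 M \<Longrightarrow> L2_norm M (A f) \<le> CA * L2_norm M f"
        using L2_boundedE[OF A] by blast
      obtain CP where CP: "\<And>f. f \<in> L2 M \<Longrightarrow> L2_norm M (P f) \<le> CP * L2_norm M f"
        using L2_boundedE[OF \<open>L2_bounded M P\<close>] by blast
      \<comment> \<open>Since A u_(n+1) = f - P u_n almost everywhere, A' w - f equals A (w -
        u_(n+1)) + P (w - u_n); both parts tend to zero.\<close>
      have bound: "L2_norm M (\<lambda>x. A' w x - f x) \<le> CA * L2_norm M (\<lambda>x. u (Suc n) x - w x) + CP * L2_norm M (\<lambda>x. u n x - w x)" for n
      proof -
        have "AE x in M. A (u (Suc n)) x = f x - P (u n) x"
          unfolding uS by (intro AB L2_diff f PL uL)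
        then have "L2_norm M (\<lambda>x. A' w x - f x) = L2_norm M (\<lambda>x. (A w x - A (u (Suc n)) x) + (P w x - P (u n) x))"
          by (intro L2_norm_cong_AE L2_diff L2_add A'L AL PL f w uL, eventually_elim) (simp add: P_def)
        also have "\<dots> \<le> L2_norm M (\<lambda>x. A w x - A (u (Suc n)) x) + L2_norm M (\<lambda>x. P w x - P (u n) x)"
          by (intro L2_add L2_diff AL PL w uL)
        also have "L2_norm M (\<lambda>x. A w x - A (u (Suc n)) x) \<le> CA * L2_norm M (\<lambda>x. w x - u (Suc n) x)"
          unfolding L2_linear_norm_diff[OF Al w uL] by (intro CA L2_diff w uL)
        also have "L2_norm M (\<lambda>x. P w x - P (u n) x) \<le> CP * L2_norm M (\<lambda>x. w x - u n x)"
          unfolding L2_linear_norm_diff[OF Pl w uL] by (intro CP L2_diff w uL)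
        finally show ?thesis by (simp add: L2_norm_diff_commute[of M w])
      qed
      have "(\<lambda>n. CA * L2_norm M (\<lambda>x. u (Suc n) x - w x) + CP * L2_norm M (\<lambda>x. u n x - w x)) \<longlonglongrightarrow> 0"
        using tendsto_add[OF tendsto_mult_right_zero[OF LIMSEQ_Suc[OF lim], of CA] tendsto_mult_right_zero[OF lim, of CP]]
        by simp
      then have "L2_norm M (\<lambda>x. A' w x - f x) \<le> 0"
        by (rule LIMSEQ_le_const) (use bound in blast)
      then have "AE x in M. A' w x = f x"
        using L2_norm_nonneg[of M "\<lambda>x. A' w x - f x"] by (intro L2_eq_AE A'L w f) simp
      with w show ?thesis by blast
    qed
    \<comment> \<open>Solutions are determined only up to null sets, so a representative is chosen
      for each right-hand side.\<close>
    define B' where "B' f = (SOME u. u \<in> L2 M \<and> (AE x in M. A' u x = f x))" for f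
    have B': "B' f \<in> L2 M" "AE x in M. A' (B' f) x = f x" if "f \<in> L2 M" for f
      using someI_ex[of "\<lambda>u. u \<in> L2 M \<and> (AE x in M. A' u x = f x)"] surj[OF that]
      unfolding B'_def by blast+
    have "L2_linear M B'"
      unfolding L2_linear_def
    proof (intro conjI ballI allI)
      fix f g assume f: "f \<in> L2 M" and g: "g \<in> L2 M"
      have "AE x in M. A' (\<lambda>z. B' f z + B' g z) x = A' (B' f) x + A' (B' g) x"
        using A'l B'(1)[OF f] B'(1)[OF g] unfolding L2_linear_def by blast
      then have eq: "AE x in M. A' (B' (\<lambda>z. f z + g z)) x = A' (\<lambda>z. B' f z + B' g z) x"
        using B'(2)[OF f] B'(2)[OF g] B'(2)[OF L2_add(1)[OF f g]] by eventually_elim simp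
      show "AE x in M. B' (\<lambda>z. f z + g z) x = B' f x + B' g x"
        by (rule inj[OF _ _ eq]) (intro L2_add B' f g)+
    next
      fix f and c :: real assume f: "f \<in> L2 M"
      have "AE x in M. A' (\<lambda>z. c *\<^sub>R B' f z) x = c *\<^sub>R A' (B' f) x"
        using A'l B'(1)[OF f] unfolding L2_linear_def by blast
      then have eq: "AE x in M. A' (B' (\<lambda>z. c *\<^sub>R f z)) x = A' (\<lambda>z. c *\<^sub>R B' f z) x"
        using B'(2)[OF f] B'(2)[OF L2_scale(1)[OF f, of c]] by eventually_elim simp
      show "AE x in M. B' (\<lambda>z. c *\<^sub>R f z) x = c *\<^sub>R B' f x"
        by (rule inj[OF _ _ eq]) (intro L2_scale B' f)+
    qed (rule B'(1))
    moreover have "L2_norm M (B' f) \<le> 2 * C * L2_norm M f" if f: "f \<in> L2 M" for f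
      using coercive[OF B'(1)[OF f]] L2_norm_cong_AE[OF A'L[OF B'(1)[OF f]] f B'(2)[OF f]] by simp
    ultimately have "L2_bounded M B'" unfolding L2_bounded_def by blast
    moreover have "AE x in M. B' (A' f) x = f x" if f: "f \<in> L2 M" for f
      by (rule inj[OF B'(1)[OF A'L[OF f]] f B'(2)[OF A'L[OF f]]])
    ultimately show ?thesis
      using A' B'(2) unfolding L2_invertible_def by blast
  qed
  ultimately show ?thesis by blast
qed

section \<open>Smooth surfaces\<close>

lemma has_derivative_grad:
  assumes "f differentiable (at x)"
  shows "(f has_derivative (\<lambda>h. h \<bullet> grad f x)) (at x)"
proof -
  obtain f' where f': "(f has_derivative f') (at x)"
    using assms differentiable_def by blast
  have "f' h = h \<bullet> grad f x" for h
    using ddiff_eq[OF f', of h] by (simp add: ddiff_def grad_def inner_vec_def)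
  then show ?thesis by (intro has_derivative_eq_rhs[OF f']) auto
qed

lemma onorm_inner_le: "onorm (\<lambda>h::real^3. h \<bullet> g) \<le> norm g"
  by (rule onorm_le) (metis Cauchy_Schwarz_ineq2 mult.commute real_norm_def)

lemma C1_lipschitz:
  assumes diff: "f differentiable_on U" and U: "open U"
    and cont: "\<And>l. continuous_on U (pdiff l f)" and sub: "cball p e \<subseteq> U"
  shows "\<exists>L. \<forall>x\<in>cball p e. \<forall>z\<in>cball p e. \<bar>f x - f z\<bar> \<le> L * norm (x - z)"
proof -
  have "continuous_on (cball p e) (grad f)"
    unfolding grad_def
    by (intro continuous_on_vec_lambda continuous_on_subset[OF cont sub])
  then have "bounded (grad f ` cball p e)"
    by (intro compact_imp_bounded compact_continuous_image compact_cball)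
  then obtain L where L: "\<And>x. x \<in> cball p e \<Longrightarrow> norm (grad f x) \<le> L"
    unfolding bounded_iff by blast
  have "norm (f x - f z) \<le> L * norm (x - z)" if "x \<in> cball p e" "z \<in> cball p e" for x z
  proof (rule differentiable_bound[OF convex_cball, of p e f "\<lambda>x h. h \<bullet> grad f x"])
    fix x assume x: "x \<in> cball p e"
    then have "f differentiable (at x)"
      using diff sub U differentiable_on_eq_differentiable_at by blast
    then show "(f has_derivative (\<lambda>h. h \<bullet> grad f x)) (at x within cball p e)"
      using has_derivative_grad has_derivative_at_withinI by blast
    show "onorm (\<lambda>h. h \<bullet> grad f x) \<le> L"
      using onorm_inner_le[of "grad f x"] L[OF x] by simp
  qed (use that in auto)
  then show ?thesis unfolding real_norm_def by blast
qed

text \<open>The components of the gradient are C^1, hence Lipschitz on a closed ball, and the norm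
  of the gradient attains a positive minimum there. This is the quantitative form in which
  smoothness enters the estimates for the normal.\<close>

lemma defining_function_local:
  assumes def: "defining_function \<Omega> p U \<phi>"
  shows "\<exists>e L c. 0 < e \<and> 0 \<le> L \<and> 0 < c \<and> cball p e \<subseteq> U \<and>
    (\<forall>x\<in>cball p e. \<phi> differentiable (at x)) \<and>
    (\<forall>x\<in>cball p e. \<forall>z\<in>cball p e. norm (grad \<phi> x - grad \<phi> z) \<le> L * norm (x - z)) \<and>
    (\<forall>x\<in>cball p e. c \<le> norm (grad \<phi> x))"
proof -
  have U: "open U" "p \<in> U" and C: "Cinf_on U \<phi>" and nz: "\<And>x. x \<in> U \<Longrightarrow> grad \<phi> x \<noteq> 0"
    using def by (auto simp: defining_function_def)
  obtain e where e: "0 < e" "cball p e \<subseteq> U"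
    using U open_contains_cball by blast
  have "Ck_on (Suc (Suc 0)) U \<phi>" using C unfolding Cinf_on_def by blast
  then have d1: "\<phi> differentiable_on U" and d2: "\<And>l. pdiff l \<phi> differentiable_on U"
    and c2: "\<And>l m. continuous_on U (pdiff m (pdiff l \<phi>))"
    by auto
  have diff: "\<phi> differentiable (at x)" if "x \<in> cball p e" for x
    using d1 U e that differentiable_on_eq_differentiable_at by blast
  obtain L where L: "\<And>l x z. x \<in> cball p e \<Longrightarrow> z \<in> cball p e \<Longrightarrow> \<bar>pdiff l \<phi> x - pdiff l \<phi> z\<bar> \<le> L l * norm (x - z)"
    using C1_lipschitz[OF d2 U(1) c2 e(2)] by metis
  define L' where "L' = (\<Sum>l\<in>UNIV. \<bar>L l\<bar>)"
  have L': "norm (grad \<phi> x - grad \<phi> z) \<le> L' * norm (x - z)"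
    if "x \<in> cball p e" "z \<in> cball p e" for x z
  proof -
    have "norm (grad \<phi> x - grad \<phi> z) \<le> (\<Sum>l\<in>UNIV. \<bar>(grad \<phi> x - grad \<phi> z) $ l\<bar>)"
      by (rule norm_le_l1_cart)
    also have "\<dots> \<le> (\<Sum>l\<in>UNIV. \<bar>L l\<bar> * norm (x - z))"
    proof (rule sum_mono)
      fix l
      have "\<bar>(grad \<phi> x - grad \<phi> z) $ l\<bar> \<le> L l * norm (x - z)"
        using L[OF that, of l] by (simp add: grad_def)
      also have "\<dots> \<le> \<bar>L l\<bar> * norm (x - z)" by (intro mult_right_mono) auto
      finally show "\<bar>(grad \<phi> x - grad \<phi> z) $ l\<bar> \<le> \<bar>L l\<bar> * norm (x - z)" .
    qed
    finally show ?thesis by (simp add: L'_def sum_distrib_right)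
  qed
  have "continuous_on (cball p e) (\<lambda>x. norm (grad \<phi> x))"
    unfolding grad_def
    by (intro continuous_on_norm continuous_on_vec_lambda continuous_on_subset[OF differentiable_imp_continuous_on[OF d2] e(2)])
  then obtain x0 where x0: "x0 \<in> cball p e" "\<And>x. x \<in> cball p e \<Longrightarrow> norm (grad \<phi> x0) \<le> norm (grad \<phi> x)"
    using continuous_attains_inf[of "cball p e" "\<lambda>x. norm (grad \<phi> x)"] e(1) by (auto simp: less_imp_le)
  have "0 < norm (grad \<phi> x0)" using nz x0(1) e(2) by auto
  moreover have "0 \<le> L'" by (auto simp: L'_def sum_nonneg)
  ultimately show ?thesis using e diff L' x0(2) by blast
qed

text \<open>Mean value inequality for \<phi> minus its linearisation at x: the gradient of the
  difference is at most L |x - y| on the segment. This gives L in place of the sharp L / 2.\<close>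

lemma taylor_bound:
  assumes diff: "\<And>x. x \<in> cball p e \<Longrightarrow> \<phi> differentiable (at x)"
    and lip: "\<And>x z. x \<in> cball p e \<Longrightarrow> z \<in> cball p e \<Longrightarrow> norm (grad \<phi> x - grad \<phi> z) \<le> L * norm (x - z)"
    and L: "0 \<le> L" and x: "x \<in> cball p e" and y: "y \<in> cball p e"
  shows "\<bar>\<phi> y - \<phi> x - (y - x) \<bullet> grad \<phi> x\<bar> \<le> L * (norm (x - y))\<^sup>2"
proof -
  define \<psi> where "\<psi> z = \<phi> z - z \<bullet> grad \<phi> x" for z
  have seg: "closed_segment x y \<subseteq> cball p e"
    using x y closed_segment_subset convex_cball by blast
  have "norm (\<psi> y - \<psi> x) \<le> (L * norm (x - y)) * norm (y - x)"
  proof (rule differentiable_bound[OF convex_closed_segment, of x y \<psi> "\<lambda>z h. h \<bullet> (grad \<phi> z - grad \<phi> x)"])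
    fix z assume z: "z \<in> closed_segment x y"
    then have zc: "z \<in> cball p e" using seg by blast
    have "((\<lambda>z. \<phi> z - z \<bullet> grad \<phi> x) has_derivative (\<lambda>h. h \<bullet> grad \<phi> z - h \<bullet> grad \<phi> x)) (at z)"
      by (intro has_derivative_diff has_derivative_grad diff zc bounded_linear_imp_has_derivative bounded_linear_inner_left)
    then show "(\<psi> has_derivative (\<lambda>h. h \<bullet> (grad \<phi> z - grad \<phi> x))) (at z within closed_segment x y)"
      unfolding \<psi>_def[abs_def] inner_diff_right by (rule has_derivative_at_withinI)
    have "onorm (\<lambda>h. h \<bullet> (grad \<phi> z - grad \<phi> x)) \<le> norm (grad \<phi> z - grad \<phi> x)"
      by (rule onorm_inner_le)
    also have "\<dots> \<le> L * norm (z - x)" by (rule lip[OF zc x])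
    also have "\<dots> \<le> L * norm (x - y)"
      using segment_bound1[OF z] L by (intro mult_left_mono) (auto simp: norm_minus_commute)
    finally show "onorm (\<lambda>h. h \<bullet> (grad \<phi> z - grad \<phi> x)) \<le> L * norm (x - y)" .
  qed auto
  then show ?thesis
    by (simp add: \<psi>_def inner_diff_left power2_eq_square norm_minus_commute algebra_simps)
qed

lemma directional_sign:
  fixes \<phi> :: "real^3 \<Rightarrow> real"
  assumes "\<phi> differentiable (at p)" "\<phi> p = 0"
  shows "w \<bullet> grad \<phi> p < 0 \<Longrightarrow> \<exists>d>0. \<forall>t>0. t < d \<longrightarrow> \<phi> (p + t *\<^sub>R w) < 0"
    and "w \<bullet> grad \<phi> p > 0 \<Longrightarrow> \<exists>d>0. \<forall>t>0. t < d \<longrightarrow> \<phi> (p + t *\<^sub>R w) > 0"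
proof -
  have "((\<lambda>t. p + t *\<^sub>R w) has_derivative (\<lambda>t. t *\<^sub>R w)) (at 0)"
    by (auto intro!: derivative_eq_intros)
  from has_derivative_compose[OF this, of \<phi> "\<lambda>h. h \<bullet> grad \<phi> p"] has_derivative_grad[OF assms(1)]
  have "((\<lambda>t. \<phi> (p + t *\<^sub>R w)) has_derivative (\<lambda>t. (t *\<^sub>R w) \<bullet> grad \<phi> p)) (at 0)" by simp
  then have D: "((\<lambda>t. \<phi> (p + t *\<^sub>R w)) has_real_derivative w \<bullet> grad \<phi> p) (at 0)"
    by (simp add: has_field_derivative_def mult.commute[of _ "w \<bullet> grad \<phi> p"])
  show "w \<bullet> grad \<phi> p < 0 \<Longrightarrow> \<exists>d>0. \<forall>t>0. t < d \<longrightarrow> \<phi> (p + t *\<^sub>R w) < 0"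
    using DERIV_neg_dec_right[OF D] assms(2) by auto
  show "w \<bullet> grad \<phi> p > 0 \<Longrightarrow> \<exists>d>0. \<forall>t>0. t < d \<longrightarrow> \<phi> (p + t *\<^sub>R w) > 0"
    using DERIV_pos_inc_right[OF D] assms(2) by auto
qed

lemma defining_function_frontier:
  assumes "defining_function \<Omega> p U \<phi>" "x \<in> frontier \<Omega>" "x \<in> U"
  shows "\<phi> x = 0" "defining_function \<Omega> x U \<phi>"
  using assms by (auto simp: defining_function_def)

text \<open>If the unit gradients a and b differed, w = b - a would satisfy w . a < 0 < w . b. For
  small t > 0 the point p + t w would then lie in the domain according to \<phi> and outside it
  according to \<psi>.\<close>

lemma defining_normal_unique:
  assumes p: "p \<in> frontier \<Omega>" and 1: "defining_function \<Omega> p U \<phi>" and 2: "defining_function \<Omega> p V \<psi>"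
  shows "grad \<phi> p /\<^sub>R norm (grad \<phi> p) = grad \<psi> p /\<^sub>R norm (grad \<psi> p)"
proof (rule ccontr)
  assume ne: "grad \<phi> p /\<^sub>R norm (grad \<phi> p) \<noteq> grad \<psi> p /\<^sub>R norm (grad \<psi> p)"
  define a b where "a = grad \<phi> p /\<^sub>R norm (grad \<phi> p)" and "b = grad \<psi> p /\<^sub>R norm (grad \<psi> p)"
  have nz: "grad \<phi> p \<noteq> 0" "grad \<psi> p \<noteq> 0" using 1 2 by (auto simp: defining_function_def)
  have n: "a \<bullet> a = 1" "b \<bullet> b = 1"
    using nz by (auto simp: a_def b_def dot_square_norm power2_eq_square)
  have "0 < (b - a) \<bullet> (b - a)" using ne by (simp add: a_def b_def)
  then have ab: "a \<bullet> b < 1" using n by (simp add: inner_diff inner_commute)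
  define w where "w = b - a"
  have "w \<bullet> a < 0" "w \<bullet> b > 0" using ab n by (auto simp: w_def inner_diff inner_commute)
  moreover have "w \<bullet> grad \<phi> p = norm (grad \<phi> p) * (w \<bullet> a)" "w \<bullet> grad \<psi> p = norm (grad \<psi> p) * (w \<bullet> b)"
    using nz by (auto simp: a_def b_def)
  ultimately have s: "w \<bullet> grad \<phi> p < 0" "w \<bullet> grad \<psi> p > 0"
    using nz by (auto simp: mult_less_0_iff)
  have d: "\<phi> differentiable (at p)" "\<psi> differentiable (at p)"
    using defining_function_local[OF 1] defining_function_local[OF 2] by (force)+
  have z: "\<phi> p = 0" "\<psi> p = 0" using p 1 2 by (auto simp: defining_function_def)
  obtain d1 where d1: "0 < d1" "\<And>t. 0 < t \<Longrightarrow> t < d1 \<Longrightarrow> \<phi> (p + t *\<^sub>R w) < 0"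
    using directional_sign(1)[OF d(1) z(1) s(1)] by blast
  obtain d2 where d2: "0 < d2" "\<And>t. 0 < t \<Longrightarrow> t < d2 \<Longrightarrow> \<psi> (p + t *\<^sub>R w) > 0"
    using directional_sign(2)[OF d(2) z(2) s(2)] by blast
  have "open (U \<inter> V)" "p \<in> U \<inter> V" using 1 2 by (auto simp: defining_function_def)
  then obtain d3 where d3: "0 < d3" "ball p d3 \<subseteq> U \<inter> V" using open_contains_ball by blast
  have w1: "0 < norm w + 1" by (simp add: add_nonneg_pos)
  define m where "m = d3 / (norm w + 1)"
  define t where "t = min (min d1 d2) m / 2"
  have "0 < m" using d3(1) w1 by (simp add: m_def)
  then have t: "0 < t" "t < d1" "t < d2" "t < m"
    using d1(1) d2(1) by (auto simp: t_def min_def)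
  have "norm (t *\<^sub>R w) < d3"
  proof -
    have "norm (t *\<^sub>R w) \<le> t * (norm w + 1)" using t(1) by (simp add: algebra_simps)
    also have "\<dots> < d3" using t(4) w1 by (simp add: m_def field_simps)
    finally show ?thesis .
  qed
  then have q: "p + t *\<^sub>R w \<in> U" "p + t *\<^sub>R w \<in> V" using d3(2) by (auto simp: dist_norm)
  have "\<Omega> \<inter> U = {x\<in>U. \<phi> x < 0}" using 1 unfolding defining_function_def by blast
  then have "p + t *\<^sub>R w \<in> \<Omega>" using q(1) d1(2)[OF t(1,2)] by blast
  moreover have "\<Omega> \<inter> V = {x\<in>V. \<psi> x < 0}" using 2 unfolding defining_function_def by blast
  ultimately have "\<psi> (p + t *\<^sub>R w) < 0" using q(2) by blast
  then show False using d2(2)[OF t(1,3)] by simp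
qed

lemma outward_normal_eq:
  assumes p: "p \<in> frontier \<Omega>" and 1: "defining_function \<Omega> p U \<phi>"
  shows "outward_normal \<Omega> p = grad \<phi> p /\<^sub>R norm (grad \<phi> p)"
  unfolding outward_normal_def
proof (rule the_equality)
  show "\<exists>U \<phi>'. defining_function \<Omega> p U \<phi>' \<and> grad \<phi> p /\<^sub>R norm (grad \<phi> p) = grad \<phi>' p /\<^sub>R norm (grad \<phi>' p)"
    using 1 by blast
next
  fix \<nu> assume "\<exists>U \<phi>'. defining_function \<Omega> p U \<phi>' \<and> \<nu> = grad \<phi>' p /\<^sub>R norm (grad \<phi>' p)"
  then obtain V \<psi> where "defining_function \<Omega> p V \<psi>" "\<nu> = grad \<psi> p /\<^sub>R norm (grad \<psi> p)" by blast
  then show "\<nu> = grad \<phi> p /\<^sub>R norm (grad \<phi> p)"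
    using defining_normal_unique[OF p _ 1] by simp
qed

lemma norm_normalize_diff:
  fixes a b :: "'a::real_normed_vector"
  assumes "0 < c" "c \<le> norm a" "c \<le> norm b"
  shows "norm (a /\<^sub>R norm a - b /\<^sub>R norm b) \<le> 2 / c * norm (a - b)"
proof -
  have nz: "norm a > 0" "norm b > 0" using assms by auto
  have "a /\<^sub>R norm a - b /\<^sub>R norm b = (a - b) /\<^sub>R norm a + (inverse (norm a) - inverse (norm b)) *\<^sub>R b"
    by (simp add: algebra_simps)
  also have "norm \<dots> \<le> norm ((a - b) /\<^sub>R norm a) + norm ((inverse (norm a) - inverse (norm b)) *\<^sub>R b)"
    by (rule norm_triangle_ineq)
  also have "norm ((inverse (norm a) - inverse (norm b)) *\<^sub>R b) = \<bar>norm b - norm a\<bar> / norm a"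
    using nz by (simp add: field_simps abs_mult abs_divide)
  also have "\<dots> \<le> norm (a - b) / norm a"
    using nz norm_triangle_ineq3[of b a] by (simp add: divide_right_mono norm_minus_commute)
  also have "norm ((a - b) /\<^sub>R norm a) + norm (a - b) / norm a = 2 * (norm (a - b) / norm a)"
    by (simp add: divide_inverse)
  also have "\<dots> \<le> 2 * (norm (a - b) / c)"
    using assms nz by (intro mult_left_mono divide_left_mono) auto
  finally show ?thesis by simp
qed

text \<open>Lebesgue numbers: points closer than \<delta> lie in a common ball of a finite cover and
  so share a local constant. The sum of the absolute values dominates all of these constants, and
  monotonicity of \<open>Q\<close> passes to it.\<close>

lemma compact_uniform_near:
  fixes S :: "'a::metric_space set" and Q :: "real \<Rightarrow> 'a \<Rightarrow> 'a \<Rightarrow> bool"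
  assumes S: "compact S"
    and loc: "\<And>p. p \<in> S \<Longrightarrow> \<exists>e>0. \<exists>C. \<forall>x\<in>S \<inter> ball p e. \<forall>y\<in>S \<inter> ball p e. Q C x y"
    and mono: "\<And>C C' x y. Q C x y \<Longrightarrow> C \<le> C' \<Longrightarrow> Q C' x y"
  shows "\<exists>\<delta>>0. \<exists>C. \<forall>x\<in>S. \<forall>y\<in>S. dist x y < \<delta> \<longrightarrow> Q C x y"
proof -
  obtain e C where e: "\<And>p. p \<in> S \<Longrightarrow> 0 < e p"
    and Q: "\<And>p x y. p \<in> S \<Longrightarrow> x \<in> S \<inter> ball p (e p) \<Longrightarrow> y \<in> S \<inter> ball p (e p) \<Longrightarrow> Q (C p) x y"
    using loc by metis
  have "S \<subseteq> (\<Union>p\<in>S. ball p (e p))" using e by auto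
  then obtain T where T: "T \<subseteq> S" "finite T" "S \<subseteq> (\<Union>p\<in>T. ball p (e p))"
    using compactE_image[OF S, of S "\<lambda>p. ball p (e p)"] by auto
  obtain \<delta> where \<delta>: "0 < \<delta>" "\<And>x. x \<in> S \<Longrightarrow> \<exists>G\<in>(\<lambda>p. ball p (e p)) ` T. ball x \<delta> \<subseteq> G"
    using Heine_Borel_lemma[OF S, of "(\<lambda>p. ball p (e p)) ` T"] T(3) by auto
  define C' where "C' = (\<Sum>p\<in>T. \<bar>C p\<bar>)"
  have "Q C' x y" if x: "x \<in> S" and y: "y \<in> S" and xy: "dist x y < \<delta>" for x y
  proof -
    obtain p where p: "p \<in> T" "ball x \<delta> \<subseteq> ball p (e p)" using \<delta>(2)[OF x] by auto
    have "x \<in> ball x \<delta>" "y \<in> ball x \<delta>" using xy \<delta>(1) by auto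
    then have "Q (C p) x y" using Q[of p x y] p T(1) x y by blast
    moreover have "C p \<le> C'"
      unfolding C'_def by (rule order_trans[OF abs_ge_self]) (rule member_le_sum, use p T in auto)
    ultimately show ?thesis by (rule mono)
  qed
  then show ?thesis using \<delta>(1) by blast
qed

lemma outward_normal_unit:
  assumes "smooth_domain \<Omega>" "p \<in> frontier \<Omega>"
  shows "norm (outward_normal \<Omega> p) = 1"
proof -
  obtain U \<phi> where d: "defining_function \<Omega> p U \<phi>" using assms unfolding smooth_domain_def by blast
  then have "grad \<phi> p \<noteq> 0" by (auto simp: defining_function_def)
  then show ?thesis using outward_normal_eq[OF assms(2) d] by simp
qed

text \<open>\<phi> vanishes at both boundary points, so Taylor's bound says directly that y - x is
  orthogonal to the gradient at x up to a quadratic error. The Lipschitz bound survives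
  normalisation because the gradient stays away from zero.\<close>

lemma normal_local:
  assumes \<Omega>: "smooth_domain \<Omega>" and p: "p \<in> frontier \<Omega>"
  shows "\<exists>e>0. \<exists>C. \<forall>x\<in>frontier \<Omega> \<inter> ball p e. \<forall>y\<in>frontier \<Omega> \<inter> ball p e.
     norm (outward_normal \<Omega> x - outward_normal \<Omega> y) \<le> C * norm (x - y) \<and>
     \<bar>outward_normal \<Omega> x \<bullet> (x - y)\<bar> \<le> C * (norm (x - y))\<^sup>2"
proof -
  obtain U \<phi> where def: "defining_function \<Omega> p U \<phi>" using assms unfolding smooth_domain_def by blast
  obtain e L c where e: "0 < e" and L: "0 \<le> L" and c: "0 < c" and sub: "cball p e \<subseteq> U"
    and diff: "\<And>x. x \<in> cball p e \<Longrightarrow> \<phi> differentiable (at x)"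
    and lip: "\<And>x z. x \<in> cball p e \<Longrightarrow> z \<in> cball p e \<Longrightarrow> norm (grad \<phi> x - grad \<phi> z) \<le> L * norm (x - z)"
    and low: "\<And>x. x \<in> cball p e \<Longrightarrow> c \<le> norm (grad \<phi> x)"
    using defining_function_local[OF def] by blast
  define C where "C = 2 * L / c"
  have "norm (outward_normal \<Omega> x - outward_normal \<Omega> y) \<le> C * norm (x - y) \<and>
     \<bar>outward_normal \<Omega> x \<bullet> (x - y)\<bar> \<le> C * (norm (x - y))\<^sup>2"
    if x: "x \<in> frontier \<Omega> \<inter> ball p e" and y: "y \<in> frontier \<Omega> \<inter> ball p e" for x y
  proof
    have xy: "x \<in> cball p e" "y \<in> cball p e" using x y by auto
    have dx: "\<phi> x = 0" "defining_function \<Omega> x U \<phi>" and dy: "\<phi> y = 0" "defining_function \<Omega> y U \<phi>"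
      using defining_function_frontier[OF def] x y xy sub by blast+
    have nx: "outward_normal \<Omega> x = grad \<phi> x /\<^sub>R norm (grad \<phi> x)"
      and ny: "outward_normal \<Omega> y = grad \<phi> y /\<^sub>R norm (grad \<phi> y)"
      using outward_normal_eq dx dy x y by blast+
    have "norm (outward_normal \<Omega> x - outward_normal \<Omega> y) \<le> 2 / c * norm (grad \<phi> x - grad \<phi> y)"
      unfolding nx ny by (rule norm_normalize_diff[OF c low[OF xy(1)] low[OF xy(2)]])
    also have "\<dots> \<le> 2 / c * (L * norm (x - y))"
      using c by (intro mult_left_mono lip xy) auto
    finally show "norm (outward_normal \<Omega> x - outward_normal \<Omega> y) \<le> C * norm (x - y)"
      by (simp add: C_def)
    have "\<bar>(x - y) \<bullet> grad \<phi> x\<bar> \<le> L * (norm (x - y))\<^sup>2"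
      using taylor_bound[OF diff lip L xy] dx(1) dy(1)
      by (simp add: inner_diff_left abs_minus_commute)
    then have "\<bar>outward_normal \<Omega> x \<bullet> (x - y)\<bar> \<le> L * (norm (x - y))\<^sup>2 / norm (grad \<phi> x)"
      using c low[OF xy(1)] unfolding nx by (simp add: inner_commute abs_mult divide_inverse mult.commute mult_left_mono)
    also have "\<dots> \<le> L * (norm (x - y))\<^sup>2 / c"
      using c low[OF xy(1)] L by (intro divide_left_mono mult_pos_pos) auto
    also have "\<dots> \<le> C * (norm (x - y))\<^sup>2"
      using L c by (simp add: C_def divide_right_mono)
    finally show "\<bar>outward_normal \<Omega> x \<bullet> (x - y)\<bar> \<le> C * (norm (x - y))\<^sup>2" .
  qed
  then show ?thesis using e by blast
qed

lemma normal_bounds: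
  assumes \<Omega>: "smooth_domain \<Omega>" and S: "compact (frontier \<Omega>)"
  obtains C where "0 < C"
    "\<And>x y. x \<in> frontier \<Omega> \<Longrightarrow> y \<in> frontier \<Omega> \<Longrightarrow>
       norm (outward_normal \<Omega> x - outward_normal \<Omega> y) \<le> C * norm (x - y)"
    "\<And>x y. x \<in> frontier \<Omega> \<Longrightarrow> y \<in> frontier \<Omega> \<Longrightarrow>
       \<bar>outward_normal \<Omega> x \<bullet> (x - y)\<bar> \<le> C * (norm (x - y))\<^sup>2"
proof -
  let ?n = "outward_normal \<Omega>"
  define Q where "Q C x y \<longleftrightarrow> norm (?n x - ?n y) \<le> C * norm (x - y) \<and>
     \<bar>?n x \<bullet> (x - y)\<bar> \<le> C * (norm (x - y))\<^sup>2" for C x y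
  have Q_mono: "Q C' x y" if Q: "Q C x y" and C: "C \<le> C'" for C C' x y
    using Q mult_right_mono[OF C, of "norm (x - y)"] mult_right_mono[OF C, of "(norm (x - y))\<^sup>2"]
    by (auto simp: Q_def)
  have "\<exists>\<delta>>0. \<exists>C. \<forall>x\<in>frontier \<Omega>. \<forall>y\<in>frontier \<Omega>. dist x y < \<delta> \<longrightarrow> Q C x y"
  proof (rule compact_uniform_near[OF S])
    show "\<exists>e>0. \<exists>C. \<forall>x\<in>frontier \<Omega> \<inter> ball p e. \<forall>y\<in>frontier \<Omega> \<inter> ball p e. Q C x y"
      if "p \<in> frontier \<Omega>" for p
      using normal_local[OF \<Omega> that] by (simp add: Q_def)
  qed (rule Q_mono)
  then obtain \<delta> C where \<delta>: "0 < \<delta>" and Q: "\<And>x y. x \<in> frontier \<Omega> \<Longrightarrow> y \<in> frontier \<Omega> \<Longrightarrow> dist x y < \<delta> \<Longrightarrow> Q C x y"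
    by blast
  \<comment> \<open>2 / \<delta> serves pairs at distance at least \<delta>, where the left-hand
    sides are at most 2 and |x - y|. The summand 1 makes the constant positive.\<close>
  define C' where "C' = \<bar>C\<bar> + 2 / \<delta> + 1"
  have "Q C' x y" if x: "x \<in> frontier \<Omega>" and y: "y \<in> frontier \<Omega>" for x y
  proof (cases "dist x y < \<delta>")
    case True
    have "0 < 2 / \<delta>" using \<delta> by simp
    then have "C \<le> C'" unfolding C'_def using abs_ge_self[of C] by linarith
    then show ?thesis using Q[OF x y True] by (rule Q_mono[rotated])
  next
    case False
    then have d: "\<delta> \<le> norm (x - y)" by (simp add: dist_norm)
    have u: "norm (?n x) = 1" "norm (?n y) = 1" using outward_normal_unit[OF \<Omega>] x y by auto
    have "2 / \<delta> \<le> C'" using \<delta> by (simp add: C'_def)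
    have "norm (?n x - ?n y) \<le> 2" using norm_triangle_ineq4[of "?n x" "?n y"] u by simp
    also have "2 = 2 / \<delta> * \<delta>" using \<delta> by simp
    also have "\<dots> \<le> C' * norm (x - y)" using d \<delta> \<open>2 / \<delta> \<le> C'\<close> by (intro mult_mono) (auto simp: C'_def)
    finally have 1: "norm (?n x - ?n y) \<le> C' * norm (x - y)" .
    have "\<bar>?n x \<bullet> (x - y)\<bar> \<le> norm (x - y)" using Cauchy_Schwarz_ineq2[of "?n x" "x - y"] u by simp
    also have "\<dots> = 1 / \<delta> * \<delta> * norm (x - y)" using \<delta> by simp
    also have "\<dots> \<le> C' * norm (x - y) * norm (x - y)"
      using d \<delta> by (intro mult_mono) (auto simp: C'_def field_simps)
    finally show ?thesis using 1 by (simp add: Q_def power2_eq_square mult.assoc)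
  qed
  moreover have "0 < C'" using \<delta> by (simp add: C'_def add_pos_nonneg add_nonneg_pos)
  ultimately show ?thesis using that unfolding Q_def by blast
qed

lemma continuous_on_normal:
  assumes "smooth_domain \<Omega>" "compact (frontier \<Omega>)"
  shows "continuous_on (frontier \<Omega>) (outward_normal \<Omega>)"
proof -
  obtain C where C: "0 < C" "\<And>x y. x \<in> frontier \<Omega> \<Longrightarrow> y \<in> frontier \<Omega> \<Longrightarrow>
       norm (outward_normal \<Omega> x - outward_normal \<Omega> y) \<le> C * norm (x - y)"
    using normal_bounds[OF assms] by metis
  then have "C-lipschitz_on (frontier \<Omega>) (outward_normal \<Omega>)"
    by (intro lipschitz_onI) (auto simp: dist_norm)
  then show ?thesis by (rule lipschitz_on_continuous_on)
qed

lemma smooth_along_continuous: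
  assumes "smooth_along S h"
  shows "continuous_on S h"
  unfolding continuous_on_eq_continuous_within
proof
  fix p assume p: "p \<in> S"
  obtain U g where U: "open U" "p \<in> U" and g: "Cinf_on U g" and hg: "\<forall>x\<in>S \<inter> U. h x = g x"
    using assms[unfolded smooth_along_def, rule_format, OF p] by (elim exE conjE)
  have "Ck_on 0 U g" using g unfolding Cinf_on_def by blast
  then have "continuous (at p) g" using U by (simp add: continuous_on_eq_continuous_at)
  then have "(g \<longlongrightarrow> g p) (at p within S)"
    using continuous_at_imp_continuous_within continuous_within by blast
  moreover have "\<forall>\<^sub>F x in at p within S. g x = h x"
    unfolding eventually_at_topological using U hg by auto
  ultimately have "(h \<longlongrightarrow> g p) (at p within S)"
    by (rule Lim_transform_eventually)
  then show "continuous (at p within S) h"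
    using hg p U by (simp add: continuous_within)
qed

section \<open>Quadratic growth of the surface measure\<close>

text \<open>\<open>A\<close> is a Lipschitz graph over the coordinates a and b. A grid of N^2
  squares of side 2 r / N in that plane cuts it into pieces of diameter at most D = 4 K r / N. The
  covering sum N^2 (pi / 4) D^2 = 4 pi K^2 r^2 does not depend on N, so it bounds every scale
  \<delta>.\<close>

lemma hausdorff2_graph_bound:
  fixes A :: "(real^3) set"
  assumes K: "0 < K" and r: "0 < r" and A: "A \<subseteq> ball z r"
    and graph: "\<And>x y. x \<in> A \<Longrightarrow> y \<in> A \<Longrightarrow> norm (x - y) \<le> K * (\<bar>x $ a - y $ a\<bar> + \<bar>x $ b - y $ b\<bar>)"
  shows "hausdorff2 A \<le> ennreal (4 * pi * K\<^sup>2 * r\<^sup>2)"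
  unfolding hausdorff2_def
proof (rule SUP_least)
  fix \<delta> :: real assume "\<delta> \<in> {0<..}"
  then have \<delta>: "0 < \<delta>" by simp
  obtain N :: nat where N0: "4 * K * r / \<delta> < real N" using reals_Archimedean2 by blast
  have "0 < 4 * K * r / \<delta>" using K r \<delta> by simp
  then have "0 < real N" using N0 by linarith
  then have N: "0 < N" by simp
  define D where "D = 4 * K * r / real N"
  have D: "0 < D" "D \<le> \<delta>" using K r N N0 \<delta> by (auto simp: D_def field_simps)
  \<comment> \<open>Maps the c-th coordinate range of the ball around \<open>z\<close> onto (0, N),
    so that the integer part numbers the strips of the grid.\<close>
  define u where "u c x = (x $ c - z $ c + r) * real N / (2 * r)" for c and x :: "real^3"
  have u_range: "0 \<le> u c x \<and> u c x < real N" if "x \<in> A" for c x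
  proof -
    have "norm (x - z) < r" using A that by (auto simp: dist_norm norm_minus_commute)
    then have "\<bar>x $ c - z $ c\<bar> < r" using component_le_norm_cart[of "x - z" c] by simp
    then have "0 < x $ c - z $ c + r" "x $ c - z $ c + r < 2 * r" by auto
    moreover from this have "(x $ c - z $ c + r) * real N < 2 * r * real N"
      using N by (intro mult_strict_right_mono) auto
    ultimately show ?thesis using r N by (simp add: u_def pos_divide_less_eq mult.commute)
  qed
  have u_close: "\<bar>x $ c - y $ c\<bar> \<le> 2 * r / real N" if "nat \<lfloor>u c x\<rfloor> = nat \<lfloor>u c y\<rfloor>" "x \<in> A" "y \<in> A" for c x y
  proof -
    have "\<lfloor>u c x\<rfloor> = \<lfloor>u c y\<rfloor>"
      using that u_range[of x c] u_range[of y c] by (simp add: nat_eq_iff)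
    then have "\<bar>u c x - u c y\<bar> < 1" by linarith
    moreover have "u c x - u c y = (x $ c - y $ c) * (real N / (2 * r))"
      by (simp add: u_def diff_divide_distrib[symmetric] left_diff_distrib[symmetric])
    ultimately have "\<bar>x $ c - y $ c\<bar> * (real N / (2 * r)) < 1"
      using r N by (simp add: abs_mult)
    then show ?thesis using r N by (simp add: field_simps)
  qed
  \<comment> \<open>One index encodes the row and column of a square by \<open>div\<close> and
    \<open>mod\<close>. The condition i < N * N empties all further cells, which makes the countable
    cover a finite sum.\<close>
  define cell where "cell i = {x \<in> A. i < N * N \<and> nat \<lfloor>u a x\<rfloor> = i div N \<and> nat \<lfloor>u b x\<rfloor> = i mod N}" for i
  have cell_diff: "norm (x - y) \<le> D" if "x \<in> cell i" "y \<in> cell i" for x y i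
  proof -
    have "x \<in> A" "y \<in> A" using that by (auto simp: cell_def)
    then have "norm (x - y) \<le> K * (\<bar>x $ a - y $ a\<bar> + \<bar>x $ b - y $ b\<bar>)" by (rule graph)
    also have "\<dots> \<le> K * (2 * r / real N + 2 * r / real N)"
      using that K by (intro mult_left_mono add_mono u_close) (auto simp: cell_def)
    finally show ?thesis by (simp add: D_def mult_ac)
  qed
  have diam: "diameter (cell i) \<le> D" for i
    using D(1) cell_diff by (intro diameter_le) auto
  have empty: "cell i = {}" if "i \<notin> {..<N * N}" for i
    using that by (auto simp: cell_def)
  have "A \<subseteq> (\<Union>i. cell i)"
  proof
    fix x assume x: "x \<in> A"
    define i j where "i = nat \<lfloor>u a x\<rfloor>" and "j = nat \<lfloor>u b x\<rfloor>"
    have ij: "i < N" "j < N"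
      using u_range[OF x, of a] u_range[OF x, of b] unfolding i_def j_def by linarith+
    have "i * N + j < i * N + N" using ij by simp
    also have "\<dots> = Suc i * N" by simp
    also have "\<dots> \<le> N * N" using ij by (intro mult_le_mono1) simp
    finally have "x \<in> cell (i * N + j)"
      using x ij by (simp add: cell_def i_def[symmetric] j_def[symmetric])
    then show "x \<in> (\<Union>i. cell i)" by blast
  qed
  moreover have "bounded (cell i)" for i
    by (rule bounded_subset[OF bounded_ball]) (use A in \<open>auto simp: cell_def\<close>)
  ultimately have "cell \<in> {C. A \<subseteq> (\<Union>i. C i) \<and> (\<forall>i. bounded (C i) \<and> diameter (C i) \<le> \<delta>)}"
    using diam D(2) order_trans by blast
  then have "hausdorff2_pre \<delta> A \<le> (\<Sum>i. ennreal (pi / 4 * (diameter (cell i))\<^sup>2))"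
    unfolding hausdorff2_pre_def by (rule INF_lower)
  also have "\<dots> = (\<Sum>i<N * N. ennreal (pi / 4 * (diameter (cell i))\<^sup>2))"
    by (rule suminf_finite) (auto simp: empty)
  also have "\<dots> \<le> (\<Sum>i<N * N. ennreal (pi / 4 * D\<^sup>2))"
  proof (rule sum_mono)
    fix i
    have "0 \<le> diameter (cell i)"
      by (intro diameter_ge_0 bounded_subset[OF bounded_ball]) (use A in \<open>auto simp: cell_def\<close>)
    then show "ennreal (pi / 4 * (diameter (cell i))\<^sup>2) \<le> ennreal (pi / 4 * D\<^sup>2)"
      using diam[of i] by (intro ennreal_leI mult_left_mono power_mono) auto
  qed
  also have "\<dots> = ennreal (real (N * N) * (pi / 4 * D\<^sup>2))"
    by (subst sum_ennreal) auto
  also have "real (N * N) * (pi / 4 * D\<^sup>2) = 4 * pi * K\<^sup>2 * r\<^sup>2"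
    using N by (simp add: D_def power2_eq_square field_simps)
  finally show "hausdorff2_pre \<delta> A \<le> ennreal (4 * pi * K\<^sup>2 * r\<^sup>2)" .
qed

text \<open>Spares \<open>frontier_graph\<close> a case split over the axis \<open>l\<close>: a and
  b are the two other axes.\<close>

lemma complement_axes:
  fixes l :: 3
  shows "\<exists>a b. \<forall>f :: 3 \<Rightarrow> real. sum f UNIV = f l + (f a + f b)"
proof -
  have "l = 1 \<or> l = 2 \<or> l = 3" by (rule exhaust_3)
  then show ?thesis
  proof (elim disjE)
    assume "l = 1" then show ?thesis by (intro exI[of _ 2] exI[of _ 3]) (simp add: sum_3)
  next
    assume "l = 2" then show ?thesis by (intro exI[of _ 1] exI[of _ 3]) (simp add: sum_3)
  next
    assume "l = 3" then show ?thesis by (intro exI[of _ 1] exI[of _ 2]) (simp add: sum_3)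
  qed
qed

text \<open>A quantitative implicit function argument. Let l be an axis with nonzero partial
  derivative at p, of modulus m, and d = y - x. Since \<phi> vanishes at x and y and its gradient is
  nearly constant, |d . grad \<phi>(p)| is at most (m / 2) |d|, and solving for d_l bounds it by the
  other two components.\<close>

lemma frontier_graph:
  assumes \<Omega>: "smooth_domain \<Omega>" and p: "p \<in> frontier \<Omega>"
  shows "\<exists>e K a b. 0 < e \<and> 0 < K \<and> (\<forall>x\<in>frontier \<Omega> \<inter> ball p e. \<forall>y\<in>frontier \<Omega> \<inter> ball p e.
    norm (x - y) \<le> K * (\<bar>x $ a - y $ a\<bar> + \<bar>x $ b - y $ b\<bar>))"
proof -
  obtain U \<phi> where def: "defining_function \<Omega> p U \<phi>" using assms unfolding smooth_domain_def by blast
  obtain e L c where e: "0 < e" and L: "0 \<le> L" and c: "0 < c" and sub: "cball p e \<subseteq> U"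
    and diff: "\<And>x. x \<in> cball p e \<Longrightarrow> \<phi> differentiable (at x)"
    and lip: "\<And>x z. x \<in> cball p e \<Longrightarrow> z \<in> cball p e \<Longrightarrow> norm (grad \<phi> x - grad \<phi> z) \<le> L * norm (x - z)"
    and "\<And>x. x \<in> cball p e \<Longrightarrow> c \<le> norm (grad \<phi> x)"
    using defining_function_local[OF def] by blast
  have "grad \<phi> p \<noteq> 0" using def by (auto simp: defining_function_def)
  then obtain l where l: "grad \<phi> p $ l \<noteq> 0" by (auto simp: vec_eq_iff)
  define m where "m = \<bar>grad \<phi> p $ l\<bar>"
  define G where "G = norm (grad \<phi> p)"
  have m: "0 < m" using l by (simp add: m_def)
  obtain a b where ab: "\<And>f :: 3 \<Rightarrow> real. sum f UNIV = f l + (f a + f b)"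
    using complement_axes[of l] by metis
  \<comment> \<open>Chosen so that 3 L e' <= m / 2: Taylor's bound contributes 2 L e', as |x - y| <=
    2 e', and moving the gradient from x to p contributes L e'. The term L + 1 avoids division by
    zero.\<close>
  define e' where "e' = min e (m / (6 * (L + 1)))"
  have e': "0 < e'" "e' \<le> e" using e m L by (auto simp: e'_def)
  have "3 * L * e' \<le> 3 * (L + 1) * (m / (6 * (L + 1)))"
    using L m e'(1) by (intro mult_mono) (auto simp: e'_def)
  also have "\<dots> = m / 2"
  proof -
    have "L + 1 \<noteq> 0" using L by linarith
    moreover have "3 * M * (m / (6 * M)) = m / 2" if "M \<noteq> 0" for M
      using that by simp
    ultimately show ?thesis by blast
  qed
  finally have small: "3 * L * e' \<le> m / 2" .
  define K where "K = 1 + (G + m / 2) / (m / 2)"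
  have K: "0 < K" using m by (simp add: K_def G_def add_pos_nonneg)
  have "norm (x - y) \<le> K * (\<bar>x $ a - y $ a\<bar> + \<bar>x $ b - y $ b\<bar>)"
    if x: "x \<in> frontier \<Omega> \<inter> ball p e'" and y: "y \<in> frontier \<Omega> \<inter> ball p e'" for x y
  proof -
    have xy: "x \<in> cball p e" "y \<in> cball p e" "p \<in> cball p e" using x y e e' by auto
    have z: "\<phi> x = 0" "\<phi> y = 0"
      using defining_function_frontier(1)[OF def] x y xy sub by blast+
    have xp: "norm (x - p) \<le> e'" "norm (x - y) \<le> 2 * e'"
    proof -
      show 1: "norm (x - p) \<le> e'" using x by (auto simp: dist_norm norm_minus_commute)
      have "norm (p - y) \<le> e'" using y by (auto simp: dist_norm)
      with 1 show "norm (x - y) \<le> 2 * e'" using norm_triangle_ineq[of "x - p" "p - y"] by simp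
    qed
    define d where "d = y - x"
    have "\<bar>d \<bullet> grad \<phi> x\<bar> \<le> L * (norm (x - y))\<^sup>2"
      using taylor_bound[OF diff lip L xy(1,2)] z by (simp add: d_def)
    also have "\<dots> \<le> L * (2 * e' * norm (x - y))"
      using L xp(2) by (intro mult_left_mono) (auto simp: power2_eq_square intro: mult_right_mono)
    finally have 1: "\<bar>d \<bullet> grad \<phi> x\<bar> \<le> 2 * L * e' * norm (x - y)" by simp
    have "\<bar>d \<bullet> (grad \<phi> p - grad \<phi> x)\<bar> \<le> norm d * norm (grad \<phi> p - grad \<phi> x)"
      by (rule Cauchy_Schwarz_ineq2)
    also have "\<dots> \<le> norm d * (L * e')"
      using lip[OF xy(3,1)] mult_left_mono[OF xp(1) L]
      by (intro mult_left_mono) (auto simp: norm_minus_commute)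
    finally have 2: "\<bar>d \<bullet> (grad \<phi> p - grad \<phi> x)\<bar> \<le> L * e' * norm (x - y)"
      by (simp add: d_def norm_minus_commute mult_ac)
    have "\<bar>d \<bullet> grad \<phi> p\<bar> \<le> 3 * L * e' * norm (x - y)"
      using 1 2 by (simp add: inner_diff_right algebra_simps)
    also have "\<dots> \<le> m / 2 * norm (x - y)" using small by (rule mult_right_mono) simp
    finally have 3: "\<bar>d \<bullet> grad \<phi> p\<bar> \<le> m / 2 * norm (x - y)" .
    define s where "s = \<bar>d $ a\<bar> + \<bar>d $ b\<bar>"
    have s: "0 \<le> s" by (simp add: s_def)
    have "d \<bullet> grad \<phi> p = d $ l * grad \<phi> p $ l + (d $ a * grad \<phi> p $ a + d $ b * grad \<phi> p $ b)"
      by (simp add: inner_vec_def ab)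
    then have "\<bar>d $ l * grad \<phi> p $ l\<bar> \<le> \<bar>d \<bullet> grad \<phi> p\<bar> + \<bar>d $ a * grad \<phi> p $ a\<bar> + \<bar>d $ b * grad \<phi> p $ b\<bar>"
      by linarith
    also have "\<dots> \<le> m / 2 * norm (x - y) + \<bar>d $ a\<bar> * G + \<bar>d $ b\<bar> * G"
      using 3 component_le_norm_cart[of "grad \<phi> p"]
      by (intro add_mono) (auto simp: abs_mult G_def intro!: mult_left_mono)
    finally have "m * \<bar>d $ l\<bar> \<le> m / 2 * norm (x - y) + G * s"
      by (simp add: abs_mult m_def s_def algebra_simps)
    moreover have n: "norm (x - y) \<le> \<bar>d $ l\<bar> + s"
      using norm_le_l1_cart[of d] by (simp add: ab s_def d_def norm_minus_commute)
    then have "m / 2 * norm (x - y) \<le> m / 2 * (\<bar>d $ l\<bar> + s)" using m by (intro mult_left_mono) auto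
    ultimately have "m / 2 * \<bar>d $ l\<bar> \<le> (G + m / 2) * s" by (simp add: algebra_simps)
    then have "\<bar>d $ l\<bar> \<le> (G + m / 2) * s / (m / 2)" using m by (simp add: field_simps)
    then have "norm (x - y) \<le> K * s" using n by (simp add: K_def algebra_simps)
    then show ?thesis by (simp add: s_def d_def abs_minus_commute)
  qed
  then show ?thesis using e'(1) K by blast
qed

lemma sets_surface_measure: "sets (surface_measure \<Omega>) = sets (restrict_space borel (frontier \<Omega>))"
proof -
  have "sets hausdorff2_measure = sets borel"
    using sets.sigma_sets_eq[of "borel :: (real^3) measure"] by (simp add: hausdorff2_measure_def)
  then show ?thesis
    unfolding surface_measure_def by (rule sets_restrict_space_cong)
qed

lemma space_surface_measure: "space (surface_measure \<Omega>) = frontier \<Omega>"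
  by (simp add: surface_measure_def hausdorff2_measure_def space_restrict_space space_measure_of_conv)

text \<open>Should \<open>hausdorff2\<close> fail to be countably additive on the Borel sets, \<open>measure_of\<close> would give the
  zero measure; an upper bound holds in either case.\<close>

lemma emeasure_surface_measure_le:
  assumes "A \<in> sets borel" "A \<subseteq> frontier \<Omega>"
  shows "emeasure (surface_measure \<Omega>) A \<le> hausdorff2 A"
proof -
  have "emeasure (surface_measure \<Omega>) A = emeasure hausdorff2_measure A"
    unfolding surface_measure_def
    by (rule emeasure_restrict_space) (use assms in \<open>auto simp: hausdorff2_measure_def\<close>)
  also have "\<dots> \<le> hausdorff2 A"
    unfolding hausdorff2_measure_def using assms
    by (simp add: emeasure_measure_of_conv)
  finally show ?thesis .
qed

lemma surface_sets:
  "A \<in> sets borel \<Longrightarrow> frontier \<Omega> \<inter> A \<in> sets (surface_measure \<Omega>)"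
  unfolding sets_surface_measure sets_restrict_space by blast

lemma surface_measure_small_balls:
  assumes \<Omega>: "smooth_domain \<Omega>" and S: "compact (frontier \<Omega>)"
  shows "\<exists>C>0. \<forall>x\<in>frontier \<Omega>. \<forall>r>0. r \<le> 1 / C \<longrightarrow>
    emeasure (surface_measure \<Omega>) (frontier \<Omega> \<inter> ball x r) \<le> ennreal (C * r\<^sup>2)"
proof (cases "frontier \<Omega> = {}")
  case True then show ?thesis by (intro exI[of _ 1]) simp
next
  case False
  \<comment> \<open>The relation ignores \<open>y\<close> and is evaluated on the diagonal in the
    end. The same C limits the radii and bounds the growth, so a larger C is a weaker demand, as
    \<open>compact_uniform_near\<close> requires.\<close>
  define Q where "Q C x y \<longleftrightarrow> 0 < C \<and> (\<forall>r>0. r \<le> 1 / C \<longrightarrow>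
    emeasure (surface_measure \<Omega>) (frontier \<Omega> \<inter> ball x r) \<le> ennreal (C * r\<^sup>2))" for C and x y :: "real^3"
  have "\<exists>\<delta>>0. \<exists>C. \<forall>x\<in>frontier \<Omega>. \<forall>y\<in>frontier \<Omega>. dist x y < \<delta> \<longrightarrow> Q C x y"
  proof (rule compact_uniform_near[OF S])
    fix p assume p: "p \<in> frontier \<Omega>"
    obtain e K a b where e: "0 < e" and K: "0 < K"
      and graph: "\<And>x y. x \<in> frontier \<Omega> \<inter> ball p e \<Longrightarrow> y \<in> frontier \<Omega> \<inter> ball p e \<Longrightarrow>
        norm (x - y) \<le> K * (\<bar>x $ a - y $ a\<bar> + \<bar>x $ b - y $ b\<bar>)"
      using frontier_graph[OF \<Omega> p] by blast
    define C where "C = 4 * pi * K\<^sup>2 + 2 / e"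
    have C: "0 < C" "2 / e \<le> C" "4 * pi * K\<^sup>2 \<le> C"
      using e K by (auto simp: C_def intro!: add_nonneg_pos)
    have rC: "1 / C \<le> e / 2" using C(1,2) e by (simp add: field_simps)
    have "Q C x y" if x: "x \<in> frontier \<Omega> \<inter> ball p (e / 2)" for x y
      unfolding Q_def
    proof (intro conjI allI impI C(1))
      fix r :: real assume r: "0 < r" "r \<le> 1 / C"
      have sub: "ball x r \<subseteq> ball p e"
      proof
        fix z assume "z \<in> ball x r"
        then show "z \<in> ball p e" using x r rC dist_triangle[of p z x] by auto
      qed
      have "emeasure (surface_measure \<Omega>) (frontier \<Omega> \<inter> ball x r) \<le> hausdorff2 (frontier \<Omega> \<inter> ball x r)"
        by (rule emeasure_surface_measure_le) (auto intro!: sets.Int borel_closed frontier_closed)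
      also have "\<dots> \<le> ennreal (4 * pi * K\<^sup>2 * r\<^sup>2)"
        by (rule hausdorff2_graph_bound[OF K r(1), of _ x a b]) (use sub in \<open>auto intro!: graph\<close>)
      also have "\<dots> \<le> ennreal (C * r\<^sup>2)"
        using C(3) by (intro ennreal_leI mult_right_mono) auto
      finally show "emeasure (surface_measure \<Omega>) (frontier \<Omega> \<inter> ball x r) \<le> ennreal (C * r\<^sup>2)" .
    qed
    then have "\<forall>x\<in>frontier \<Omega> \<inter> ball p (e / 2). \<forall>y\<in>frontier \<Omega> \<inter> ball p (e / 2). Q C x y" by blast
    then show "\<exists>e>0. \<exists>C. \<forall>x\<in>frontier \<Omega> \<inter> ball p e. \<forall>y\<in>frontier \<Omega> \<inter> ball p e. Q C x y"
      using half_gt_zero[OF e] by blast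
  next
    fix C C' x y assume Q: "Q C x y" and C: "C \<le> C'"
    then have pos: "0 < C" "0 < C'" by (auto simp: Q_def)
    have "1 / C' \<le> 1 / C" using C pos by (simp add: frac_le)
    moreover have "ennreal (C * r\<^sup>2) \<le> ennreal (C' * r\<^sup>2)" for r
      using C by (intro ennreal_leI mult_right_mono) auto
    ultimately show "Q C' x y"
      using Q pos unfolding Q_def by (meson order_trans)
  qed
  then obtain \<delta> C where "0 < \<delta>" and Q: "\<And>x y. x \<in> frontier \<Omega> \<Longrightarrow> y \<in> frontier \<Omega> \<Longrightarrow> dist x y < \<delta> \<Longrightarrow> Q C x y"
    by blast
  then have "Q C x x" if "x \<in> frontier \<Omega>" for x using that by simp
  then show ?thesis using False unfolding Q_def by blast
qed

lemma surface_measure_growth: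
  assumes \<Omega>: "smooth_domain \<Omega>" and S: "compact (frontier \<Omega>)"
  shows "finite_measure (surface_measure \<Omega>)"
    and "\<exists>C>0. \<forall>x\<in>frontier \<Omega>. \<forall>r>0.
      emeasure (surface_measure \<Omega>) (frontier \<Omega> \<inter> ball x r) \<le> ennreal (C * r\<^sup>2)"
proof -
  let ?M = "surface_measure \<Omega>"
  obtain C where C: "0 < C" and small: "\<And>x r. x \<in> frontier \<Omega> \<Longrightarrow> 0 < r \<Longrightarrow> r \<le> 1 / C \<Longrightarrow>
      emeasure ?M (frontier \<Omega> \<inter> ball x r) \<le> ennreal (C * r\<^sup>2)"
    using surface_measure_small_balls[OF assms] by blast
  have ball: "frontier \<Omega> \<inter> ball x r \<in> sets ?M" for x r by (rule surface_sets) simp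
  have "frontier \<Omega> \<subseteq> (\<Union>p\<in>frontier \<Omega>. ball p (1 / C))" using C by auto
  then obtain T where T: "T \<subseteq> frontier \<Omega>" "finite T" "frontier \<Omega> \<subseteq> (\<Union>p\<in>T. ball p (1 / C))"
    using compactE_image[OF S, of "frontier \<Omega>" "\<lambda>p. ball p (1 / C)"] by auto
  have "emeasure ?M (space ?M) \<le> emeasure ?M (\<Union>p\<in>T. frontier \<Omega> \<inter> ball p (1 / C))"
  proof (rule emeasure_mono)
    show "space ?M \<subseteq> (\<Union>p\<in>T. frontier \<Omega> \<inter> ball p (1 / C))"
      using T(3) by (auto simp: space_surface_measure)
    show "(\<Union>p\<in>T. frontier \<Omega> \<inter> ball p (1 / C)) \<in> sets ?M"
      using T(2) ball by (intro sets.finite_UN) auto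
  qed
  also have "\<dots> \<le> (\<Sum>p\<in>T. emeasure ?M (frontier \<Omega> \<inter> ball p (1 / C)))"
    using T(2) ball by (intro emeasure_subadditive_finite) auto
  also have "\<dots> \<le> (\<Sum>p\<in>T. ennreal (C * (1 / C)\<^sup>2))"
    using T(1) C by (intro sum_mono small) auto
  also have "\<dots> = ennreal (\<Sum>p\<in>T. C * (1 / C)\<^sup>2)"
    using C by (intro sum_ennreal) auto
  finally have fin: "emeasure ?M (space ?M) \<le> ennreal (\<Sum>p\<in>T. C * (1 / C)\<^sup>2)" .
  then show fm: "finite_measure ?M"
    by (intro finite_measureI) (auto simp: top_unique)
  define m where "m = measure ?M (space ?M)"
  have m: "emeasure ?M (space ?M) = ennreal m" "0 \<le> m"
    using finite_measure.emeasure_eq_measure[OF fm] by (auto simp: m_def)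
  \<comment> \<open>For r > 1 / C the total mass m is at most m (C r)^2, which accounts for the
    second summand.\<close>
  define D where "D = C + m * C\<^sup>2"
  have D: "C \<le> D" "0 < D" "m * C\<^sup>2 \<le> D" using C m by (auto simp: D_def add_pos_nonneg)
  have "emeasure ?M (frontier \<Omega> \<inter> ball x r) \<le> ennreal (D * r\<^sup>2)" if x: "x \<in> frontier \<Omega>" and r: "0 < r" for x r
  proof (cases "r \<le> 1 / C")
    case True
    have "emeasure ?M (frontier \<Omega> \<inter> ball x r) \<le> ennreal (C * r\<^sup>2)" by (rule small[OF x r True])
    also have "\<dots> \<le> ennreal (D * r\<^sup>2)" using D(1) by (intro ennreal_leI mult_right_mono) auto
    finally show ?thesis .
  next
    case False
    then have "1 \<le> C * r" using C by (simp add: field_simps)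
    then have "1 \<le> (C * r)\<^sup>2" by (simp add: one_le_power)
    have "emeasure ?M (frontier \<Omega> \<inter> ball x r) \<le> emeasure ?M (space ?M)" by (rule emeasure_space)
    also have "\<dots> = ennreal (m * 1)" using m by simp
    also have "\<dots> \<le> ennreal (m * (C * r)\<^sup>2)"
      using m(2) \<open>1 \<le> (C * r)\<^sup>2\<close> by (intro ennreal_leI mult_left_mono)
    also have "\<dots> \<le> ennreal (D * r\<^sup>2)"
      using mult_right_mono[OF D(3), of "r\<^sup>2"] by (intro ennreal_leI) (simp add: power_mult_distrib mult.assoc)
    finally show ?thesis .
  qed
  then show "\<exists>C>0. \<forall>x\<in>frontier \<Omega>. \<forall>r>0. emeasure ?M (frontier \<Omega> \<inter> ball x r) \<le> ennreal (C * r\<^sup>2)"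
    using D(2) by blast
qed

section \<open>Weakly singular integral operators\<close>

lemma norm_matrix_vector_mult_le:
  fixes A :: "real^3^3"
  shows "norm (A *v w) \<le> norm A * norm w"
proof -
  have "norm (A *v w) \<le> L2_set (\<lambda>i. norm (A $ i) * norm w) UNIV"
    unfolding norm_vec_def[of "A *v w"]
    by (rule L2_set_mono) (auto simp: matrix_vector_mul_component Cauchy_Schwarz_ineq2)
  also have "\<dots> = norm A * norm w"
    by (simp add: norm_vec_def[of A] L2_set_left_distrib)
  finally show ?thesis .
qed

lemma matrix_vector_mult_measurable[measurable]:
  fixes k :: "'a \<Rightarrow> real^3^3" and f :: "'a \<Rightarrow> real^3"
  assumes [measurable]: "k \<in> borel_measurable M" "f \<in> borel_measurable M"
  shows "(\<lambda>x. k x *v f x) \<in> borel_measurable M"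
  by (rule borel_measurable_continuous_Pair[OF assms, where H = "(*v)"])
    (auto simp: matrix_vector_mult_def intro!: continuous_intros)

text \<open>For kernels whose value on the diagonal is uncontrolled. Since the point is a measurable
  null set, changing a function there preserves measurability, so integrability transfers in both
  directions, and with it the default value 0 of a divergent integral.\<close>

lemma integral_cong_off_point:
  fixes f g :: "'a \<Rightarrow> 'b::{banach, second_countable_topology}"
  assumes x: "{x} \<inter> space M \<in> null_sets M" and fg: "\<And>y. y \<noteq> x \<Longrightarrow> f y = g y"
  shows "integrable M f \<longleftrightarrow> integrable M g" "integral\<^sup>L M f = integral\<^sup>L M g"
proof -
  have meas: "v \<in> borel_measurable M" if u: "u \<in> borel_measurable M" and uv: "\<And>y. y \<noteq> x \<Longrightarrow> u y = v y"
    for u v :: "'a \<Rightarrow> 'b"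
  proof -
    have "{y \<in> space M. y = x} = {x} \<inter> space M" by auto
    then have "{y \<in> space M. y = x} \<in> sets M" using x by auto
    then have "(\<lambda>y. if y = x then v x else u y) \<in> borel_measurable M"
      using u by (intro measurable_If) auto
    moreover have "(\<lambda>y. if y = x then v x else u y) = v" using uv by auto
    ultimately show ?thesis by simp
  qed
  have AE: "AE y in M. f y = g y"
    by (rule AE_I'[OF x]) (use fg in auto)
  have m: "f \<in> borel_measurable M \<longleftrightarrow> g \<in> borel_measurable M"
    using meas[of f g, OF _ fg] meas[of g f, OF _ fg[symmetric]] by blast
  show int: "integrable M f \<longleftrightarrow> integrable M g"
  proof (cases "f \<in> borel_measurable M")
    case True
    then show ?thesis using m by (intro integrable_cong_AE AE) blast+
  next
    case False
    then show ?thesis using m borel_measurable_integrable by blast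
  qed
  show "integral\<^sup>L M f = integral\<^sup>L M g"
  proof (cases "integrable M f")
    case True
    then have "f \<in> borel_measurable M" "g \<in> borel_measurable M"
      using int borel_measurable_integrable by blast+
    then show ?thesis by (rule integral_cong_AE[OF _ _ AE])
  next
    case False
    then show ?thesis using int by (simp add: not_integrable_integral_eq)
  qed
qed

text \<open>Write q f as sqrt q times sqrt q f. Cauchy-Schwarz and the row bound give one factor A;
  exchanging the integrals and using the column bound gives the other.\<close>

lemma (in sigma_finite_measure) schur_test:
  assumes q[measurable]: "(\<lambda>p. q (fst p) (snd p)) \<in> borel_measurable (M \<Otimes>\<^sub>M M)"
    and f[measurable]: "f \<in> borel_measurable M"
    and nonneg: "\<And>x y. 0 \<le> q x y"
    and rows: "\<And>x. x \<in> space M \<Longrightarrow> (\<integral>\<^sup>+y. ennreal (q x y) \<partial>M) \<le> ennreal A"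
    and cols: "\<And>y. y \<in> space M \<Longrightarrow> (\<integral>\<^sup>+x. ennreal (q x y) \<partial>M) \<le> ennreal A"
  shows "(\<integral>\<^sup>+x. (\<integral>\<^sup>+y. ennreal (q x y) * f y \<partial>M)\<^sup>2 \<partial>M) \<le> (ennreal A)\<^sup>2 * (\<integral>\<^sup>+y. (f y)\<^sup>2 \<partial>M)"
proof -
  interpret pair_sigma_finite M M ..
  have [measurable]: "(\<lambda>(x, y). q x y) \<in> borel_measurable (M \<Otimes>\<^sub>M M)"
    using q by (simp add: split_beta')
  have "(\<integral>\<^sup>+x. (\<integral>\<^sup>+y. ennreal (q x y) * f y \<partial>M)\<^sup>2 \<partial>M)
      \<le> (\<integral>\<^sup>+x. ennreal A * (\<integral>\<^sup>+y. ennreal (q x y) * (f y)\<^sup>2 \<partial>M) \<partial>M)"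
  proof (rule nn_integral_mono)
    fix x assume x[measurable]: "x \<in> space M"
    have [measurable]: "(\<lambda>y. q x y) \<in> borel_measurable M" by measurable
    have s: "ennreal (sqrt (q x y)) * ennreal (sqrt (q x y)) = ennreal (q x y)" for y
      using nonneg by (simp flip: ennreal_mult)
    have "(\<integral>\<^sup>+y. ennreal (q x y) * f y \<partial>M)\<^sup>2 =
        (\<integral>\<^sup>+y. ennreal (sqrt (q x y)) * (ennreal (sqrt (q x y)) * f y) \<partial>M)\<^sup>2"
      by (simp add: s flip: mult.assoc)
    also have "\<dots> \<le> (\<integral>\<^sup>+y. (ennreal (sqrt (q x y)))\<^sup>2 \<partial>M) * (\<integral>\<^sup>+y. (ennreal (sqrt (q x y)) * f y)\<^sup>2 \<partial>M)"
      by (rule Cauchy_Schwarz_nn_integral) measurable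
    also have "\<dots> = (\<integral>\<^sup>+y. ennreal (q x y) \<partial>M) * (\<integral>\<^sup>+y. ennreal (q x y) * (f y)\<^sup>2 \<partial>M)"
      by (simp add: power_mult_distrib) (simp add: power2_eq_square s)
    also have "\<dots> \<le> ennreal A * (\<integral>\<^sup>+y. ennreal (q x y) * (f y)\<^sup>2 \<partial>M)"
      by (intro mult_right_mono rows x) simp
    finally show "(\<integral>\<^sup>+y. ennreal (q x y) * f y \<partial>M)\<^sup>2 \<le> ennreal A * (\<integral>\<^sup>+y. ennreal (q x y) * (f y)\<^sup>2 \<partial>M)" .
  qed
  also have "\<dots> = ennreal A * (\<integral>\<^sup>+x. (\<integral>\<^sup>+y. ennreal (q x y) * (f y)\<^sup>2 \<partial>M) \<partial>M)"
    by (rule nn_integral_cmult) measurable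
  also have "(\<integral>\<^sup>+x. (\<integral>\<^sup>+y. ennreal (q x y) * (f y)\<^sup>2 \<partial>M) \<partial>M) = (\<integral>\<^sup>+y. (\<integral>\<^sup>+x. ennreal (q x y) * (f y)\<^sup>2 \<partial>M) \<partial>M)"
    by (rule Fubini') measurable
  also have "\<dots> = (\<integral>\<^sup>+y. (\<integral>\<^sup>+x. ennreal (q x y) \<partial>M) * (f y)\<^sup>2 \<partial>M)"
    by (intro nn_integral_cong nn_integral_multc) measurable
  also have "\<dots> \<le> (\<integral>\<^sup>+y. ennreal A * (f y)\<^sup>2 \<partial>M)"
    by (intro nn_integral_mono mult_right_mono cols) auto
  also have "\<dots> = ennreal A * (\<integral>\<^sup>+y. (f y)\<^sup>2 \<partial>M)"
    by (rule nn_integral_cmult) measurable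
  finally show ?thesis
    by (simp add: power2_eq_square mult.assoc mult_left_mono)
qed

text \<open>All that the operator theory takes from the surface; in particular no lower bound on the
  measure of balls enters.\<close>

locale upper_regular_measure =
  fixes M :: "(real^3) measure" and S :: "(real^3) set" and c :: real
  assumes sets_M: "sets M = sets (restrict_space borel S)"
    and compact_S: "compact S"
    and finite_M: "finite_measure M"
    and c_pos: "0 < c"
    and growth: "\<And>x r. x \<in> S \<Longrightarrow> 0 < r \<Longrightarrow> emeasure M (S \<inter> ball x r) \<le> ennreal (c * r\<^sup>2)"
begin

sublocale finite_measure M by (rule finite_M)

lemma space_M: "space M = S"
  using sets_eq_imp_space_eq[OF sets_M] by (simp add: space_restrict_space)

lemma S_Int_sets: "A \<in> sets borel \<Longrightarrow> S \<inter> A \<in> sets M"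
  unfolding sets_M sets_restrict_space by blast

lemma measurable_M_borel: "g \<in> borel_measurable borel \<Longrightarrow> g \<in> borel_measurable M"
  unfolding measurable_cong_sets[OF sets_M refl] by (rule measurable_restrict_space1)

lemma singleton_null: "{x} \<inter> space M \<in> null_sets M"
proof (cases "x \<in> S")
  case True
  have set: "{x} \<inter> space M \<in> sets M" using S_Int_sets[of "{x}"] by (simp add: space_M Int_commute)
  have "emeasure M ({x} \<inter> space M) \<le> ennreal (c * (1 / real (Suc n))\<^sup>2)" for n
  proof -
    have "emeasure M ({x} \<inter> space M) \<le> emeasure M (S \<inter> ball x (1 / real (Suc n)))"
      by (rule emeasure_mono) (auto simp: space_M intro!: S_Int_sets)
    also have "\<dots> \<le> ennreal (c * (1 / real (Suc n))\<^sup>2)" using True by (intro growth) auto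
    finally show ?thesis .
  qed
  moreover have "(\<lambda>n. ennreal (c * (1 / real (Suc n))\<^sup>2)) \<longlonglongrightarrow> ennreal (c * 0\<^sup>2)"
    by (intro tendsto_intros LIMSEQ_Suc[OF lim_1_over_n])
  ultimately have "emeasure M ({x} \<inter> space M) \<le> ennreal (c * 0\<^sup>2)"
    by (intro LIMSEQ_le_const) auto
  then show ?thesis using set by (simp add: null_sets_def)
qed (simp add: space_M)

text \<open>On the ball, 1 / |x - y| is dominated by the sum over n of 2^(n+1) / r on the dyadic
  balls of radius r / 2^n. Each contributes at most (2^(n+1) / r) c r^2 / 4^n = 2 c r / 2^n, which
  sums to 4 c r. That this vanishes with r makes truncation near the diagonal a small
  perturbation.\<close>

lemma riesz_bound:
  assumes x: "x \<in> S" and r: "0 < r"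
  shows "(\<integral>\<^sup>+y. ennreal (indicator (ball x r) y / norm (x - y)) \<partial>M) \<le> ennreal (4 * c * r)"
proof -
  define B where "B n = ball x (r / 2 ^ n)" for n
  have B[measurable]: "S \<inter> B n \<in> sets M" for n unfolding B_def by (intro S_Int_sets) simp
  have dom: "ennreal (indicator (ball x r) y / norm (x - y)) \<le> (\<Sum>n. ennreal (2 ^ Suc n / r) * indicator (S \<inter> B n) y)"
    if y: "y \<in> space M" for y
  proof (cases "y = x \<or> y \<notin> ball x r")
    \<comment> \<open>At y = x the left-hand side is 0 because x / 0 = 0, and outside the ball
      because of the indicator.\<close>
    case True then show ?thesis by auto
  next
    case False
    define t where "t = norm (x - y)"
    have t: "0 < t" "t < r" using False by (auto simp: t_def dist_norm)
    obtain m where m: "r / 2 ^ m \<le> t"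
    proof -
      obtain m where "r / t < 2 ^ m" using real_arch_pow[of 2 "r / t"] by auto
      then have "r / 2 ^ m \<le> t" using t by (simp add: field_simps)
      then show ?thesis by (rule that)
    qed
    \<comment> \<open>By minimality y still lies in the dyadic ball with the preceding index, which
      exists because t < r rules out m0 = 0.\<close>
    define m0 where "m0 = (LEAST m. r / 2 ^ m \<le> t)"
    have m0: "r / 2 ^ m0 \<le> t" unfolding m0_def using m by (rule LeastI)
    have "m0 \<noteq> 0" using m0 t by (auto intro: ccontr)
    then obtain n where n: "m0 = Suc n" using not0_implies_Suc by blast
    have "\<not> r / 2 ^ n \<le> t" using not_less_Least[of n "\<lambda>m. r / 2 ^ m \<le> t"] n by (simp add: m0_def[symmetric])
    then have yB: "y \<in> S \<inter> B n" using y by (simp add: B_def space_M t_def dist_norm)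
    have "1 / t \<le> 2 ^ Suc n / r" using m0 n t r by (simp add: field_simps)
    then have "ennreal (indicator (ball x r) y / norm (x - y)) \<le> ennreal (2 ^ Suc n / r) * indicator (S \<inter> B n) y"
      using False yB by (auto simp: t_def intro!: ennreal_leI)
    also have "\<dots> = (\<Sum>k\<in>{n}. ennreal (2 ^ Suc k / r) * indicator (S \<inter> B k) y)"
      by (simp only: sum.insert sum.empty finite.emptyI empty_iff not_False_eq_True add_0_right)
    also have "\<dots> \<le> (\<Sum>n. ennreal (2 ^ Suc n / r) * indicator (S \<inter> B n) y)"
      by (rule sum_le_suminf) auto
    finally show ?thesis .
  qed
  have "(\<integral>\<^sup>+y. ennreal (indicator (ball x r) y / norm (x - y)) \<partial>M)
      \<le> (\<integral>\<^sup>+y. (\<Sum>n. ennreal (2 ^ Suc n / r) * indicator (S \<inter> B n) y) \<partial>M)"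
    by (rule nn_integral_mono) (rule dom)
  also have "\<dots> = (\<Sum>n. \<integral>\<^sup>+y. ennreal (2 ^ Suc n / r) * indicator (S \<inter> B n) y \<partial>M)"
    by (rule nn_integral_suminf) measurable
  also have "\<dots> = (\<Sum>n. ennreal (2 ^ Suc n / r) * emeasure M (S \<inter> B n))"
    by (simp add: nn_integral_cmult_indicator)
  also have "\<dots> \<le> (\<Sum>n. ennreal (2 * c * r * (1 / 2) ^ n))"
  proof (rule suminf_le)
    fix n
    have "ennreal (2 ^ Suc n / r) * emeasure M (S \<inter> B n) \<le> ennreal (2 ^ Suc n / r) * ennreal (c * (r / 2 ^ n)\<^sup>2)"
      unfolding B_def using x r by (intro mult_left_mono growth) auto
    also have "\<dots> = ennreal (2 ^ Suc n / r * (c * (r / 2 ^ n)\<^sup>2))"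
      using r c_pos by (intro ennreal_mult[symmetric]) auto
    also have "2 ^ Suc n / r * (c * (r / 2 ^ n)\<^sup>2) = 2 * c * r * (1 / 2) ^ n"
      using r by (simp add: field_simps power2_eq_square)
    finally show "ennreal (2 ^ Suc n / r) * emeasure M (S \<inter> B n) \<le> ennreal (2 * c * r * (1 / 2) ^ n)" .
  qed auto
  also have "\<dots> = ennreal (\<Sum>n. 2 * c * r * (1 / 2) ^ n)"
    using r c_pos by (intro suminf_ennreal2 summable_mult summable_geometric) auto
  also have "(\<Sum>n. 2 * c * r * (1 / 2) ^ n) = 4 * c * r"
    using suminf_mult[OF summable_geometric, of "1 / 2 :: real" "2 * c * r"] suminf_geometric[of "1 / 2 :: real"] by simp
  finally show ?thesis .
qed

lemma riesz_bound_total: "\<exists>A. \<forall>x\<in>S. (\<integral>\<^sup>+y. ennreal (1 / norm (x - y)) \<partial>M) \<le> ennreal A"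
proof -
  obtain R where R: "\<And>x. x \<in> S \<Longrightarrow> norm x < R"
    using compact_imp_bounded[OF compact_S] bounded_pos_less[of S] by auto
  have "(\<integral>\<^sup>+y. ennreal (1 / norm (x - y)) \<partial>M) \<le> ennreal (4 * c * (2 * (\<bar>R\<bar> + 1)))" if x: "x \<in> S" for x
  proof -
    have "(\<integral>\<^sup>+y. ennreal (1 / norm (x - y)) \<partial>M) = (\<integral>\<^sup>+y. ennreal (indicator (ball x (2 * (\<bar>R\<bar> + 1))) y / norm (x - y)) \<partial>M)"
    proof (rule nn_integral_cong)
      fix y assume "y \<in> space M"
      then have "norm (x - y) < 2 * (\<bar>R\<bar> + 1)"
        using R[OF x] R[of y] norm_triangle_ineq4[of x y] by (simp add: space_M)
      then show "ennreal (1 / norm (x - y)) = ennreal (indicator (ball x (2 * (\<bar>R\<bar> + 1))) y / norm (x - y))"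
        by (simp add: dist_norm)
    qed
    also have "\<dots> \<le> ennreal (4 * c * (2 * (\<bar>R\<bar> + 1)))" by (rule riesz_bound[OF x]) simp
    finally show ?thesis .
  qed
  then show ?thesis by blast
qed

end

text \<open>The exponent 1 is below the growth exponent 2 of the measure, which makes rows and
  columns integrable. The diagonal is left free because the kernels take meaningless values
  there.\<close>

definition weakly_singular :: "(real^3) set \<Rightarrow> (real^3 \<Rightarrow> real^3 \<Rightarrow> real^3^3) \<Rightarrow> bool" where
  "weakly_singular S k \<longleftrightarrow>
     continuous_on {p. fst p \<in> S \<and> snd p \<in> S \<and> fst p \<noteq> snd p} (\<lambda>p. k (fst p) (snd p)) \<and>
     (\<exists>C. \<forall>x\<in>S. \<forall>y\<in>S. x \<noteq> y \<longrightarrow> norm (k x y) \<le> C / norm (x - y))"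

context upper_regular_measure
begin

lemma off_diagonal_measurable:
  fixes k :: "real^3 \<Rightarrow> real^3 \<Rightarrow> real^3^3"
  assumes cont: "continuous_on {p. fst p \<in> S \<and> snd p \<in> S \<and> fst p \<noteq> snd p} (\<lambda>p. k (fst p) (snd p))"
    and diag: "\<And>x. k x x = 0"
  shows "(\<lambda>p. k (fst p) (snd p)) \<in> borel_measurable (M \<Otimes>\<^sub>M M)"
proof -
  define D where "D = {p. fst p \<in> S \<and> snd p \<in> S \<and> fst p \<noteq> (snd p :: real^3)}"
  have "D = (S \<times> S) \<inter> (\<lambda>p. fst p - snd p) -` (- {0})" by (auto simp: D_def)
  moreover have "closed (S \<times> S)" using compact_S by (intro closed_Times compact_imp_closed)
  moreover have "open ((\<lambda>p. fst p - snd p :: real^3) -` (- {0}))"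
    by (intro open_vimage continuous_intros)
  ultimately have D: "D \<in> sets borel" by (auto intro!: sets.Int borel_closed borel_open)
  define K where "K = (\<lambda>p. indicator D p *\<^sub>R k (fst p) (snd p))"
  have K: "K \<in> borel_measurable borel"
    unfolding K_def by (rule borel_measurable_continuous_on_indicator[OF D]) (use cont in \<open>simp add: D_def\<close>)
  have id: "(\<lambda>x. x) \<in> borel_measurable M" by (rule measurable_M_borel) simp
  have "(\<lambda>p. (fst p, snd p)) \<in> (M \<Otimes>\<^sub>M M) \<rightarrow>\<^sub>M (borel \<Otimes>\<^sub>M borel)"
    using id by (intro measurable_Pair measurable_compose[OF measurable_fst id] measurable_compose[OF measurable_snd id])
  then have "(\<lambda>p. K (fst p, snd p)) \<in> borel_measurable (M \<Otimes>\<^sub>M M)"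
    by (rule measurable_compose) (use K in \<open>simp add: borel_prod\<close>)
  moreover have "K (fst p, snd p) = k (fst p) (snd p)" if "p \<in> space (M \<Otimes>\<^sub>M M)" for p
    using that diag by (cases "fst p = snd p") (auto simp: K_def D_def space_pair_measure space_M)
  ultimately show ?thesis
    by (subst measurable_cong[of _ _ "\<lambda>p. K (fst p, snd p)"]) auto
qed

lemma kernel_schur:
  fixes k :: "real^3 \<Rightarrow> real^3 \<Rightarrow> real^3^3"
  assumes meas: "(\<lambda>p. k (fst p) (snd p)) \<in> borel_measurable (M \<Otimes>\<^sub>M M)"
    and A: "0 \<le> A"
    and rows: "\<forall>x\<in>S. (\<integral>\<^sup>+y. ennreal (norm (k x y)) \<partial>M) \<le> ennreal A"
    and cols: "\<forall>y\<in>S. (\<integral>\<^sup>+x. ennreal (norm (k x y)) \<partial>M) \<le> ennreal A"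
  shows "\<rho> \<in> L2 M \<Longrightarrow> AE x in M. integrable M (\<lambda>y. k x y *v \<rho> y)"
    and "\<rho> \<in> L2 M \<Longrightarrow> L2_norm M (kernel_op M k \<rho>) \<le> A * L2_norm M \<rho>"
    and "L2_linear M (kernel_op M k)"
proof -
  have [measurable]: "(\<lambda>(x, y). k x y) \<in> borel_measurable (M \<Otimes>\<^sub>M M)"
    using meas by (simp add: split_beta')
  have fin: "AE x in M. integrable M (\<lambda>y. k x y *v \<rho> y)"
    and L2: "kernel_op M k \<rho> \<in> L2 M"
    and norm: "L2_norm M (kernel_op M k \<rho>) \<le> A * L2_norm M \<rho>"
    if \<rho>: "\<rho> \<in> L2 M" for \<rho>
  proof -
    have [measurable]: "\<rho> \<in> borel_measurable M" by (rule L2_measurable[OF \<rho>])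
    define I where "I x = (\<integral>\<^sup>+y. ennreal (norm (k x y)) * ennreal (norm (\<rho> y)) \<partial>M)" for x
    have "(\<integral>\<^sup>+x. (I x)\<^sup>2 \<partial>M) \<le> (ennreal A)\<^sup>2 * (\<integral>\<^sup>+y. (ennreal (norm (\<rho> y)))\<^sup>2 \<partial>M)"
      unfolding I_def
      by (rule schur_test) (use meas rows cols in \<open>auto simp: space_M\<close>)
    also have "\<dots> = ennreal ((A * L2_norm M \<rho>)\<^sup>2)"
      using A L2_nn_integral[OF \<rho>] by (simp add: ennreal_power power_mult_distrib ennreal_mult)
    finally have I2: "(\<integral>\<^sup>+x. (I x)\<^sup>2 \<partial>M) \<le> ennreal ((A * L2_norm M \<rho>)\<^sup>2)" .
    have [measurable]: "I \<in> borel_measurable M" unfolding I_def by measurable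
    have "(\<integral>\<^sup>+x. (I x)\<^sup>2 \<partial>M) \<noteq> \<infinity>" using I2 by (auto simp: top_unique)
    then have "AE x in M. (I x)\<^sup>2 \<noteq> \<infinity>" by (intro nn_integral_noteq_infinite) auto
    then have finI: "AE x in M. I x < \<infinity>"
      by eventually_elim (auto simp: less_top[symmetric] power2_eq_square)
    have bound: "(\<integral>\<^sup>+y. ennreal (norm (k x y *v \<rho> y)) \<partial>M) \<le> I x" for x
      unfolding I_def
      by (intro nn_integral_mono) (simp add: norm_matrix_vector_mult_le flip: ennreal_mult)
    have sect: "(\<lambda>y. k x y *v \<rho> y) \<in> borel_measurable M" if "x \<in> space M" for x
    proof -
      have "(\<lambda>y. k x y) \<in> borel_measurable M" using that by measurable
      then show ?thesis by measurable
    qed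
    have "AE x in M. x \<in> space M" by (rule AE_space)
    with finI show "AE x in M. integrable M (\<lambda>y. k x y *v \<rho> y)"
    proof eventually_elim
      case (elim x)
      then show ?case using sect[of x] le_less_trans[OF bound[of x]] by (simp add: integrable_iff_bounded)
    qed
    have [measurable]: "kernel_op M k \<rho> \<in> borel_measurable M"
      unfolding kernel_op_def[abs_def] by measurable
    \<comment> \<open>Where the integral diverges the operator takes the default value 0, so the
      bound holds at every point.\<close>
    have ptw: "ennreal (norm (kernel_op M k \<rho> x)) \<le> I x" for x
    proof (cases "integrable M (\<lambda>y. k x y *v \<rho> y)")
      case True
      then show ?thesis
        unfolding kernel_op_def by (rule order_trans[OF integral_norm_bound_ennreal bound])
    next
      case False
      then show ?thesis by (simp add: kernel_op_def not_integrable_integral_eq)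
    qed
    have "(\<integral>\<^sup>+x. ennreal ((norm (kernel_op M k \<rho> x))\<^sup>2) \<partial>M) \<le> (\<integral>\<^sup>+x. (I x)\<^sup>2 \<partial>M)"
      using ptw by (intro nn_integral_mono) (simp add: ennreal_power[symmetric] power_mono)
    also note I2
    finally have le: "(\<integral>\<^sup>+x. ennreal ((norm (kernel_op M k \<rho> x))\<^sup>2) \<partial>M) \<le> ennreal ((A * L2_norm M \<rho>)\<^sup>2)" .
    show "kernel_op M k \<rho> \<in> L2 M" by (rule L2I_nn_integral(1)[OF _ le]) measurable
    show "L2_norm M (kernel_op M k \<rho>) \<le> A * L2_norm M \<rho>"
      by (rule L2I_nn_integral(2)[OF _ le]) (auto simp: A L2_norm_nonneg)
  qed
  show "\<rho> \<in> L2 M \<Longrightarrow> AE x in M. integrable M (\<lambda>y. k x y *v \<rho> y)"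
    and "\<rho> \<in> L2 M \<Longrightarrow> L2_norm M (kernel_op M k \<rho>) \<le> A * L2_norm M \<rho>"
    by (rule fin norm, assumption)+
  show "L2_linear M (kernel_op M k)"
    unfolding L2_linear_def
  proof (intro conjI ballI allI L2)
    fix f g assume f: "f \<in> L2 M" and g: "g \<in> L2 M"
    show "AE x in M. kernel_op M k (\<lambda>z. f z + g z) x = kernel_op M k f x + kernel_op M k g x"
      using fin[OF f] fin[OF g]
      by eventually_elim (simp add: kernel_op_def matrix_vector_right_distrib)
  next
    fix f and a :: real assume "f \<in> L2 M"
    show "AE x in M. kernel_op M k (\<lambda>z. a *\<^sub>R f z) x = a *\<^sub>R kernel_op M k f x"
      by (simp add: kernel_op_def matrix_vector_mult_scaleR)
  qed
qed

lemma L2_const: "(\<lambda>x. a) \<in> L2 M" "L2_norm M (\<lambda>x. a) = norm a * sqrt (measure M (space M))"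
  by (auto simp: L2_def L2_norm_def real_sqrt_mult mult.commute)

lemma L1_L2_bound:
  assumes f: "f \<in> L2 M"
  shows "integrable M (\<lambda>y. norm (f y))" "(\<integral>y. norm (f y) \<partial>M) \<le> L2_norm M f * sqrt (measure M (space M))"
proof -
  have n: "norm (axis 1 1 :: real^3) = 1" by simp
  show "integrable M (\<lambda>y. norm (f y))"
    using L2_inner_bound(1)[OF f L2_const(1)[of "axis 1 1"]] n by simp
  show "(\<integral>y. norm (f y) \<partial>M) \<le> L2_norm M f * sqrt (measure M (space M))"
    using L2_inner_bound(2)[OF f L2_const(1)[of "axis 1 1"]] n by (simp add: L2_const(2))
qed

lemma L2_norm_sup_bound:
  assumes [measurable]: "f \<in> borel_measurable M" and le: "\<And>x. x \<in> S \<Longrightarrow> norm (f x) \<le> e" and e: "0 \<le> e"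
  shows "f \<in> L2 M" "L2_norm M f \<le> e * sqrt (measure M (space M))"
proof -
  have "(\<integral>\<^sup>+x. ennreal ((norm (f x))\<^sup>2) \<partial>M) \<le> (\<integral>\<^sup>+x. ennreal (e\<^sup>2) \<partial>M)"
    by (intro nn_integral_mono ennreal_leI power_mono le) (auto simp: space_M)
  also have "\<dots> = ennreal ((e * sqrt (measure M (space M)))\<^sup>2)"
    by (simp add: emeasure_eq_measure power_mult_distrib ennreal_mult)
  finally have *: "(\<integral>\<^sup>+x. ennreal ((norm (f x))\<^sup>2) \<partial>M) \<le> ennreal ((e * sqrt (measure M (space M)))\<^sup>2)" .
  show "f \<in> L2 M" by (rule L2I_nn_integral(1)[OF _ *]) measurable
  show "L2_norm M f \<le> e * sqrt (measure M (space M))"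
    by (rule L2I_nn_integral(2)[OF _ *]) (auto simp: e)
qed

lemma continuous_on_S_measurable:
  fixes g :: "real^3 \<Rightarrow> real^3"
  shows "continuous_on S g \<Longrightarrow> g \<in> borel_measurable M"
  unfolding measurable_cong_sets[OF sets_M refl] by (rule borel_measurable_continuous_on_restrict)

text \<open>On a finite measure an L^2 bound is an L^1 bound, so boundedness and uniform continuity
  of \<open>k\<close> make the images uniformly bounded and equicontinuous. The uniform convergence
  from Arzela-Ascoli is again stronger than convergence in L^2.\<close>

lemma continuous_kernel_compact:
  fixes k :: "real^3 \<Rightarrow> real^3 \<Rightarrow> real^3^3"
  assumes cont: "continuous_on (S \<times> S) (\<lambda>p. k (fst p) (snd p))"
    and lin: "L2_linear M (kernel_op M k)"
  shows "L2_compact M (kernel_op M k)"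
  unfolding L2_compact_def
proof (intro conjI allI impI)
  show "L2_linear M (kernel_op M k)" by (rule lin)
  fix f :: "nat \<Rightarrow> real^3 \<Rightarrow> real^3" and C assume "\<forall>n. f n \<in> L2 M \<and> L2_norm M (f n) \<le> C"
  then have f: "\<And>n. f n \<in> L2 M" and C: "\<And>n. L2_norm M (f n) \<le> C" by auto
  define m where "m = sqrt (measure M (space M))"
  have m: "0 \<le> m" by (simp add: m_def)
  have C0: "0 \<le> C" using C[of 0] L2_norm_nonneg[of M "f 0"] by linarith
  have SS: "compact (S \<times> S)" using compact_S by (intro compact_Times)
  have "bounded ((\<lambda>p. k (fst p) (snd p)) ` (S \<times> S))"
    by (intro compact_imp_bounded compact_continuous_image cont SS)
  then obtain B where B0: "0 < B" and B: "\<And>x y. x \<in> S \<Longrightarrow> y \<in> S \<Longrightarrow> norm (k x y) \<le> B"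
    unfolding bounded_pos by (auto simp: image_iff)
  have fm[measurable]: "f n \<in> borel_measurable M" for n using f L2_measurable by blast
  have kx[measurable]: "(\<lambda>y. k x y) \<in> borel_measurable M" if "x \<in> S" for x
  proof -
    have "continuous_on S (\<lambda>y. k x y)"
      using that by (intro continuous_on_compose2[OF cont, of S "\<lambda>y. (x, y)", simplified] continuous_intros) auto
    then show ?thesis
      unfolding measurable_cong_sets[OF sets_M refl] by (rule borel_measurable_continuous_on_restrict)
  qed
  note nf = L1_L2_bound[OF f]
  have nfC: "(\<integral>y. norm (f n y) \<partial>M) \<le> C * m" for n
    using nf(2)[of n] mult_right_mono[OF C m, of n] by (simp add: m_def)
  have int: "integrable M (\<lambda>y. k x y *v f n y)" if x: "x \<in> S" for x n
  proof (rule Bochner_Integration.integrable_bound[of M "\<lambda>y. B * norm (f n y)"])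
    show "integrable M (\<lambda>y. B * norm (f n y))" using nf(1)[of n] by simp
    show "(\<lambda>y. k x y *v f n y) \<in> borel_measurable M" using kx[OF x] by measurable
    show "AE y in M. norm (k x y *v f n y) \<le> norm (B * norm (f n y))"
      by (rule AE_I2) (use B[OF x] B0 in \<open>auto simp: space_M intro!: order_trans[OF norm_matrix_vector_mult_le] mult_right_mono\<close>)
  qed
  have bound: "norm (kernel_op M k (f n) x) \<le> B * (C * m)" if x: "x \<in> S" for n x
  proof -
    have "norm (kernel_op M k (f n) x) \<le> (\<integral>y. B * norm (f n y) \<partial>M)"
      unfolding kernel_op_def
      by (rule Bochner_Integration.integral_norm_bound_integral[OF int[OF x]])
        (use nf(1)[of n] B[OF x] in \<open>auto simp: space_M intro!: order_trans[OF norm_matrix_vector_mult_le] mult_right_mono\<close>)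
    also have "\<dots> \<le> B * (C * m)" using nfC[of n] B0 by simp
    finally show ?thesis .
  qed
  have equi: "\<exists>d. 0 < d \<and> (\<forall>n y. y \<in> S \<and> norm (x - y) < d \<longrightarrow> norm (kernel_op M k (f n) x - kernel_op M k (f n) y) < e)"
    if x: "x \<in> S" and e: "0 < e" for x e
  proof -
    define \<eta> where "\<eta> = e / (C * m + 1)"
    have Cm: "0 \<le> C * m" using C0 m by simp
    have \<eta>: "0 < \<eta>" using e Cm by (simp add: \<eta>_def)
    have "uniformly_continuous_on (S \<times> S) (\<lambda>p. k (fst p) (snd p))"
      by (rule compact_uniformly_continuous[OF cont SS])
    then obtain d where d: "0 < d" and
      dk: "\<And>p q. p \<in> S \<times> S \<Longrightarrow> q \<in> S \<times> S \<Longrightarrow> dist q p < d \<Longrightarrow> dist (k (fst q) (snd q)) (k (fst p) (snd p)) < \<eta>"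
      unfolding uniformly_continuous_on_def using \<eta> by meson
    have "norm (kernel_op M k (f n) x - kernel_op M k (f n) y) < e" if y: "y \<in> S" "norm (x - y) < d" for n y
    proof -
      have kk: "norm (k x z - k y z) \<le> \<eta>" if "z \<in> S" for z
        using dk[of "(y, z)" "(x, z)"] x y that by (simp add: dist_Pair_Pair dist_norm less_imp_le)
      have "kernel_op M k (f n) x - kernel_op M k (f n) y = (\<integral>z. (k x z - k y z) *v f n z \<partial>M)"
        unfolding kernel_op_def
        by (simp add: matrix_vector_mult_diff_rdistrib Bochner_Integration.integral_diff[OF int[OF x] int[OF y(1)]])
      also have "norm \<dots> \<le> (\<integral>z. \<eta> * norm (f n z) \<partial>M)"
      proof (rule Bochner_Integration.integral_norm_bound_integral)
        show "integrable M (\<lambda>z. (k x z - k y z) *v f n z)"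
          using Bochner_Integration.integrable_diff[OF int[OF x] int[OF y(1)], of n n]
          by (simp add: matrix_vector_mult_diff_rdistrib)
        show "integrable M (\<lambda>z. \<eta> * norm (f n z))" using nf(1)[of n] by simp
        show "norm ((k x z - k y z) *v f n z) \<le> \<eta> * norm (f n z)" if "z \<in> space M" for z
          using kk[of z] that by (auto simp: space_M intro!: order_trans[OF norm_matrix_vector_mult_le] mult_right_mono)
      qed
      also have "\<dots> \<le> \<eta> * (C * m)" using nfC[of n] \<eta> by simp
      also have "\<dots> < e" using e Cm by (simp add: \<eta>_def field_simps)
      finally show ?thesis .
    qed
    then show ?thesis using d by blast
  qed
  obtain g s where g: "continuous_on S g" and s: "strict_mono (s :: nat \<Rightarrow> nat)"
    and unif: "\<And>e. 0 < e \<Longrightarrow> \<exists>N. \<forall>n x. n \<ge> N \<and> x \<in> S \<longrightarrow> norm (kernel_op M k (f (s n)) x - g x) < e"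
    using Arzela_Ascoli[of S "\<lambda>n. kernel_op M k (f n)" "B * (C * m)", OF compact_S bound equi] by blast
  have gm: "g \<in> borel_measurable M" by (rule continuous_on_S_measurable[OF g])
  have KL: "kernel_op M k (f n) \<in> L2 M" for n by (rule L2_linear_L2[OF lin f])
  have "bounded (g ` S)" by (intro compact_imp_bounded compact_continuous_image g compact_S)
  then obtain b where "0 < b" "\<And>x. x \<in> S \<Longrightarrow> norm (g x) \<le> b"
    unfolding bounded_pos by auto
  then have gL: "g \<in> L2 M" using L2_norm_sup_bound(1)[OF gm] less_imp_le by blast
  have "(\<lambda>n. L2_norm M (\<lambda>x. kernel_op M k (f (s n)) x - g x)) \<longlonglongrightarrow> 0"
  proof (rule LIMSEQ_I)
    fix r :: real assume r: "0 < r"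
    define e where "e = r / (m + 1)"
    have e: "0 < e" using r m by (simp add: e_def)
    obtain N where N: "\<And>n x. n \<ge> N \<Longrightarrow> x \<in> S \<Longrightarrow> norm (kernel_op M k (f (s n)) x - g x) < e"
      using unif[OF e] by blast
    have "norm (L2_norm M (\<lambda>x. kernel_op M k (f (s n)) x - g x) - 0) < r" if n: "n \<ge> N" for n
    proof -
      have "L2_norm M (\<lambda>x. kernel_op M k (f (s n)) x - g x) \<le> e * m"
        unfolding m_def
        by (rule L2_norm_sup_bound(2)) (use N[OF n] e L2_measurable[OF L2_diff(1)[OF KL gL]] less_imp_le in auto)
      also have "\<dots> < r" using r m by (simp add: e_def field_simps)
      finally show ?thesis by (simp add: L2_norm_nonneg)
    qed
    then show "\<exists>no. \<forall>n\<ge>no. norm (L2_norm M (\<lambda>x. kernel_op M k (f (s n)) x - g x) - 0) < r" by blast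
  qed
  then show "\<exists>s g. strict_mono s \<and> g \<in> L2 M \<and> (\<lambda>n. L2_norm M (\<lambda>x. kernel_op M k (f (s n)) x - g x)) \<longlonglongrightarrow> 0"
    using s gL by blast
qed

text \<open>A cutoff splits the kernel into a part \<open>kc\<close>, continuous on all of S x S,
  and a part \<open>kd\<close> supported in |x - y| < r. By Schur's test and
  \<open>riesz_bound\<close> the norm of the second operator is at most any prescribed
  \<open>e\<close>, once r is small.\<close>

theorem weakly_singular_compact:
  assumes "weakly_singular S k"
  shows "L2_compact_kernel M k"
proof -
  let ?D = "{p. fst p \<in> S \<and> snd p \<in> S \<and> fst p \<noteq> (snd p :: real^3)}"
  obtain C0 where cont: "continuous_on ?D (\<lambda>p. k (fst p) (snd p))"
    and C0: "\<And>x y. x \<in> S \<Longrightarrow> y \<in> S \<Longrightarrow> x \<noteq> y \<Longrightarrow> norm (k x y) \<le> C0 / norm (x - y)"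
    using assms unfolding weakly_singular_def by blast
  define C where "C = \<bar>C0\<bar> + 1"
  have C: "0 < C" by (simp add: C_def)
  \<comment> \<open>The value 0 on the diagonal makes the kernel jointly measurable and agrees with
    1 / 0 = 0 in the bound; no integral changes, since points are null.\<close>
  define k0 where "k0 x y = (if x = y then 0 else k x y)" for x y
  have k0_bound: "norm (k0 x y) \<le> C * (1 / norm (x - y))" if "x \<in> S" "y \<in> S" for x y
  proof (cases "x = y")
    case False
    have "norm (k0 x y) \<le> C0 / norm (x - y)" using C0[OF that False] False by (simp add: k0_def)
    also have "\<dots> \<le> C / norm (x - y)" by (intro divide_right_mono) (auto simp: C_def)
    finally show ?thesis by simp
  qed (simp add: k0_def)
  have k0_cont: "continuous_on ?D (\<lambda>p. k0 (fst p) (snd p))"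
    by (rule continuous_on_eq[OF cont]) (simp add: k0_def)
  have k0_meas: "(\<lambda>p. k0 (fst p) (snd p)) \<in> borel_measurable (M \<Otimes>\<^sub>M M)"
    by (rule off_diagonal_measurable[OF k0_cont]) (simp add: k0_def)
  have same: "integrable M (\<lambda>y. k x y *v \<rho> y) \<longleftrightarrow> integrable M (\<lambda>y. k0 x y *v \<rho> y)"
    "kernel_op M k \<rho> x = kernel_op M k0 \<rho> x" for \<rho> x
    unfolding kernel_op_def
    by (rule integral_cong_off_point[OF singleton_null, of x]; simp add: k0_def)+
  have op: "kernel_op M k = kernel_op M k0" using same(2) by (intro ext)
  obtain A0 where A0: "\<And>x. x \<in> S \<Longrightarrow> (\<integral>\<^sup>+y. ennreal (1 / norm (x - y)) \<partial>M) \<le> ennreal A0"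
    using riesz_bound_total by blast
  define A where "A = C * \<bar>A0\<bar>"
  have A: "0 \<le> A" using C by (simp add: A_def)
  have mn: "(\<lambda>y. ennreal (1 / norm (x - y))) \<in> borel_measurable M" for x :: "real^3"
    by (rule measurable_compose[OF measurable_M_borel]) measurable
  have rows: "(\<integral>\<^sup>+y. ennreal (norm (q y)) \<partial>M) \<le> ennreal A"
    if "x \<in> S" "\<And>y. y \<in> S \<Longrightarrow> norm (q y) \<le> C * (1 / norm (x - y))" for x and q :: "real^3 \<Rightarrow> real^3^3"
  proof -
    have "(\<integral>\<^sup>+y. ennreal (norm (q y)) \<partial>M) \<le> (\<integral>\<^sup>+y. ennreal C * ennreal (1 / norm (x - y)) \<partial>M)"
      using that(2) C by (intro nn_integral_mono) (simp add: space_M ennreal_leI flip: ennreal_mult)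
    also have "\<dots> = ennreal C * (\<integral>\<^sup>+y. ennreal (1 / norm (x - y)) \<partial>M)"
      by (rule nn_integral_cmult[OF mn])
    also have "\<dots> \<le> ennreal C * ennreal \<bar>A0\<bar>"
      using A0[OF that(1)] by (intro mult_left_mono) (auto intro: order_trans ennreal_leI)
    finally show ?thesis using C by (simp add: A_def ennreal_mult)
  qed
  note sch = kernel_schur[OF k0_meas A]
  have k0_rows: "\<forall>x\<in>S. (\<integral>\<^sup>+y. ennreal (norm (k0 x y)) \<partial>M) \<le> ennreal A"
    by (rule ballI, rule rows, assumption, (rule k0_bound; assumption))
  have k0_cols: "\<forall>y\<in>S. (\<integral>\<^sup>+x. ennreal (norm (k0 x y)) \<partial>M) \<le> ennreal A"
    by (rule ballI, rule rows, assumption, subst norm_minus_commute, (rule k0_bound; assumption))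
  note s0 = sch[OF k0_rows k0_cols]
  have L2k: "L2_kernel M k"
    unfolding L2_kernel_def op same(1) L2_bounded_def using s0 by blast
  have "L2_compact M (kernel_op M k0)"
  proof (rule L2_compact_limit[OF s0(3)])
    fix e :: real assume e: "0 < e"
    \<comment> \<open>Makes C times the bound 4 c r of \<open>riesz_bound\<close> equal to
      \<open>e\<close>.\<close>
    define r where "r = e / (4 * c * C)"
    have r: "0 < r" using e C c_pos by (simp add: r_def)
    define \<eta> where "\<eta> x y = min 1 (max 0 (2 * norm (x - y) / r - 1))" for x y :: "real^3"
    define kc where "kc x y = \<eta> x y *\<^sub>R k0 x y" for x y
    define kd where "kd x y = (1 - \<eta> x y) *\<^sub>R k0 x y" for x y
    have \<eta>: "0 \<le> \<eta> x y" "\<eta> x y \<le> 1" for x y by (auto simp: \<eta>_def)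
    have \<eta>_cont: "continuous_on X (\<lambda>p. \<eta> (fst p) (snd p))" for X
      unfolding \<eta>_def using r by (intro continuous_intros) auto
    \<comment> \<open>The cutoff \<eta> vanishes for |x - y| <= r / 2, so \<open>kc\<close> is zero
      on one closed piece and continuous on the closed rest, and the two are glued.\<close>
    have kc_cont: "continuous_on (S \<times> S) (\<lambda>p. kc (fst p) (snd p))"
    proof -
      define P where "P = {p \<in> S \<times> S. norm (fst p - snd p) \<le> r / 2}"
      define Q where "Q = {p \<in> S \<times> S. r / 2 \<le> norm (fst p - snd p)}"
      have cl: "closed (S \<times> S)" using compact_S by (intro closed_Times compact_imp_closed)
      have "P = S \<times> S \<inter> {p. norm (fst p - snd p) \<le> r / 2}" by (auto simp: P_def)
      moreover have "closed {p :: (real^3) \<times> (real^3). norm (fst p - snd p) \<le> r / 2}"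
        by (intro closed_Collect_le continuous_intros)
      ultimately have P: "closed P" using cl by auto
      have "Q = S \<times> S \<inter> {p. r / 2 \<le> norm (fst p - snd p)}" by (auto simp: Q_def)
      moreover have "closed {p :: (real^3) \<times> (real^3). r / 2 \<le> norm (fst p - snd p)}"
        by (intro closed_Collect_le continuous_intros)
      ultimately have Q: "closed Q" using cl by auto
      have "continuous_on P (\<lambda>p. kc (fst p) (snd p))"
      proof (rule continuous_on_eq[OF continuous_on_const])
        fix p assume "p \<in> P"
        then have "2 * norm (fst p - snd p) / r \<le> 1" using r by (simp add: P_def)
        then have "\<eta> (fst p) (snd p) = 0" by (simp add: \<eta>_def)
        then show "0 = kc (fst p) (snd p)" by (simp add: kc_def)
      qed
      moreover have "continuous_on Q (\<lambda>p. kc (fst p) (snd p))"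
        unfolding kc_def
        by (intro continuous_on_scaleR \<eta>_cont continuous_on_subset[OF k0_cont]) (use r in \<open>auto simp: Q_def\<close>)
      ultimately have "continuous_on (P \<union> Q) (\<lambda>p. kc (fst p) (snd p))"
        by (intro continuous_on_closed_Un P Q)
      moreover have "P \<union> Q = S \<times> S" by (auto simp: P_def Q_def)
      ultimately show ?thesis by simp
    qed
    have kc_meas: "(\<lambda>p. kc (fst p) (snd p)) \<in> borel_measurable (M \<Otimes>\<^sub>M M)"
      by (rule off_diagonal_measurable[OF continuous_on_subset[OF kc_cont]]) (auto simp: kc_def k0_def)
    have kd_meas: "(\<lambda>p. kd (fst p) (snd p)) \<in> borel_measurable (M \<Otimes>\<^sub>M M)"
      unfolding kd_def
      by (rule off_diagonal_measurable) (auto simp: k0_def intro!: continuous_intros \<eta>_cont k0_cont[unfolded k0_def])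
    have kc_bound: "norm (kc x y) \<le> C * (1 / norm (x - y))" if "x \<in> S" "y \<in> S" for x y
    proof -
      have "norm (kc x y) \<le> 1 * norm (k0 x y)"
        unfolding kc_def norm_scaleR using \<eta>[of x y] by (intro mult_right_mono) auto
      then show ?thesis using k0_bound[OF that] by simp
    qed
    have kd_bound: "norm (kd x y) \<le> C * (indicator (ball x r) y / norm (x - y))" if "x \<in> S" "y \<in> S" for x y
    proof (cases "y \<in> ball x r")
      case True
      have "norm (kd x y) \<le> 1 * norm (k0 x y)"
        unfolding kd_def norm_scaleR using \<eta>[of x y] by (intro mult_right_mono) auto
      then show ?thesis using k0_bound[OF that] True by simp
    next
      case False
      then have "1 \<le> norm (x - y) / r" using r by (simp add: dist_norm)
      then have "\<eta> x y = 1" by (simp add: \<eta>_def)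
      then show ?thesis using False by (simp add: kd_def)
    qed
    have cA: "4 * c * r * C = e" using c_pos C by (simp add: r_def)
    have kd_int: "(\<integral>\<^sup>+y. ennreal (norm (q y)) \<partial>M) \<le> ennreal e"
      if "x \<in> S" "\<And>y. y \<in> S \<Longrightarrow> norm (q y) \<le> C * (indicator (ball x r) y / norm (x - y))"
      for x and q :: "real^3 \<Rightarrow> real^3^3"
    proof -
      have [measurable]: "(\<lambda>y. ennreal (indicator (ball x r) y / norm (x - y))) \<in> borel_measurable M"
        by (intro measurable_M_borel measurable_compose[OF _ measurable_ennreal] borel_measurable_divide
            borel_measurable_indicator borel_measurable_continuous_onI continuous_intros) simp
      have "(\<integral>\<^sup>+y. ennreal (norm (q y)) \<partial>M) \<le> (\<integral>\<^sup>+y. ennreal C * ennreal (indicator (ball x r) y / norm (x - y)) \<partial>M)"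
        using that(2) C by (intro nn_integral_mono) (simp add: space_M ennreal_leI flip: ennreal_mult)
      also have "\<dots> = ennreal C * (\<integral>\<^sup>+y. ennreal (indicator (ball x r) y / norm (x - y)) \<partial>M)"
        by (rule nn_integral_cmult) measurable
      also have "\<dots> \<le> ennreal C * ennreal (4 * c * r)"
        by (intro mult_left_mono riesz_bound that(1) r) simp
      also have "\<dots> = ennreal e" using C c_pos r cA by (simp add: mult.commute flip: ennreal_mult)
      finally show ?thesis .
    qed
    have kc_rows: "\<forall>x\<in>S. (\<integral>\<^sup>+y. ennreal (norm (kc x y)) \<partial>M) \<le> ennreal A"
      by (rule ballI, rule rows, assumption, (rule kc_bound; assumption))
    have kc_cols: "\<forall>y\<in>S. (\<integral>\<^sup>+x. ennreal (norm (kc x y)) \<partial>M) \<le> ennreal A"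
      by (rule ballI, rule rows, assumption, subst norm_minus_commute, (rule kc_bound; assumption))
    have kd_rows: "\<forall>x\<in>S. (\<integral>\<^sup>+y. ennreal (norm (kd x y)) \<partial>M) \<le> ennreal e"
      by (rule ballI, rule kd_int, assumption, (rule kd_bound; assumption))
    have kd_cols: "\<forall>y\<in>S. (\<integral>\<^sup>+x. ennreal (norm (kd x y)) \<partial>M) \<le> ennreal e"
    proof (rule ballI, rule kd_int, assumption)
      fix x y assume y: "y \<in> S" and "x \<in> S"
      moreover have "indicator (ball y r) x = (indicator (ball x r) y :: real)"
        by (auto simp: indicator_def dist_commute)
      ultimately show "norm (kd x y) \<le> C * (indicator (ball y r) x / norm (y - x))"
        using kd_bound[of x y] y by (simp add: norm_minus_commute)
    qed
    note sc = kernel_schur[OF kc_meas A kc_rows kc_cols]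
    note sd = kernel_schur[OF kd_meas less_imp_le[OF e] kd_rows kd_cols]
    have "L2_norm M (\<lambda>x. kernel_op M k0 \<rho> x - kernel_op M kc \<rho> x) \<le> e * L2_norm M \<rho>" if \<rho>: "\<rho> \<in> L2 M" for \<rho>
    proof -
      have "AE x in M. kernel_op M k0 \<rho> x - kernel_op M kc \<rho> x = kernel_op M kd \<rho> x"
        using s0(1)[OF \<rho>] sc(1)[OF \<rho>]
      proof eventually_elim
        case (elim x)
        have "kd x y *v \<rho> y = k0 x y *v \<rho> y - kc x y *v \<rho> y" for y
          by (simp add: kd_def kc_def scaleR_diff_left matrix_vector_mult_diff_rdistrib)
        then show ?case
          unfolding kernel_op_def using Bochner_Integration.integral_diff[OF elim] by simp
      qed
      then have "L2_norm M (\<lambda>x. kernel_op M k0 \<rho> x - kernel_op M kc \<rho> x) = L2_norm M (kernel_op M kd \<rho>)"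
        by (intro L2_norm_cong_AE L2_diff L2_linear_L2[OF s0(3)] L2_linear_L2[OF sc(3)] L2_linear_L2[OF sd(3)] \<rho>)
      then show ?thesis using sd(2)[OF \<rho>] by simp
    qed
    then show "\<exists>B. L2_compact M B \<and> (\<forall>f\<in>L2 M. L2_norm M (\<lambda>x. kernel_op M k0 f x - B f x) \<le> e * L2_norm M f)"
      using continuous_kernel_compact[OF kc_cont sc(3)] by blast
  qed
  then show ?thesis using L2k by (simp add: L2_compact_kernel_def op)
qed

end

text \<open>Only points near the diagonal matter: the pairs at distance at least \<delta> form a
  compact set, on which the kernel is at most some B, and B <= 2 R B / |x - y| when S has radius
  R.\<close>

lemma weakly_singularI:
  assumes S: "compact S"
    and cont: "continuous_on {p. fst p \<in> S \<and> snd p \<in> S \<and> fst p \<noteq> snd p} (\<lambda>p. k (fst p) (snd p))"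
    and \<delta>: "0 < \<delta>"
    and near: "\<And>x y. x \<in> S \<Longrightarrow> y \<in> S \<Longrightarrow> x \<noteq> y \<Longrightarrow> norm (x - y) < \<delta> \<Longrightarrow> norm (k x y) \<le> C / norm (x - y)"
  shows "weakly_singular S k"
proof -
  define F where "F = S \<times> S \<inter> {p. \<delta> \<le> norm (fst p - snd p)}"
  have "compact F"
    unfolding F_def
    by (intro compact_Int_closed compact_Times S closed_Collect_le continuous_intros)
  moreover have "continuous_on F (\<lambda>p. k (fst p) (snd p))"
    by (rule continuous_on_subset[OF cont]) (use \<delta> in \<open>auto simp: F_def\<close>)
  ultimately have "bounded ((\<lambda>p. k (fst p) (snd p)) ` F)"
    by (intro compact_imp_bounded compact_continuous_image)
  then obtain B where B: "0 < B" "\<And>p. p \<in> F \<Longrightarrow> norm (k (fst p) (snd p)) \<le> B"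
    unfolding bounded_pos by auto
  obtain R where R: "0 < R" "\<And>x. x \<in> S \<Longrightarrow> norm x \<le> R"
    using compact_imp_bounded[OF S] bounded_pos[of S] by auto
  have "norm (k x y) \<le> max C (B * (2 * R)) / norm (x - y)" if x: "x \<in> S" and y: "y \<in> S" and ne: "x \<noteq> y" for x y
  proof (cases "norm (x - y) < \<delta>")
    case True
    have "norm (k x y) \<le> C / norm (x - y)" by (rule near[OF x y ne True])
    also have "\<dots> \<le> max C (B * (2 * R)) / norm (x - y)" by (intro divide_right_mono) auto
    finally show ?thesis .
  next
    case False
    then have "norm (k x y) \<le> B" using B(2)[of "(x, y)"] x y by (simp add: F_def)
    moreover have "norm (x - y) \<le> 2 * R" using norm_triangle_ineq4[of x y] R(2)[OF x] R(2)[OF y] by simp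
    ultimately have "norm (k x y) * norm (x - y) \<le> B * (2 * R)" using B(1) by (intro mult_mono) auto
    also have "\<dots> \<le> max C (B * (2 * R))" by simp
    finally show ?thesis using ne by (simp add: field_simps)
  qed
  then show ?thesis using cont unfolding weakly_singular_def by blast
qed

lemma weakly_singular_continuous:
  assumes S: "compact S" and cont: "continuous_on (S \<times> S) (\<lambda>p. k (fst p) (snd p))"
  shows "weakly_singular S k"
proof -
  have "bounded ((\<lambda>p. k (fst p) (snd p)) ` (S \<times> S))"
    by (intro compact_imp_bounded compact_continuous_image cont compact_Times S)
  then obtain B where B: "0 < B" "\<And>x y. x \<in> S \<Longrightarrow> y \<in> S \<Longrightarrow> norm (k x y) \<le> B"
    unfolding bounded_pos by (auto simp: image_iff)
  show ?thesis
  proof (rule weakly_singularI[OF S continuous_on_subset[OF cont] zero_less_one])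
    fix x y assume "x \<in> S" "y \<in> S" "x \<noteq> y" "norm (x - y) < 1"
    moreover from this have "B * norm (x - y) \<le> B" using B(1) by simp
    then have "B \<le> B / norm (x - y)" using \<open>x \<noteq> y\<close> by (simp add: field_simps)
    ultimately show "norm (k x y) \<le> B / norm (x - y)" using B(2)[of x y] by linarith
  qed auto
qed

lemma weakly_singular_add:
  assumes "weakly_singular S k" "weakly_singular S l"
  shows "weakly_singular S (\<lambda>x y. k x y + l x y)"
proof -
  obtain C where C: "\<And>x y. x \<in> S \<Longrightarrow> y \<in> S \<Longrightarrow> x \<noteq> y \<Longrightarrow> norm (k x y) \<le> C / norm (x - y)"
    using assms(1) unfolding weakly_singular_def by blast
  obtain D where D: "\<And>x y. x \<in> S \<Longrightarrow> y \<in> S \<Longrightarrow> x \<noteq> y \<Longrightarrow> norm (l x y) \<le> D / norm (x - y)"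
    using assms(2) unfolding weakly_singular_def by blast
  have "norm (k x y + l x y) \<le> (C + D) / norm (x - y)" if "x \<in> S" "y \<in> S" "x \<noteq> y" for x y
    using add_mono[OF C[OF that] D[OF that]] norm_triangle_ineq[of "k x y" "l x y"]
    by (simp add: add_divide_distrib)
  then show ?thesis
    using assms unfolding weakly_singular_def by (auto intro!: continuous_on_add)
qed

lemma weakly_singular_scale:
  assumes "weakly_singular S k"
  shows "weakly_singular S (\<lambda>x y. a *\<^sub>R k x y)"
proof -
  obtain C where C: "\<And>x y. x \<in> S \<Longrightarrow> y \<in> S \<Longrightarrow> x \<noteq> y \<Longrightarrow> norm (k x y) \<le> C / norm (x - y)"
    using assms unfolding weakly_singular_def by blast
  have "norm (a *\<^sub>R k x y) \<le> (\<bar>a\<bar> * C) / norm (x - y)" if "x \<in> S" "y \<in> S" "x \<noteq> y" for x y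
    using mult_left_mono[OF C[OF that], of "\<bar>a\<bar>"] by simp
  moreover have "continuous_on {p. fst p \<in> S \<and> snd p \<in> S \<and> fst p \<noteq> snd p} (\<lambda>p. a *\<^sub>R k (fst p) (snd p))"
    using assms by (intro continuous_on_scaleR continuous_on_const) (simp add: weakly_singular_def)
  ultimately show ?thesis unfolding weakly_singular_def by blast
qed

lemma weakly_singular_cong:
  assumes "weakly_singular S k" "\<And>x y. x \<in> S \<Longrightarrow> y \<in> S \<Longrightarrow> x \<noteq> y \<Longrightarrow> k x y = l x y"
  shows "weakly_singular S l"
proof -
  have "continuous_on {p. fst p \<in> S \<and> snd p \<in> S \<and> fst p \<noteq> snd p} (\<lambda>p. l (fst p) (snd p))"
    by (rule continuous_on_eq[of _ "\<lambda>p. k (fst p) (snd p)"])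
      (use assms in \<open>auto simp: weakly_singular_def\<close>)
  then show ?thesis using assms unfolding weakly_singular_def by metis
qed

section \<open>The kernels on the boundary\<close>

lemma norm_matrix_le:
  fixes A :: "real^3^3"
  assumes "\<And>j k. \<bar>A $ j $ k\<bar> \<le> B"
  shows "norm A \<le> 9 * B"
proof -
  have "norm A \<le> (\<Sum>j\<in>UNIV. norm (A $ j))"
    unfolding norm_vec_def[of A] by (rule L2_set_le_sum) simp
  also have "\<dots> \<le> (\<Sum>j\<in>(UNIV::3 set). \<Sum>k\<in>(UNIV::3 set). B)"
    by (intro sum_mono order_trans[OF norm_le_l1_cart] assms)
  finally show ?thesis by simp
qed

text \<open>24 = 9 + 15: three products with factor 3, and the product of three inner products with
  factor 15, by Cauchy-Schwarz.\<close>

lemma third_deriv_bound: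
  assumes "w \<noteq> 0"
  shows "\<bar>third_deriv a b c w\<bar> \<le> 24 * (norm a * norm b * norm c) / norm w ^ 4"
proof -
  define r P where "r = norm w" and "P = norm a * norm b * norm c"
  have r: "0 < r" using assms by (simp add: r_def)
  have CS: "\<bar>u \<bullet> v\<bar> \<le> norm u * norm v" for u v :: "real^3" by (rule Cauchy_Schwarz_ineq2)
  have pair: "\<bar>(u \<bullet> v) * (z \<bullet> w)\<bar> \<le> norm u * norm v * norm z * r" for u v z :: "real^3"
  proof -
    have "\<bar>(u \<bullet> v) * (z \<bullet> w)\<bar> \<le> (norm u * norm v) * (norm z * r)"
      unfolding abs_mult r_def by (intro mult_mono CS mult_nonneg_nonneg norm_ge_zero abs_ge_zero)
    then show ?thesis by (simp add: mult.assoc)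
  qed
  have t1: "\<bar>(a \<bullet> b) * (c \<bullet> w) + (a \<bullet> c) * (b \<bullet> w) + (b \<bullet> c) * (a \<bullet> w)\<bar> \<le> 3 * (P * r)"
    using pair[of a b c] pair[of a c b] pair[of b c a] by (simp add: P_def mult_ac)
  have "\<bar>(a \<bullet> w) * (b \<bullet> w) * (c \<bullet> w)\<bar> \<le> (norm a * r) * (norm b * r) * (norm c * r)"
    unfolding abs_mult r_def by (intro mult_mono CS mult_nonneg_nonneg norm_ge_zero abs_ge_zero)
  then have t2: "\<bar>(a \<bullet> w) * (b \<bullet> w) * (c \<bullet> w)\<bar> \<le> P * r ^ 3"
    by (simp add: P_def power3_eq_cube mult_ac)
  have "\<bar>third_deriv a b c w\<bar> \<le> \<bar>3 * ((a \<bullet> b) * (c \<bullet> w) + (a \<bullet> c) * (b \<bullet> w) + (b \<bullet> c) * (a \<bullet> w)) / r ^ 5\<bar>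
      + \<bar>15 * (a \<bullet> w) * (b \<bullet> w) * (c \<bullet> w) / r ^ 7\<bar>"
    unfolding third_deriv_def r_def by (rule abs_triangle_ineq4)
  also have "\<dots> \<le> 9 * (P * r) / r ^ 5 + 15 * (P * r ^ 3) / r ^ 7"
  proof (rule add_mono)
    show "\<bar>3 * ((a \<bullet> b) * (c \<bullet> w) + (a \<bullet> c) * (b \<bullet> w) + (b \<bullet> c) * (a \<bullet> w)) / r ^ 5\<bar> \<le> 9 * (P * r) / r ^ 5"
      using t1 r by (simp add: abs_mult divide_right_mono)
    show "\<bar>15 * (a \<bullet> w) * (b \<bullet> w) * (c \<bullet> w) / r ^ 7\<bar> \<le> 15 * (P * r ^ 3) / r ^ 7"
      using t2 r by (simp add: abs_mult mult.assoc divide_right_mono)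
  qed
  also have "\<dots> = 24 * P / r ^ 4"
    using r by (simp add: field_simps eval_nat_numeral)
  finally show ?thesis by (simp add: r_def P_def)
qed

text \<open>192 = 2 * 4 * 24: four third derivatives in unit directions, with coefficients of
  modulus at most 1, and the overall factor 2.\<close>

lemma residual_bound:
  assumes v: "norm v = 1" and w: "w \<noteq> 0"
  shows "\<bar>residual v i j k w\<bar> \<le> 192 / norm w ^ 4"
proof -
  define T where "T = 24 / norm w ^ 4"
  have T: "0 \<le> T" by (simp add: T_def)
  have b: "\<bar>third_deriv a b c w\<bar> \<le> T" if "norm a = 1" "norm b = 1" "norm c = 1" for a b c
    using third_deriv_bound[OF w, of a b c] that by (simp add: T_def)
  have m: "\<bar>s * third_deriv a b c w\<bar> \<le> T" if "\<bar>s\<bar> \<le> 1" "norm a = 1" "norm b = 1" "norm c = 1" for s a b c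
    using mult_mono[OF that(1) b[OF that(2-4)]] by (simp add: abs_mult)
  have vc: "\<bar>v $ l\<bar> \<le> 1" for l using component_le_norm_cart[of v l] v by simp
  have "\<bar>(if i = j then 1 else 0) * third_deriv v v (axis k 1) w\<bar> \<le> T"
    "\<bar>third_deriv (axis i 1) (axis j 1) (axis k 1) w\<bar> \<le> T"
    "\<bar>v $ j * third_deriv v (axis i 1) (axis k 1) w\<bar> \<le> T"
    "\<bar>v $ i * third_deriv v (axis j 1) (axis k 1) w\<bar> \<le> T"
    by (intro m b; simp add: v vc)+
  moreover have "\<bar>- 2 * (p + q - r - s)\<bar> \<le> 2 * (T + T + T + T)"
    if "\<bar>p\<bar> \<le> T" "\<bar>q\<bar> \<le> T" "\<bar>r\<bar> \<le> T" "\<bar>s\<bar> \<le> T" for p q r s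
  proof -
    have "\<bar>p + q - r - s\<bar> \<le> T + T + T + T" using that by linarith
    then show ?thesis by (simp add: abs_mult)
  qed
  ultimately have "\<bar>residual v i j k w\<bar> \<le> 2 * (T + T + T + T)"
    unfolding residual_def by blast
  then show ?thesis by (simp add: T_def)
qed

text \<open>The antiderivative is - 1 / (2 (r^2 + t^2)), so the bound is uniform in
  \<open>h\<close>. The weight t improves the order of the integral from 1 / r^3 to 1 / r^2.\<close>

lemma dipole_integral:
  fixes r h :: real
  assumes r: "0 < r" and h: "0 \<le> h"
  shows "(\<lambda>t. t / (r\<^sup>2 + t\<^sup>2)\<^sup>2) integrable_on {0..h}"
    and "integral {0..h} (\<lambda>t. t / (r\<^sup>2 + t\<^sup>2)\<^sup>2) \<le> 1 / (2 * r\<^sup>2)"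
proof -
  have pos: "0 < r\<^sup>2 + t\<^sup>2" for t using r by (simp add: add_pos_nonneg)
  have "((\<lambda>t. t / (r\<^sup>2 + t\<^sup>2)\<^sup>2) has_integral (- 1 / (2 * (r\<^sup>2 + h\<^sup>2)) - (- 1 / (2 * (r\<^sup>2 + 0\<^sup>2))))) {0..h}"
  proof (rule fundamental_theorem_of_calculus[OF h])
    fix t assume "t \<in> {0..h}"
    define g where "g t = r\<^sup>2 + t\<^sup>2" for t
    have nz: "g t \<noteq> 0" using pos[of t] by (metis g_def less_irrefl)
    have g: "(g has_real_derivative 2 * t) (at t within {0..h})"
      unfolding g_def by (auto intro!: derivative_eq_intros)
    have "((\<lambda>t. (- 1 / 2) * inverse (g t)) has_real_derivative
        (- 1 / 2) * - (inverse (g t) * (2 * t) * inverse (g t))) (at t within {0..h})"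
      by (intro DERIV_cmult DERIV_inverse' g nz)
    moreover have "(- 1 / 2) * - (i * (2 * t) * i) = t * (i * i)" for i :: real
      by simp
    moreover have "t / (g t)\<^sup>2 = t * (inverse (g t) * inverse (g t))"
      by (simp only: divide_inverse power2_eq_square inverse_mult_distrib)
    moreover have "- 1 / (2 * u) = (- 1 / 2) * inverse u" for u :: real
      by (cases "u = 0") (auto simp: field_simps)
    ultimately have "((\<lambda>t. - 1 / (2 * g t)) has_real_derivative t / (g t)\<^sup>2) (at t within {0..h})"
      by (simp only:)
    then have "((\<lambda>t. - 1 / (2 * (r\<^sup>2 + t\<^sup>2))) has_real_derivative t / (r\<^sup>2 + t\<^sup>2)\<^sup>2) (at t within {0..h})"
      unfolding g_def .
    then show "((\<lambda>t. - 1 / (2 * (r\<^sup>2 + t\<^sup>2))) has_vector_derivative t / (r\<^sup>2 + t\<^sup>2)\<^sup>2) (at t within {0..h})"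
      by (simp add: has_real_derivative_iff_has_vector_derivative)
  qed
  note hi = this
  show "(\<lambda>t. t / (r\<^sup>2 + t\<^sup>2)\<^sup>2) integrable_on {0..h}" using hi by blast
  have "0 \<le> 1 / (2 * (r\<^sup>2 + h\<^sup>2))" using pos[of h] by simp
  then show "integral {0..h} (\<lambda>t. t / (r\<^sup>2 + t\<^sup>2)\<^sup>2) \<le> 1 / (2 * r\<^sup>2)"
    using integral_unique[OF hi] by simp
qed

text \<open>The coefficient (1 - \<alpha>) / \<alpha> is left out, so the kernel depends on the
  geometry alone and is common to all Lame parameters.\<close>

definition remainder_kernel ::
    "(real^3) set \<Rightarrow> (real^3 \<Rightarrow> real) \<Rightarrow> real^3 \<Rightarrow> real^3 \<Rightarrow> real^3^3" where
  "remainder_kernel \<Omega> h x y = (\<chi> j k. 1 / (4 * pi) * (\<Sum>i\<in>UNIV. outward_normal \<Omega> x $ i *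
     integral {0..h y} (\<lambda>t. t * residual (outward_normal \<Omega> y) i j k (x - y - t *\<^sub>R outward_normal \<Omega> y))))"

lemma residual_line_integrable:
  assumes off: "\<And>t. t \<in> {0..h} \<Longrightarrow> x \<noteq> y + t *\<^sub>R v"
  shows "(\<lambda>t. t * residual v i j k (x - y - t *\<^sub>R v)) integrable_on {0..h}"
  by (intro integrable_continuous_real continuous_intros
      continuous_on_line_off_zero[OF continuous_on_residual] off)

text \<open>Flatness gives |x - y - t v|^2 >= r^2 - r t + t^2 >= (r^2 + t^2) / 2. The residual is
  then at most 4 * 192 / (r^2 + t^2)^2, and \<open>dipole_integral\<close> turns 768 into 384 /
  r^2.\<close>

lemma residual_line_bound:
  assumes v: "norm v = 1" and h: "0 \<le> h" and xy: "x \<noteq> y"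
    and off: "\<And>t. t \<in> {0..h} \<Longrightarrow> x \<noteq> y + t *\<^sub>R v"
    and flat: "\<bar>(x - y) \<bullet> v\<bar> \<le> norm (x - y) / 2"
  shows "\<bar>integral {0..h} (\<lambda>t. t * residual v i j k (x - y - t *\<^sub>R v))\<bar> \<le> 384 / (norm (x - y))\<^sup>2"
proof -
  define r where "r = norm (x - y)"
  have r: "0 < r" using xy by (simp add: r_def)
  have dist: "(r\<^sup>2 + t\<^sup>2) / 2 \<le> (norm (x - y - t *\<^sub>R v))\<^sup>2" if t: "0 \<le> t" for t
  proof -
    have "(norm (a - t *\<^sub>R v))\<^sup>2 = (norm a)\<^sup>2 - 2 * t * (a \<bullet> v) + t\<^sup>2" for a
      using v unfolding power2_norm_eq_inner norm_eq_1
      by (simp add: inner_diff_left inner_diff_right inner_commute[of v a] power2_eq_square right_diff_distrib)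
    from this[of "x - y"] have "(norm (x - y - t *\<^sub>R v))\<^sup>2 = r\<^sup>2 - 2 * t * ((x - y) \<bullet> v) + t\<^sup>2"
      by (simp add: r_def)
    moreover have "2 * t * ((x - y) \<bullet> v) \<le> 2 * t * (r / 2)"
      using flat t by (intro mult_left_mono) (auto simp: r_def)
    moreover have "2 * r * t \<le> r\<^sup>2 + t\<^sup>2" by (rule sum_squares_bound)
    ultimately show ?thesis by (simp add: field_simps)
  qed
  have "norm (integral {0..h} (\<lambda>t. t * residual v i j k (x - y - t *\<^sub>R v)))
      \<le> integral {0..h} (\<lambda>t. 768 * (t / (r\<^sup>2 + t\<^sup>2)\<^sup>2))"
  proof (rule integral_norm_bound_integral[OF residual_line_integrable[OF off]])
    show "(\<lambda>t. 768 * (t / (r\<^sup>2 + t\<^sup>2)\<^sup>2)) integrable_on {0..h}"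
      by (intro integrable_on_mult_right dipole_integral r h)
    fix t assume t: "t \<in> {0..h}"
    define q where "q = norm (x - y - t *\<^sub>R v)"
    have w: "x - y - t *\<^sub>R v \<noteq> 0" using off[OF t] by (auto simp: algebra_simps)
    have s: "0 < r\<^sup>2 + t\<^sup>2" using r by (simp add: add_pos_nonneg)
    have "((r\<^sup>2 + t\<^sup>2) / 2)\<^sup>2 \<le> (q\<^sup>2)\<^sup>2"
      using dist[of t] t s unfolding q_def by (intro power_mono) auto
    then have "(r\<^sup>2 + t\<^sup>2)\<^sup>2 / 4 \<le> q ^ 4" by (simp add: power_divide flip: power_mult)
    then have "192 / q ^ 4 \<le> 192 / ((r\<^sup>2 + t\<^sup>2)\<^sup>2 / 4)"
      using s w by (intro divide_left_mono mult_pos_pos) (auto simp: q_def)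
    then have "\<bar>residual v i j k (x - y - t *\<^sub>R v)\<bar> \<le> 768 / (r\<^sup>2 + t\<^sup>2)\<^sup>2"
      using residual_bound[OF v w, of i j k] by (simp add: q_def)
    then have "t * \<bar>residual v i j k (x - y - t *\<^sub>R v)\<bar> \<le> t * (768 / (r\<^sup>2 + t\<^sup>2)\<^sup>2)"
      using t by (intro mult_left_mono) auto
    then show "norm (t * residual v i j k (x - y - t *\<^sub>R v)) \<le> 768 * (t / (r\<^sup>2 + t\<^sup>2)\<^sup>2)"
      using t by (simp add: abs_mult mult_ac)
  qed
  also have "\<dots> = 768 * integral {0..h} (\<lambda>t. t / (r\<^sup>2 + t\<^sup>2)\<^sup>2)"
    by (rule integral_mult_right)
  also have "\<dots> \<le> 768 * (1 / (2 * r\<^sup>2))"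
    by (intro mult_left_mono dipole_integral r h) simp
  finally show ?thesis by (simp add: r_def)
qed

text \<open>After subtracting the contraction with n(y), each of three summands is at most (C r)
  (384 / r^2), which gives 1152 C / r per entry; 9 is the number of entries, and 1 / (4 pi) is
  estimated by 1.\<close>

lemma remainder_kernel_bound:
  assumes n: "norm (outward_normal \<Omega> x - outward_normal \<Omega> y) \<le> C * norm (x - y)"
    and v: "norm (outward_normal \<Omega> y) = 1" and h: "0 \<le> h y" and xy: "x \<noteq> y"
    and off: "\<And>t. t \<in> {0..h y} \<Longrightarrow> x \<noteq> y + t *\<^sub>R outward_normal \<Omega> y"
    and flat: "\<bar>(x - y) \<bullet> outward_normal \<Omega> y\<bar> \<le> norm (x - y) / 2"
  shows "norm (remainder_kernel \<Omega> h x y) \<le> (9 * (1152 * C)) / norm (x - y)"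
proof -
  let ?v = "outward_normal \<Omega> y"
  define r where "r = norm (x - y)"
  have r: "0 < r" using xy by (simp add: r_def)
  have C: "0 \<le> C" using order_trans[OF norm_ge_zero n] r by (simp add: r_def[symmetric] zero_le_mult_iff)
  have "\<bar>remainder_kernel \<Omega> h x y $ j $ k\<bar> \<le> 1152 * C / r" for j k
  proof -
    define I where "I i = integral {0..h y} (\<lambda>t. t * residual ?v i j k (x - y - t *\<^sub>R ?v))" for i
    have int: "(\<lambda>t. ?v $ i * (t * residual ?v i j k (x - y - t *\<^sub>R ?v))) integrable_on {0..h y}" for i
      by (intro integrable_on_mult_right residual_line_integrable off)
    have "(\<Sum>i\<in>UNIV. ?v $ i * I i) = integral {0..h y} (\<lambda>t. \<Sum>i\<in>UNIV. ?v $ i * (t * residual ?v i j k (x - y - t *\<^sub>R ?v)))"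
      unfolding I_def by (simp add: integral_sum[OF _ int])
    also have "\<dots> = integral {0..h y} (\<lambda>t. t * (\<Sum>i\<in>UNIV. ?v $ i * residual ?v i j k (x - y - t *\<^sub>R ?v)))"
      by (simp add: sum_distrib_left mult_ac)
    also have "\<dots> = 0" by (simp add: residual_normal[OF v])
    finally have zero: "(\<Sum>i\<in>UNIV. ?v $ i * I i) = 0" .
    have "remainder_kernel \<Omega> h x y $ j $ k = 1 / (4 * pi) * (\<Sum>i\<in>UNIV. outward_normal \<Omega> x $ i * I i)"
      by (simp add: remainder_kernel_def I_def)
    also have "\<dots> = 1 / (4 * pi) * (\<Sum>i\<in>UNIV. (outward_normal \<Omega> x - ?v) $ i * I i)"
      using zero by (simp add: left_diff_distrib sum_subtractf)
    finally have "\<bar>remainder_kernel \<Omega> h x y $ j $ k\<bar> = 1 / (4 * pi) * \<bar>\<Sum>i\<in>UNIV. (outward_normal \<Omega> x - ?v) $ i * I i\<bar>"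
      by (simp add: abs_mult)
    also have "\<dots> \<le> 1 * \<bar>\<Sum>i\<in>UNIV. (outward_normal \<Omega> x - ?v) $ i * I i\<bar>"
      using pi_gt3 by (intro mult_right_mono) auto
    also have "\<dots> \<le> (\<Sum>i\<in>UNIV. \<bar>(outward_normal \<Omega> x - ?v) $ i * I i\<bar>)"
      by (simp add: sum_abs)
    also have "\<dots> \<le> (\<Sum>i\<in>(UNIV :: 3 set). (C * r) * (384 / r\<^sup>2))"
    proof (rule sum_mono)
      fix i
      have "\<bar>(outward_normal \<Omega> x - ?v) $ i\<bar> \<le> C * r"
        using component_le_norm_cart[of "outward_normal \<Omega> x - ?v" i] n by (simp add: r_def)
      moreover have "\<bar>I i\<bar> \<le> 384 / r\<^sup>2"
        unfolding I_def r_def by (rule residual_line_bound[OF v h xy off flat])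
      ultimately show "\<bar>(outward_normal \<Omega> x - ?v) $ i * I i\<bar> \<le> (C * r) * (384 / r\<^sup>2)"
        unfolding abs_mult using C r by (intro mult_mono) auto
    qed
    also have "\<dots> = 1152 * C / r" using r by (simp add: power2_eq_square)
    finally show ?thesis .
  qed
  then have "norm (remainder_kernel \<Omega> h x y) \<le> 9 * (1152 * C / r)" by (rule norm_matrix_le)
  then show ?thesis by (simp add: r_def)
qed

text \<open>The interval of integration varies with y. The substitution t = h(y) s moves it to
  [0, 1], where continuity of the integrand in all variables suffices.\<close>

lemma remainder_kernel_continuous:
  fixes P :: "((real^3) \<times> (real^3)) set"
  assumes n1: "continuous_on P (\<lambda>p. outward_normal \<Omega> (fst p))"
    and n2: "continuous_on P (\<lambda>p. outward_normal \<Omega> (snd p))"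
    and h: "continuous_on P (\<lambda>p. h (snd p))" and hpos: "\<And>p. p \<in> P \<Longrightarrow> 0 < h (snd p)"
    and off: "\<And>p t. p \<in> P \<Longrightarrow> t \<in> {0..h (snd p)} \<Longrightarrow> fst p \<noteq> snd p + t *\<^sub>R outward_normal \<Omega> (snd p)"
  shows "continuous_on P (\<lambda>p. remainder_kernel \<Omega> h (fst p) (snd p))"
proof -
  let ?v = "\<lambda>p. outward_normal \<Omega> (snd p)"
  define w where "w = (\<lambda>(p, s). fst p - snd p - (h (snd p) * s) *\<^sub>R ?v p)"
  define F where "F i j k p s = (h (snd p) * s) * residual (?v p) i j k (w (p, s))" for i j k p s
  have scale: "integral {0..h (snd p)} (\<lambda>t. t * residual (?v p) i j k (fst p - snd p - t *\<^sub>R ?v p))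
      = h (snd p) * integral (cbox 0 1) (F i j k p)" if p: "p \<in> P" for p i j k
  proof -
    note hp = hpos[OF p]
    have img: "(\<lambda>x. x / h (snd p)) ` {0..h (snd p)} = {0..1}"
      using hp by (auto simp: image_divide_atLeastAtMost)
    have "integral {0..1} (\<lambda>s. (h (snd p) * s) * residual (?v p) i j k (fst p - snd p - (h (snd p) * s) *\<^sub>R ?v p))
      = (1 / h (snd p)) *\<^sub>R integral {0..h (snd p)} (\<lambda>t. t * residual (?v p) i j k (fst p - snd p - t *\<^sub>R ?v p))"
      using integral_stretch_real[of "h (snd p)" 0 "h (snd p)" "\<lambda>t. t * residual (?v p) i j k (fst p - snd p - t *\<^sub>R ?v p)"] hp
      unfolding img by simp
    moreover have "F i j k p = (\<lambda>s. (h (snd p) * s) * residual (?v p) i j k (fst p - snd p - (h (snd p) * s) *\<^sub>R ?v p))"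
      by (simp add: fun_eq_iff F_def w_def)
    ultimately have "integral (cbox 0 1) (F i j k p) =
        (1 / h (snd p)) *\<^sub>R integral {0..h (snd p)} (\<lambda>t. t * residual (?v p) i j k (fst p - snd p - t *\<^sub>R ?v p))"
      by simp
    then show ?thesis using hp by simp
  qed
  have wcont: "continuous_on (P \<times> cbox 0 1) w"
    unfolding w_def case_prod_unfold
    by (intro continuous_intros continuous_on_compose2[OF n2 continuous_on_fst] continuous_on_compose2[OF h continuous_on_fst]) auto
  have wnz: "w (p, s) \<noteq> 0" if "p \<in> P" "s \<in> {0..1}" for p s
  proof -
    have "h (snd p) * s \<in> {0..h (snd p)}" using that hpos[OF that(1)] by (simp add: mult_left_le)
    from off[OF that(1) this] show ?thesis by (auto simp: w_def algebra_simps)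
  qed
  have v2: "continuous_on (P \<times> cbox (0::real) 1) (\<lambda>q. ?v (fst q))"
    by (intro continuous_on_compose2[OF n2 continuous_on_fst] continuous_intros) auto
  have h2: "continuous_on (P \<times> cbox (0::real) 1) (\<lambda>q. h (snd (fst q)))"
    by (intro continuous_on_compose2[OF h continuous_on_fst] continuous_intros) auto
  have Fcont: "continuous_on (P \<times> cbox 0 1) (\<lambda>(p, s). F i j k p s)" for i j k
    unfolding F_def case_prod_unfold residual_def third_deriv_def prod.collapse
    by (intro continuous_intros v2 h2 wcont) (auto simp: wnz)
  have "continuous_on P (\<lambda>p. integral (cbox 0 1) (F i j k p))" for i j k
    by (rule integral_continuous_on_param[OF Fcont])
  then have "continuous_on P (\<lambda>p. \<chi> j k. 1 / (4 * pi) * (\<Sum>i\<in>UNIV. outward_normal \<Omega> (fst p) $ i *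
      (h (snd p) * integral (cbox 0 1) (F i j k p))))"
    by (intro continuous_intros n1 h)
  then show ?thesis
    by (rule continuous_on_eq) (simp add: remainder_kernel_def scale)
qed

section \<open>The kernels of a boundary with displaced sources\<close>

locale coated_domain =
  fixes \<Omega> :: "(real^3) set" and h :: "real^3 \<Rightarrow> real"
  assumes domain: "smooth_domain \<Omega>" and compact_bd: "compact (frontier \<Omega>)"
    and smooth_h: "smooth_along (frontier \<Omega>) h"
    and h_pos: "\<And>y. y \<in> frontier \<Omega> \<Longrightarrow> 0 < h y"
    and segments: "\<And>y. y \<in> frontier \<Omega> \<Longrightarrow>
       {y + t *\<^sub>R outward_normal \<Omega> y | t. t \<in> {0..h y}} \<inter> frontier \<Omega> = {y}"
begin

abbreviation "S \<equiv> frontier \<Omega>"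
abbreviation "\<nu> \<equiv> outward_normal \<Omega>"
abbreviation "disp \<equiv> displaced \<Omega> h"

lemma unit: "y \<in> S \<Longrightarrow> norm (\<nu> y) = 1"
  by (rule outward_normal_unit[OF domain])

lemma off_segment:
  assumes "x \<in> S" "y \<in> S" "x \<noteq> y" "t \<in> {0..h y}"
  shows "x \<noteq> y + t *\<^sub>R \<nu> y"
proof
  assume x: "x = y + t *\<^sub>R \<nu> y"
  then have "x \<in> {y + t *\<^sub>R \<nu> y | t. t \<in> {0..h y}} \<inter> S" using assms by blast
  then have "x \<in> {y}" unfolding segments[OF assms(2)] .
  then show False using assms(3) by simp
qed

text \<open>The diagonal is included because h > 0, so the displaced kernels are continuous on all
  of S x S.\<close>

lemma off_displaced:
  assumes "x \<in> S" "y \<in> S"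
  shows "x \<noteq> disp y"
proof (cases "x = y")
  case True
  have "\<nu> y \<noteq> 0" using unit[OF assms(2)] by auto
  then show ?thesis using True h_pos[OF assms(2)] by (simp add: displaced_def)
next
  case False
  then show ?thesis
    using off_segment[OF assms False, of "h y"] h_pos[OF assms(2)] by (simp add: displaced_def)
qed

lemma continuous_normal: "continuous_on S \<nu>"
  by (rule continuous_on_normal[OF domain compact_bd])

lemma continuous_h: "continuous_on S h"
  by (rule smooth_along_continuous[OF smooth_h])

lemma continuous_displaced: "continuous_on S disp"
  unfolding displaced_def by (intro continuous_intros continuous_normal continuous_h)

lemma dipole_eq:
  assumes "x \<in> S" "y \<in> S"
  shows "displaced_dipole_kernel \<Omega> h x y =
    (\<chi> i k. \<Sum>j\<in>UNIV. h y * \<nu> x $ j * cubic1 (\<nu> y) i j k (x - disp y))"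
proof -
  have "(\<Sum>l\<in>UNIV. h y * \<nu> x $ j * \<nu> y $ l * pdiff l (cubic i j k x) (disp y))
      = h y * \<nu> x $ j * cubic1 (\<nu> y) i j k (x - disp y)" for i j k
    using ddiff_eq[OF cubic_has_derivative[OF off_displaced[OF assms], of i j k], of "\<nu> y"]
    by (simp add: ddiff_def sum_distrib_left[symmetric] mult.assoc)
  then show ?thesis by (simp add: displaced_dipole_kernel_def)
qed

lemma cubic_commute: "cubic i j k x y = cubic j i k x y"
  by (simp add: cubic_def mult_ac)

lemma cubic1_commute: "cubic1 v i j k w = cubic1 v j i k w"
  by (simp add: cubic1_def algebra_simps)

text \<open>\<open>stress_K_B\<close> only needs x to avoid the segment, so the identity is
  available for every pair of distinct boundary points, as integration over y demands. The kernels
  on the right contract the second index instead of the first, which the symmetry of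
  \<open>cubic\<close> and \<open>cubic1\<close> permits.\<close>

theorem Sigma_B_eq:
  assumes el: "elastic lam mu" and x: "x \<in> S" and y: "y \<in> S" and ne: "x \<noteq> y"
  shows "Sigma_B \<Omega> lam mu h x y =
    (- 3 / (2 * pi)) *\<^sub>R stokes_kernel \<Omega> x y + (3 / (2 * pi)) *\<^sub>R displaced_kernel \<Omega> h x y
    + (- 3 / (2 * pi)) *\<^sub>R displaced_dipole_kernel \<Omega> h x y
    + ((1 - lame_alpha lam mu) / lame_alpha lam mu) *\<^sub>R remainder_kernel \<Omega> h x y"
proof -
  define c where "c = (1 - lame_alpha lam mu) / lame_alpha lam mu"
  define a where "a = - 3 / (2 * pi)"
  define I where "I i j k = integral {0..h y} (\<lambda>t. t * residual (\<nu> y) i j k (x - y - t *\<^sub>R \<nu> y))" for i j k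
  have st: "stress lam mu (\<lambda>x'. column k (K_B lam mu (\<nu> y) (h y) x' y)) i j x =
     a * (cubic i j k x y - cubic i j k x (disp y) + h y * cubic1 (\<nu> y) i j k (x - disp y)) + c / (4 * pi) * I i j k"
    for i j k
    unfolding a_def c_def I_def displaced_def
    by (rule stress_K_B[OF el unit[OF y] less_imp_le[OF h_pos[OF y]] off_segment[OF x y ne]])
  have "Sigma_B \<Omega> lam mu h x y $ j $ k =
     a * (\<Sum>i\<in>UNIV. \<nu> x $ i * cubic j i k x y) - a * (\<Sum>i\<in>UNIV. \<nu> x $ i * cubic j i k x (disp y))
     + a * (\<Sum>i\<in>UNIV. h y * \<nu> x $ i * cubic1 (\<nu> y) j i k (x - disp y))
     + c * (1 / (4 * pi) * (\<Sum>i\<in>UNIV. \<nu> x $ i * I i j k))" for j k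
    unfolding Sigma_B_def st
    by (simp add: sum_distrib_left sum.distrib[symmetric] sum_subtractf[symmetric] cubic_commute[of j] cubic1_commute[of _ j])
      (simp add: algebra_simps)
  then show ?thesis
    unfolding dipole_eq[OF x y]
    by (simp add: vec_eq_iff stokes_kernel_def displaced_kernel_def remainder_kernel_def I_def a_def c_def)
qed

lemma T_S_cubic: "T_S i j k x y = - 3 / (4 * pi) * cubic i j k x y"
  by (simp add: T_S_def cubic_def Let_def)

lemma T_S_dipole:
  assumes "x \<in> S" "y \<in> S"
  shows "\<nu> y \<bullet> grad (T_S i j k x) (disp y) = - 3 / (4 * pi) * cubic1 (\<nu> y) i j k (x - disp y)"
proof -
  have "(T_S i j k x has_derivative (\<lambda>h. - 3 / (4 * pi) * cubic1 h i j k (x - disp y))) (at (disp y))"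
    unfolding T_S_cubic[abs_def]
    by (intro has_derivative_mult_right cubic_has_derivative off_displaced assms)
  from ddiff_eq[OF this, of "\<nu> y"] show ?thesis
    by (simp add: ddiff_def grad_def inner_vec_def)
qed

lemma Sigma_B_traction:
  assumes el: "elastic lam mu" and x: "x \<in> S" and y: "y \<in> S" and ne: "x \<noteq> y"
  shows "Sigma_B \<Omega> lam mu h x y $ j $ k =
    2 * (\<Sum>i\<in>UNIV. \<nu> x $ i * (T_S i j k x y - T_S i j k x (disp y) + h y * (\<nu> y \<bullet> grad (T_S i j k x) (disp y))))
    + (1 - lame_alpha lam mu) * ((1 / lame_alpha lam mu) *\<^sub>R remainder_kernel \<Omega> h x y) $ j $ k"
proof -
  have "2 * (\<Sum>i\<in>UNIV. \<nu> x $ i * (T_S i j k x y - T_S i j k x (disp y) + h y * (\<nu> y \<bullet> grad (T_S i j k x) (disp y))))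
    = - 3 / (2 * pi) * (\<Sum>i\<in>UNIV. \<nu> x $ i * cubic j i k x y) + 3 / (2 * pi) * (\<Sum>i\<in>UNIV. \<nu> x $ i * cubic j i k x (disp y))
     + - 3 / (2 * pi) * (\<Sum>i\<in>UNIV. h y * \<nu> x $ i * cubic1 (\<nu> y) j i k (x - disp y))"
    unfolding T_S_dipole[OF x y] T_S_cubic sum_distrib_left sum.distrib[symmetric]
    by (intro sum.cong refl) (simp add: cubic_commute[of j] cubic1_commute[of _ j] field_simps)
  then show ?thesis
    unfolding Sigma_B_eq[OF assms] dipole_eq[OF x y]
    by (simp add: stokes_kernel_def displaced_kernel_def)
qed

lemma fst_snd_continuous:
  fixes f :: "real^3 \<Rightarrow> 'b::topological_space"
  assumes "continuous_on S f"
  shows "continuous_on {p. fst p \<in> S \<and> snd p \<in> S \<and> fst p \<noteq> snd p} (\<lambda>p. f (fst p))"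
    "continuous_on {p. fst p \<in> S \<and> snd p \<in> S \<and> fst p \<noteq> snd p} (\<lambda>p. f (snd p))"
    "continuous_on (S \<times> S) (\<lambda>p. f (fst p))" "continuous_on (S \<times> S) (\<lambda>p. f (snd p))"
  by (rule continuous_on_compose2[OF assms]; auto intro!: continuous_intros)+

text \<open>The contraction with n(x) replaces one factor of size r by n(x) . (x - y) = O(r^2),
  which lowers the apparent singularity 1 / r^2 to 1 / r.\<close>

lemma stokes_weakly_singular: "weakly_singular S (stokes_kernel \<Omega>)"
proof -
  obtain C where C: "0 < C" and flat: "\<And>x y. x \<in> S \<Longrightarrow> y \<in> S \<Longrightarrow> \<bar>\<nu> x \<bullet> (x - y)\<bar> \<le> C * (norm (x - y))\<^sup>2"
    using normal_bounds[OF domain compact_bd] by metis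
  show ?thesis
  proof (rule weakly_singularI[OF compact_bd _ zero_less_one])
    show "continuous_on {p. fst p \<in> S \<and> snd p \<in> S \<and> fst p \<noteq> snd p} (\<lambda>p. stokes_kernel \<Omega> (fst p) (snd p))"
      unfolding stokes_kernel_def cubic_def
      by (intro continuous_intros fst_snd_continuous continuous_normal) auto
    fix x y assume x: "x \<in> S" and y: "y \<in> S" and ne: "x \<noteq> y"
    define r where "r = norm (x - y)"
    have r: "0 < r" using ne by (simp add: r_def)
    have "\<bar>stokes_kernel \<Omega> x y $ i $ k\<bar> \<le> C / r" for i k
    proof -
      have "stokes_kernel \<Omega> x y $ i $ k = (\<Sum>j\<in>UNIV. ((x - y) $ i * (x - y) $ k / r ^ 5) * (\<nu> x $ j * (x - y) $ j))"
        unfolding stokes_kernel_def cubic_def r_def vec_lambda_beta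
        by (intro sum.cong refl) (simp add: algebra_simps)
      also have "\<dots> = ((x - y) $ i * (x - y) $ k / r ^ 5) * (\<nu> x \<bullet> (x - y))"
        by (simp only: sum_distrib_left[symmetric] inner_vec_def inner_real_def)
      finally have eq: "\<bar>stokes_kernel \<Omega> x y $ i $ k\<bar> = (\<bar>(x - y) $ i\<bar> * \<bar>(x - y) $ k\<bar> / r ^ 5) * \<bar>\<nu> x \<bullet> (x - y)\<bar>"
        using r by (simp add: abs_mult)
      have comp: "\<bar>(x - y) $ l\<bar> \<le> r" for l unfolding r_def by (rule component_le_norm_cart)
      have "\<bar>(x - y) $ i\<bar> * \<bar>(x - y) $ k\<bar> / r ^ 5 \<le> r * r / r ^ 5"
        using r comp by (intro divide_right_mono mult_mono) auto
      then have "\<bar>stokes_kernel \<Omega> x y $ i $ k\<bar> \<le> (r * r / r ^ 5) * (C * r\<^sup>2)"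
        unfolding eq using r flat[OF x y] by (intro mult_mono) (auto simp: r_def)
      also have "\<dots> = C / r" using r by (simp add: field_simps eval_nat_numeral)
      finally show ?thesis .
    qed
    then have "norm (stokes_kernel \<Omega> x y) \<le> 9 * (C / r)" by (rule norm_matrix_le)
    then show "norm (stokes_kernel \<Omega> x y) \<le> (9 * C) / norm (x - y)" by (simp add: r_def)
  qed
qed

lemma displaced_continuous: "continuous_on (S \<times> S) (\<lambda>p. displaced_kernel \<Omega> h (fst p) (snd p))"
  unfolding displaced_kernel_def cubic_def
  by (intro continuous_intros fst_snd_continuous continuous_normal continuous_displaced)
    (use off_displaced in auto)

lemma dipole_continuous: "continuous_on (S \<times> S) (\<lambda>p. displaced_dipole_kernel \<Omega> h (fst p) (snd p))"
proof (rule continuous_on_eq)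
  show "continuous_on (S \<times> S) (\<lambda>p. \<chi> i k. \<Sum>j\<in>UNIV. h (snd p) * \<nu> (fst p) $ j *
      cubic1 (\<nu> (snd p)) i j k (fst p - disp (snd p)))"
    unfolding cubic1_def
    by (intro continuous_intros fst_snd_continuous continuous_normal continuous_displaced continuous_h)
      (use off_displaced in auto)
  show "(\<chi> i k. \<Sum>j\<in>UNIV. h (snd p) * \<nu> (fst p) $ j * cubic1 (\<nu> (snd p)) i j k (fst p - disp (snd p)))
      = displaced_dipole_kernel \<Omega> h (fst p) (snd p)" if "p \<in> S \<times> S" for p
    using that by (simp add: dipole_eq mem_Times_iff)
qed

lemma remainder_weakly_singular: "weakly_singular S (remainder_kernel \<Omega> h)"
proof -
  obtain C where C: "0 < C"
    and lip: "\<And>x y. x \<in> S \<Longrightarrow> y \<in> S \<Longrightarrow> norm (\<nu> x - \<nu> y) \<le> C * norm (x - y)"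
    and flat: "\<And>x y. x \<in> S \<Longrightarrow> y \<in> S \<Longrightarrow> \<bar>\<nu> x \<bullet> (x - y)\<bar> \<le> C * (norm (x - y))\<^sup>2"
    using normal_bounds[OF domain compact_bd] by metis
  show ?thesis
  proof (rule weakly_singularI[OF compact_bd])
    show "continuous_on {p. fst p \<in> S \<and> snd p \<in> S \<and> fst p \<noteq> snd p} (\<lambda>p. remainder_kernel \<Omega> h (fst p) (snd p))"
      by (rule remainder_kernel_continuous)
        (use h_pos off_segment in \<open>auto intro: fst_snd_continuous continuous_normal continuous_h\<close>)
    \<comment> \<open>At this distance C |x - y| <= 1/2, so the quadratic bound on the normal
      component becomes the flatness that \<open>remainder_kernel_bound\<close> needs.\<close>
    show "0 < 1 / (2 * C)" using C by simp
    fix x y assume x: "x \<in> S" and y: "y \<in> S" and ne: "x \<noteq> y" and near: "norm (x - y) < 1 / (2 * C)"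
    have "\<bar>(x - y) \<bullet> \<nu> y\<bar> = \<bar>\<nu> y \<bullet> (y - x)\<bar>"
      by (simp add: inner_diff inner_commute abs_minus_commute)
    also have "\<dots> \<le> C * (norm (x - y))\<^sup>2" using flat[OF y x] by (simp add: norm_minus_commute)
    also have "\<dots> = (C * norm (x - y)) * norm (x - y)" by (simp add: power2_eq_square)
    also have "\<dots> \<le> (1 / 2) * norm (x - y)"
      using near C by (intro mult_right_mono) (auto simp: field_simps)
    finally have fl: "\<bar>(x - y) \<bullet> \<nu> y\<bar> \<le> norm (x - y) / 2" by simp
    show "norm (remainder_kernel \<Omega> h x y) \<le> (9 * (1152 * C)) / norm (x - y)"
      by (rule remainder_kernel_bound[where C = C and \<Omega> = \<Omega> and h = h and x = x and y = y, OF lip[OF x y] unit[OF y] less_imp_le[OF h_pos[OF y]] ne off_segment[OF x y ne] fl])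
  qed
qed

lemma Sigma_weakly_singular:
  assumes "elastic lam mu"
  shows "weakly_singular S (Sigma_B \<Omega> lam mu h)"
proof (rule weakly_singular_cong)
  show "weakly_singular S (\<lambda>x y. (- 3 / (2 * pi)) *\<^sub>R stokes_kernel \<Omega> x y + (3 / (2 * pi)) *\<^sub>R displaced_kernel \<Omega> h x y
    + (- 3 / (2 * pi)) *\<^sub>R displaced_dipole_kernel \<Omega> h x y
    + ((1 - lame_alpha lam mu) / lame_alpha lam mu) *\<^sub>R remainder_kernel \<Omega> h x y)"
    by (intro weakly_singular_add weakly_singular_scale stokes_weakly_singular remainder_weakly_singular
        weakly_singular_continuous[OF compact_bd displaced_continuous]
        weakly_singular_continuous[OF compact_bd dipole_continuous])
qed (simp add: Sigma_B_eq[OF assms])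

section \<open>The integral operators and the limit\<close>

abbreviation "M \<equiv> surface_measure \<Omega>"

lemma upper_regular: "\<exists>c. upper_regular_measure M S c"
proof -
  obtain c where "0 < c" "\<forall>x\<in>S. \<forall>r>0. emeasure M (S \<inter> ball x r) \<le> ennreal (c * r\<^sup>2)"
    using surface_measure_growth(2)[OF domain compact_bd] by blast
  then show ?thesis
    using sets_surface_measure compact_bd surface_measure_growth(1)[OF domain compact_bd]
    by (intro exI[of _ c] upper_regular_measure.intro) auto
qed

lemma compact_kernel: "weakly_singular S k \<Longrightarrow> L2_compact_kernel M k"
  using upper_regular upper_regular_measure.weakly_singular_compact by blast

lemma point_null: "{x} \<inter> space M \<in> null_sets M"
  using upper_regular upper_regular_measure.singleton_null by blast

lemmas kernels =
  compact_kernel[OF stokes_weakly_singular]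
  compact_kernel[OF weakly_singular_continuous[OF compact_bd displaced_continuous]]
  compact_kernel[OF weakly_singular_continuous[OF compact_bd dipole_continuous]]
  compact_kernel[OF remainder_weakly_singular]

lemma L2_kernel_integrable:
  "L2_compact_kernel M k \<Longrightarrow> \<rho> \<in> L2 M \<Longrightarrow> AE x in M. integrable M (\<lambda>y. k x y *v \<rho> y)"
  by (simp add: L2_compact_kernel_def L2_kernel_def)

lemma L2_kernel_bounded: "L2_compact_kernel M k \<Longrightarrow> L2_bounded M (kernel_op M k)"
  by (simp add: L2_compact_kernel_def L2_kernel_def)

lemma L2_compact_kernelD: "L2_compact_kernel N k \<Longrightarrow> L2_kernel N k"
  by (simp add: L2_compact_kernel_def)

lemma E_alpha_bounded:
  assumes "elastic lam mu"
  shows "L2_bounded M (E_alpha \<Omega> lam mu h)"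
proof -
  have "E_alpha \<Omega> lam mu h = (\<lambda>\<rho> x. \<rho> x + kernel_op M (Sigma_B \<Omega> lam mu h) \<rho> x)"
    by (simp add: fun_eq_iff E_alpha_def)
  then show ?thesis
    using L2_bounded_add[OF L2_bounded_id L2_kernel_bounded[OF compact_kernel[OF Sigma_weakly_singular[OF assms]]]]
    by simp
qed

lemma E_one_bounded: "L2_bounded M (E_one \<Omega> h)"
proof -
  have "E_one \<Omega> h = (\<lambda>\<rho> x. (\<rho> x - (3 / (2 * pi)) *\<^sub>R kernel_op M (stokes_kernel \<Omega>) \<rho> x)
      - ((- 3 / (2 * pi)) *\<^sub>R kernel_op M (displaced_kernel \<Omega> h) \<rho> x
         + (3 / (2 * pi)) *\<^sub>R kernel_op M (displaced_dipole_kernel \<Omega> h) \<rho> x))"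
    by (simp add: fun_eq_iff E_one_def stokes_op_def E1_rhs_def)
  then show ?thesis
    by (simp only:) (intro L2_bounded_diff L2_bounded_add L2_bounded_scale L2_bounded_id L2_kernel_bounded kernels)
qed

lemma E_alpha_minus_E_one:
  assumes el: "elastic lam mu" and \<rho>: "\<rho> \<in> L2 M"
  shows "AE x in M. E_alpha \<Omega> lam mu h \<rho> x - E_one \<Omega> h \<rho> x =
    ((1 - lame_alpha lam mu) / lame_alpha lam mu) *\<^sub>R kernel_op M (remainder_kernel \<Omega> h) \<rho> x"
proof -
  define a c where "a = - 3 / (2 * pi)" and "c = (1 - lame_alpha lam mu) / lame_alpha lam mu"
  have a': "3 / (2 * pi) = - a" by (simp add: a_def)
  note int = kernels[THEN L2_kernel_integrable, OF \<rho>]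
  show ?thesis
    using int AE_space
  proof eventually_elim
    case (elim x)
    have x: "x \<in> S" using elim by (simp add: space_surface_measure)
    define g where "g y = a *\<^sub>R (stokes_kernel \<Omega> x y *v \<rho> y) + (- a) *\<^sub>R (displaced_kernel \<Omega> h x y *v \<rho> y)
        + a *\<^sub>R (displaced_dipole_kernel \<Omega> h x y *v \<rho> y) + c *\<^sub>R (remainder_kernel \<Omega> h x y *v \<rho> y)" for y
    \<comment> \<open>The kernel identity fails to cover y = x and y outside S.
      \<open>integral_cong_off_point\<close> compares functions at every other y, even outside the
      space, so the exceptions are removed one at a time: the point as a null set, the exterior by
      congruence on the space.\<close>
    have "kernel_op M (Sigma_B \<Omega> lam mu h) \<rho> x = (\<integral>y. (if y = x \<or> y \<notin> S then Sigma_B \<Omega> lam mu h x y *v \<rho> y else g y) \<partial>M)"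
      unfolding kernel_op_def
    proof (rule Bochner_Integration.integral_cong[OF refl])
      fix y assume "y \<in> space M"
      then have y: "y \<in> S" by (simp add: space_surface_measure)
      have "Sigma_B \<Omega> lam mu h x y *v \<rho> y = g y" if "y \<noteq> x"
        unfolding Sigma_B_eq[OF el x y that[symmetric]] g_def a_def[symmetric] c_def[symmetric] a'
        by (simp only: matrix_vector_mult_add_rdistrib scaleR_matrix_vector_assoc)
      then show "Sigma_B \<Omega> lam mu h x y *v \<rho> y =
          (if y = x \<or> y \<notin> S then Sigma_B \<Omega> lam mu h x y *v \<rho> y else g y)"
        by simp
    qed
    also have "\<dots> = (\<integral>y. (if y \<notin> S then Sigma_B \<Omega> lam mu h x y *v \<rho> y else g y) \<partial>M)"
      by (rule integral_cong_off_point(2)[OF point_null[of x]]) simp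
    also have "\<dots> = (\<integral>y. g y \<partial>M)"
      by (rule Bochner_Integration.integral_cong[OF refl]) (simp add: space_surface_measure)
    also have "\<dots> = a *\<^sub>R kernel_op M (stokes_kernel \<Omega>) \<rho> x + (- a) *\<^sub>R kernel_op M (displaced_kernel \<Omega> h) \<rho> x
        + a *\<^sub>R kernel_op M (displaced_dipole_kernel \<Omega> h) \<rho> x + c *\<^sub>R kernel_op M (remainder_kernel \<Omega> h) \<rho> x"
      unfolding g_def kernel_op_def using elim
      by (simp add: Bochner_Integration.integral_add Bochner_Integration.integral_scaleR_right
          Bochner_Integration.integral_diff Bochner_Integration.integral_minus)
    finally have "kernel_op M (Sigma_B \<Omega> lam mu h) \<rho> x = \<dots>" .
    then show ?case
      by (simp add: E_alpha_def E_one_def stokes_op_def E1_rhs_def a' c_def)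
  qed
qed

lemma E_alpha_close:
  "\<exists>C>0. \<forall>lam mu. elastic lam mu \<longrightarrow> (\<forall>\<rho>\<in>L2 M.
     L2_norm M (\<lambda>x. E_alpha \<Omega> lam mu h \<rho> x - E_one \<Omega> h \<rho> x)
       \<le> C * (1 - lame_alpha lam mu) * L2_norm M \<rho>)"
proof -
  obtain C where C: "0 < C" "\<And>\<rho>. \<rho> \<in> L2 M \<Longrightarrow> L2_norm M (kernel_op M (remainder_kernel \<Omega> h) \<rho>) \<le> C * L2_norm M \<rho>"
    using L2_boundedE[OF L2_kernel_bounded[OF kernels(4)]] by blast
  have "L2_norm M (\<lambda>x. E_alpha \<Omega> lam mu h \<rho> x - E_one \<Omega> h \<rho> x) \<le> (4 * C) * (1 - lame_alpha lam mu) * L2_norm M \<rho>"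
    if el: "elastic lam mu" and \<rho>: "\<rho> \<in> L2 M" for lam mu \<rho>
  proof -
    define \<alpha> where "\<alpha> = lame_alpha lam mu"
    have \<alpha>: "1 / 4 < \<alpha>" "\<alpha> < 1" using el by (auto simp: elastic_def \<alpha>_def)
    have R: "kernel_op M (remainder_kernel \<Omega> h) \<rho> \<in> L2 M"
      by (rule L2_linear_L2[OF L2_bounded_linear[OF L2_kernel_bounded[OF kernels(4)]] \<rho>])
    have EL: "(\<lambda>x. E_alpha \<Omega> lam mu h \<rho> x - E_one \<Omega> h \<rho> x) \<in> L2 M"
      by (rule L2_diff(1)[OF L2_linear_L2[OF L2_bounded_linear[OF E_alpha_bounded[OF el]] \<rho>]
            L2_linear_L2[OF L2_bounded_linear[OF E_one_bounded] \<rho>]])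
    have "L2_norm M (\<lambda>x. E_alpha \<Omega> lam mu h \<rho> x - E_one \<Omega> h \<rho> x) =
        L2_norm M (\<lambda>x. ((1 - \<alpha>) / \<alpha>) *\<^sub>R kernel_op M (remainder_kernel \<Omega> h) \<rho> x)"
      unfolding \<alpha>_def
      by (rule L2_norm_cong_AE[OF EL L2_scale(1)[OF R] E_alpha_minus_E_one[OF el \<rho>]])
    also have "\<dots> = (1 - \<alpha>) / \<alpha> * L2_norm M (kernel_op M (remainder_kernel \<Omega> h) \<rho>)"
      using \<alpha> by (simp add: L2_scale(2)[OF R])
    also have "\<dots> \<le> (4 * (1 - \<alpha>)) * (C * L2_norm M \<rho>)"
    proof (rule mult_mono)
      \<comment> \<open>The lower bound 1/4 on \<alpha> makes the constant uniform in the Lame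
        parameters.\<close>
      have "1 / \<alpha> \<le> 4" using \<alpha> by (simp add: field_simps)
      then have "(1 - \<alpha>) * (1 / \<alpha>) \<le> (1 - \<alpha>) * 4" using \<alpha> by (intro mult_left_mono) auto
      then show "(1 - \<alpha>) / \<alpha> \<le> 4 * (1 - \<alpha>)" by simp
    qed (use \<alpha> C \<rho> in \<open>auto simp: L2_norm_nonneg\<close>)
    finally show ?thesis by (simp add: \<alpha>_def mult_ac)
  qed
  then show ?thesis using C(1) by (intro exI[of _ "4 * C"]) auto
qed

lemma opnorm_tendsto:
  "((\<lambda>(lam, mu). L2_opnorm M (\<lambda>\<rho> x. E_alpha \<Omega> lam mu h \<rho> x - E_one \<Omega> h \<rho> x)) \<longlongrightarrow> 0)
      (filtercomap (\<lambda>(lam, mu). lame_alpha lam mu) (at_left 1))"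
proof -
  obtain C where C: "0 < C" and close: "\<forall>lam mu. elastic lam mu \<longrightarrow> (\<forall>\<rho>\<in>L2 M.
     L2_norm M (\<lambda>x. E_alpha \<Omega> lam mu h \<rho> x - E_one \<Omega> h \<rho> x) \<le> C * (1 - lame_alpha lam mu) * L2_norm M \<rho>)"
    using E_alpha_close by (elim exE conjE)
  note close = close[rule_format]
  let ?F = "filtercomap (\<lambda>(lam, mu). lame_alpha lam mu) (at_left 1)"
  have op: "L2_opnorm M (\<lambda>\<rho> x. E_alpha \<Omega> lam mu h \<rho> x - E_one \<Omega> h \<rho> x) \<le> ennreal (C * (1 - lame_alpha lam mu))"
    if el: "elastic lam mu" for lam mu
    unfolding L2_opnorm_def
  proof (rule SUP_least)
    fix \<rho> assume "\<rho> \<in> {f \<in> L2 M. L2_norm M f \<le> 1}"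
    then have \<rho>: "\<rho> \<in> L2 M" "L2_norm M \<rho> \<le> 1" by auto
    have "C * (1 - lame_alpha lam mu) * L2_norm M \<rho> \<le> C * (1 - lame_alpha lam mu) * 1"
      using \<rho>(2) C el by (intro mult_left_mono) (auto simp: elastic_def)
    then show "ennreal (L2_norm M (\<lambda>x. E_alpha \<Omega> lam mu h \<rho> x - E_one \<Omega> h \<rho> x)) \<le> ennreal (C * (1 - lame_alpha lam mu))"
      using close[OF el \<rho>(1)] by (intro ennreal_leI) simp
  qed
  have ev: "\<forall>\<^sub>F p in ?F. 1 / 4 < lame_alpha (fst p) (snd p) \<and> lame_alpha (fst p) (snd p) < 1"
    unfolding eventually_filtercomap
  proof (intro exI conjI allI impI)
    show "\<forall>\<^sub>F x in at_left (1::real). 1 / 4 < x \<and> x < 1"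
      by (rule eventually_conj) (auto simp: eventually_at_left_field intro: exI[of _ "1/4"])
  qed (auto simp: case_prod_unfold)
  have lim: "((\<lambda>p. ennreal (C * (1 - lame_alpha (fst p) (snd p)))) \<longlongrightarrow> ennreal (C * (1 - 1))) ?F"
  proof (intro tendsto_intros)
    have "filterlim (\<lambda>(lam, mu). lame_alpha lam mu) (at_left 1) ?F" by (rule filterlim_filtercomap)
    then show "((\<lambda>p. lame_alpha (fst p) (snd p)) \<longlongrightarrow> 1) ?F"
      unfolding filterlim_at by (simp add: case_prod_unfold)
  qed
  have "((\<lambda>p. L2_opnorm M (\<lambda>\<rho> x. E_alpha \<Omega> (fst p) (snd p) h \<rho> x - E_one \<Omega> h \<rho> x)) \<longlongrightarrow> 0) ?F"
  proof (rule tendsto_sandwich[OF _ _ tendsto_const])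
    show "\<forall>\<^sub>F p in ?F. 0 \<le> L2_opnorm M (\<lambda>\<rho> x. E_alpha \<Omega> (fst p) (snd p) h \<rho> x - E_one \<Omega> h \<rho> x)" by simp
    show "\<forall>\<^sub>F p in ?F. L2_opnorm M (\<lambda>\<rho> x. E_alpha \<Omega> (fst p) (snd p) h \<rho> x - E_one \<Omega> h \<rho> x)
        \<le> ennreal (C * (1 - lame_alpha (fst p) (snd p)))"
      using ev by eventually_elim (rule op, simp add: elastic_def)
    show "((\<lambda>p. ennreal (C * (1 - lame_alpha (fst p) (snd p)))) \<longlongrightarrow> 0) ?F" using lim by simp
  qed
  then show ?thesis by (simp add: case_prod_unfold)
qed

lemma invertible_near_one:
  assumes inv: "L2_invertible M (E_one \<Omega> h)"
  shows "\<exists>a0<1. \<forall>lam mu. a0 < lame_alpha lam mu \<and> lame_alpha lam mu < 1 \<longrightarrow> L2_invertible M (E_alpha \<Omega> lam mu h)"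
proof -
  obtain C where C: "0 < C" and close: "\<forall>lam mu. elastic lam mu \<longrightarrow> (\<forall>\<rho>\<in>L2 M.
     L2_norm M (\<lambda>x. E_alpha \<Omega> lam mu h \<rho> x - E_one \<Omega> h \<rho> x) \<le> C * (1 - lame_alpha lam mu) * L2_norm M \<rho>)"
    using E_alpha_close by (elim exE conjE)
  note close = close[rule_format]
  obtain \<epsilon> where \<epsilon>: "0 < \<epsilon>" and pert: "\<forall>A'. L2_bounded M A' \<and>
      (\<forall>f\<in>L2 M. L2_norm M (\<lambda>x. A' f x - E_one \<Omega> h f x) \<le> \<epsilon> * L2_norm M f) \<longrightarrow> L2_invertible M A'"
    using L2_invertible_perturbation[OF inv] by (elim exE conjE)
  \<comment> \<open>1/4 keeps the parameters elastic, and 1 - \<epsilon> / C ensures C (1 -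
    \<alpha>) <= \<epsilon>.\<close>
  define a0 where "a0 = max (1 / 4) (1 - \<epsilon> / C)"
  have "a0 < 1" using \<epsilon> C by (simp add: a0_def)
  moreover have "L2_invertible M (E_alpha \<Omega> lam mu h)" if a: "a0 < lame_alpha lam mu" "lame_alpha lam mu < 1" for lam mu
  proof (rule pert[rule_format], intro conjI ballI)
    have el: "elastic lam mu" using a by (simp add: elastic_def a0_def)
    then show "L2_bounded M (E_alpha \<Omega> lam mu h)" by (rule E_alpha_bounded)
  next
    have el: "elastic lam mu" using a by (simp add: elastic_def a0_def)
    fix f assume f: "f \<in> L2 M"
    have "1 - lame_alpha lam mu \<le> \<epsilon> / C" using a(1) by (simp add: a0_def)
    then have "C * (1 - lame_alpha lam mu) \<le> \<epsilon>" using C by (simp add: field_simps)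
    then have "C * (1 - lame_alpha lam mu) * L2_norm M f \<le> \<epsilon> * L2_norm M f"
      by (rule mult_right_mono) (rule L2_norm_nonneg)
    then show "L2_norm M (\<lambda>x. E_alpha \<Omega> lam mu h f x - E_one \<Omega> h f x) \<le> \<epsilon> * L2_norm M f"
      using close[OF el f] by simp
  qed
  ultimately show ?thesis by blast
qed

lemma compact_perturbation:
  assumes "elastic lam mu"
  shows "L2_compact M (\<lambda>\<rho> x. E_alpha \<Omega> lam mu h \<rho> x - stokes_op \<Omega> \<rho> x)"
proof -
  have "(\<lambda>\<rho> x. E_alpha \<Omega> lam mu h \<rho> x - stokes_op \<Omega> \<rho> x) =
    (\<lambda>\<rho> x. kernel_op M (Sigma_B \<Omega> lam mu h) \<rho> x + (3 / (2 * pi)) *\<^sub>R kernel_op M (stokes_kernel \<Omega>) \<rho> x)"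
    by (simp add: fun_eq_iff E_alpha_def stokes_op_def)
  moreover have "L2_compact M (kernel_op M (Sigma_B \<Omega> lam mu h))" "L2_compact M (kernel_op M (stokes_kernel \<Omega>))"
    using compact_kernel[OF Sigma_weakly_singular[OF assms]] kernels(1)
    by (simp_all add: L2_compact_kernel_def)
  ultimately show ?thesis
    by (simp only:) (intro L2_compact_add L2_compact_scale)
qed

lemma traction_splitting:
  assumes el: "elastic lam mu"
  shows "\<exists>Khat :: real^3 \<Rightarrow> real^3 \<Rightarrow> real^3^3.
      (\<forall>x\<in>S. \<forall>y\<in>S. x \<notin> half_line y (\<nu> y) \<longrightarrow> (\<forall>j k. Sigma_B \<Omega> lam mu h x y $ j $ k =
         2 * (\<Sum>i\<in>UNIV. \<nu> x $ i * (T_S i j k x y - T_S i j k x (disp y)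
            + h y * (\<nu> y \<bullet> grad (T_S i j k x) (disp y))))
         + (1 - lame_alpha lam mu) * Khat x y $ j $ k)) \<and>
      L2_compact_kernel M Khat"
proof (intro exI conjI ballI impI allI)
  fix x y j k assume x: "x \<in> S" and y: "y \<in> S" and off: "x \<notin> half_line y (\<nu> y)"
  have "y \<in> half_line y (\<nu> y)" by (auto simp: half_line_def intro!: exI[of _ 0])
  then have "x \<noteq> y" using off by blast
  \<comment> \<open>This instantiates the witness as the remainder kernel divided by \<alpha>, since
    (1 - \<alpha>) / \<alpha> is to be split off as the factor 1 - \<alpha>.\<close>
  then show "Sigma_B \<Omega> lam mu h x y $ j $ k =
         2 * (\<Sum>i\<in>UNIV. \<nu> x $ i * (T_S i j k x y - T_S i j k x (disp y)
            + h y * (\<nu> y \<bullet> grad (T_S i j k x) (disp y))))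
         + (1 - lame_alpha lam mu) * ((1 / lame_alpha lam mu) *\<^sub>R remainder_kernel \<Omega> h x y) $ j $ k"
    by (rule Sigma_B_traction[OF el x y])
qed (intro compact_kernel weakly_singular_scale remainder_weakly_singular)

end

lemma lame_alpha_at_top:
  assumes "0 < mu"
  shows "filterlim (\<lambda>lam. lame_alpha lam mu) (at_left 1) at_top"
proof -
  have eq: "lame_alpha lam mu = 1 - mu / (lam + 2 * mu)" if "0 < lam" for lam
    using that assms by (simp add: lame_alpha_def field_simps)
  have ev: "\<forall>\<^sub>F lam in at_top. 1 - mu / (lam + 2 * mu) = lame_alpha lam mu"
    using eventually_gt_at_top[of 0] by eventually_elim (simp add: eq)
  have "filterlim (\<lambda>lam. lam + 2 * mu) at_top at_top"
    by (subst add.commute) (rule filterlim_tendsto_add_at_top[OF tendsto_const filterlim_ident])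
  then have "((\<lambda>lam. 1 - mu / (lam + 2 * mu)) \<longlongrightarrow> 1 - 0) at_top"
    by (intro tendsto_intros tendsto_divide_0[OF tendsto_const] filterlim_at_top_imp_at_infinity)
  then have "((\<lambda>lam. lame_alpha lam mu) \<longlongrightarrow> 1) at_top"
    using ev by (auto elim: Lim_transform_eventually)
  moreover have "\<forall>\<^sub>F lam in at_top. lame_alpha lam mu < 1"
    using eventually_gt_at_top[of 0] by eventually_elim (use assms in \<open>simp add: eq\<close>)
  ultimately show ?thesis
    unfolding filterlim_at by (auto elim: eventually_mono)
qed

theorem mainTheorem4:
  fixes \<Omega> :: "(real^3) set" and h :: "real^3 \<Rightarrow> real"
  assumes "smooth_domain \<Omega>" and "compact (frontier \<Omega>)"
    and "smooth_along (frontier \<Omega>) h"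
    and "\<forall>y\<in>frontier \<Omega>. 0 < h y"
    and "\<forall>y\<in>frontier \<Omega>.
           {y + t *\<^sub>R outward_normal \<Omega> y | t. t \<in> {0..h y}} \<inter> frontier \<Omega> = {y}"
  shows
    "(\<forall>lam mu. elastic lam mu \<longrightarrow>
        (\<exists>Khat :: real^3 \<Rightarrow> real^3 \<Rightarrow> real^3^3.
          (\<forall>x\<in>frontier \<Omega>. \<forall>y\<in>frontier \<Omega>. x \<notin> half_line y (outward_normal \<Omega> y) \<longrightarrow>
            (\<forall>j k. Sigma_B \<Omega> lam mu h x y $ j $ k =
               2 * (\<Sum>i\<in>UNIV. outward_normal \<Omega> x $ i *
                 (T_S i j k x y - T_S i j k x (displaced \<Omega> h y)
                  + h y * (outward_normal \<Omega> y \<bullet> grad (T_S i j k x) (displaced \<Omega> h y))))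
               + (1 - lame_alpha lam mu) * Khat x y $ j $ k)) \<and>
          L2_compact_kernel (surface_measure \<Omega>) Khat))
     \<and> (L2_kernel (surface_measure \<Omega>) (stokes_kernel \<Omega>) \<and>
        L2_kernel (surface_measure \<Omega>) (displaced_kernel \<Omega> h) \<and>
        L2_kernel (surface_measure \<Omega>) (displaced_dipole_kernel \<Omega> h))
     \<and> (\<forall>lam mu. elastic lam mu \<longrightarrow>
          L2_kernel (surface_measure \<Omega>) (Sigma_B \<Omega> lam mu h) \<and>
          L2_compact (surface_measure \<Omega>) (\<lambda>\<rho> x. E_alpha \<Omega> lam mu h \<rho> x - stokes_op \<Omega> \<rho> x))
     \<and> ((\<lambda>(lam, mu). L2_opnorm (surface_measure \<Omega>)
            (\<lambda>\<rho> x. E_alpha \<Omega> lam mu h \<rho> x - E_one \<Omega> h \<rho> x)) \<longlongrightarrow> 0)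
          (filtercomap (\<lambda>(lam, mu). lame_alpha lam mu) (at_left 1))
     \<and> (\<forall>mu>0. ((\<lambda>lam. L2_opnorm (surface_measure \<Omega>)
            (\<lambda>\<rho> x. E_alpha \<Omega> lam mu h \<rho> x - E_one \<Omega> h \<rho> x)) \<longlongrightarrow> 0) at_top)
     \<and> (L2_invertible (surface_measure \<Omega>) (E_one \<Omega> h) \<longrightarrow>
          (\<exists>a0<1. \<forall>lam mu. a0 < lame_alpha lam mu \<and> lame_alpha lam mu < 1 \<longrightarrow>
             L2_invertible (surface_measure \<Omega>) (E_alpha \<Omega> lam mu h)))"
proof -
  interpret coated_domain \<Omega> h
    using assms by unfold_locales blast+
  have limit: "((\<lambda>lam. L2_opnorm (surface_measure \<Omega>) (\<lambda>\<rho> x. E_alpha \<Omega> lam mu h \<rho> x - E_one \<Omega> h \<rho> x)) \<longlongrightarrow> 0) at_top"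
    if mu: "0 < mu" for mu
  proof -
    have "filterlim (\<lambda>lam. (lam, mu)) (filtercomap (\<lambda>(lam, mu). lame_alpha lam mu) (at_left 1)) at_top"
      unfolding filterlim_filtercomap_iff using lame_alpha_at_top[OF mu] by (simp add: o_def)
    from filterlim_compose[OF opnorm_tendsto this] show ?thesis by simp
  qed
  show ?thesis
    by (intro conjI allI impI traction_splitting kernels(1-3)[THEN L2_compact_kernelD]
        compact_kernel[OF Sigma_weakly_singular, THEN L2_compact_kernelD] compact_perturbation
        opnorm_tendsto limit invertible_near_one)
qed

end
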